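(* For positive $\theta$ and $q$, let $\mu_{\theta,\theta-q}$ be a random measure with law $\mathcal{BG}(d\mu|\theta H,\theta-q)$, and let $\mu_\theta$ denote a gamma process with shape $\theta H$. Then the following distributional equalities hold, where $\mathcal L(Z)$ denotes the law of $Z$. (i) For all $\theta>0$ and $q>0$ and any integer $n\ge 0$ chosen such that $\theta+n-q>0$, $$\mathcal L(\mu_{\theta,\theta-q})=\mathcal L\Big(U_{q,\theta+n-q}\,\mu_\theta+U_{q,\theta+n-q}\sum_{j=1}^{n(\mathbf p)}G_{j,n}\delta_{Y^*_j}\Big),$$ where $\mathbf p$ is a random partition of $\{1,\dots,n\}$ with distribution $\pi(\mathbf p|\theta)$ and, conditional on $\mathbf p$, the distinct variables on the right-hand side are mutually independent with: $U_{q,\theta+n-q}$ a beta random variable with parameters $(q,\theta+n-q)$; $\mu_\theta$ a gamma process with shape $\theta H$; $G_{j,n}$, $j=1,\dots,n(\mathbf p)$, independent gamma random variables with shape $e_{j,n}$ and scale $1$; and $Y^*_j$, $j=1,\dots,n(\mathbf p)$, i.i.d. with law $H$. (ii) For $\theta-q>0$, $\mathcal L(\mu_{\theta,\theta-q})=\mathcal L(U_{q,\theta-q}\,\mu_\theta)$, where $U_{q,\theta-q}$ is a beta random variable with parameters $(q,\theta-q)$ independent of $\mu_\theta$. (iii) For all positive $\theta$ and $q$, $\mathcal L(\mu_{\theta,\theta-q})=\mathcal L(T_qP_\theta)$, where $T_q$ is a gamma random variable with shape $q$ and scale $1$, independent of $P_\theta$, which is a Dirichlet process with shape $\theta H$.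 (iv) For all positive $\theta$ and $q$, $\mathcal L(T_\theta\,\mu_{\theta,\theta-q})=\mathcal L(T_q\,\mu_\theta)$, where $T_\theta$ is a gamma random variable with shape $\theta$ and scale $1$ independent of $\mu_{\theta,\theta-q}$, and $T_q$ is a gamma random variable with shape $q$ and scale $1$ independent of $\mu_\theta$.
   Context: $\mathcal Y$ is a Polish space, $\mathcal M$ is the space of boundedly finite measures on $\mathcal Y$, and $H$ is a fixed non-atomic probability measure on $\mathcal Y$. Gamma process: $\mathcal G(d\mu|\theta H)$ is the law on $\mathcal M$ of the gamma process $\mu$ with shape $\theta H$, i.e. the random measure with independent values on disjoint sets and $\mu(A)$ gamma distributed with shape $\theta H(A)$ and scale $1$. Write $T=\mu(\mathcal Y)$. The Dirichlet process with shape $\theta H$ is the random probability measure $P=\mu/T$ when $\mu$ has law $\mathcal G(d\mu|\theta H)$. Beta-gamma process: for $\theta,q>0$, $$\mathcal{BG}(d\mu|\theta H,\theta-q)=\frac{\Gamma(\theta)}{\Gamma(q)}T^{-(\theta-q)}\mathcal G(d\mu|\theta H),$$ a probability law on $\mathcal M$. Partitions: $\mathbf p=\{C_1,\dots,C_{n(\mathbf p)}\}$ denotes a partition of $\{1,\dots,n\}$ into $n(\mathbf p)$ nonempty cells, $e_{j,n}$ is the size of $C_j$, and $$\pi(\mathbf p|\theta)=\frac{\Gamma(\theta)}{\Gamma(\theta+n)}\theta^{n(\mathbf p)}\prod_{j=1}^{n(\mathbf p)}\Gamma(e_{j,n}).$$ For $n=0$ there is only the empty partition, with $\pi=1$ and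 the sum over $j$ equal to $0$. A beta random variable with parameters $(a,b)$ has density proportional to $u^{a-1}(1-u)^{b-1}$ on $(0,1)$. *)

theory Defs
  imports "HOL-Probability.Probability"
begin

definition non_atomic :: "'y measure \<Rightarrow> bool" where
  "non_atomic H \<longleftrightarrow> (\<forall>A\<in>sets H. 0 < emeasure H A \<longrightarrow>
     (\<exists>B\<in>sets H. B \<subseteq> A \<and> 0 < emeasure H B \<and> emeasure H B < emeasure H A))"

definition boundedly_finite :: "'y::polish_space measure \<Rightarrow> bool" where
  "boundedly_finite m \<longleftrightarrow> sets m = sets borel \<and>
     (\<forall>A\<in>sets borel. bounded A \<longrightarrow> emeasure m A < \<infinity>)"

text \<open>The measurable space of boundedly finite measures, with the \<open>\<sigma>\<close>-algebra generated by
  the evaluations \<open>m \<mapsto> m(A)\<close>, \<open>A\<close> Borel (as the library does in \<^const>\<open>subprob_algebra\<close>).\<close>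

definition bf_measures :: "'y::polish_space measure measure" where
  "bf_measures = (SUP A \<in> sets borel.
     vimage_algebra {m. boundedly_finite m} (\<lambda>m. emeasure m A) borel)"

definition add_measure :: "'y measure \<Rightarrow> 'y measure \<Rightarrow> 'y measure" where
  "add_measure m m' = measure_of (space m) (sets m) (\<lambda>A. emeasure m A + emeasure m' A)"

text \<open>The discrete measure \<open>\<Sum>i\<in>I. g i \<delta>\<^bsub>y i\<^esub>\<close>.\<close>

definition atoms_measure ::
    "'i set \<Rightarrow> ('i \<Rightarrow> ennreal) \<Rightarrow> ('i \<Rightarrow> 'y::topological_space) \<Rightarrow> 'y measure" where
  "atoms_measure I g y = measure_of UNIV (sets borel) (\<lambda>A. \<Sum>i\<in>I. g i * indicator A (y i))"

definition normalize_measure :: "'y measure \<Rightarrow> 'y measure" where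
  "normalize_measure m = scale_measure (1 / emeasure m (space m)) m"

definition has_law :: "'w measure \<Rightarrow> 'x measure \<Rightarrow> ('w \<Rightarrow> 'x) \<Rightarrow> 'x measure \<Rightarrow> bool" where
  "has_law \<Omega> S X L \<longleftrightarrow> X \<in> measurable \<Omega> S \<and> distr \<Omega> S X = L"

text \<open>The \<open>\<sigma>\<close>-algebra generated by a random variable.  It lets random variables with
  different target types be tested for independence.\<close>

definition gen_sigma :: "'w measure \<Rightarrow> 'x measure \<Rightarrow> ('w \<Rightarrow> 'x) \<Rightarrow> 'w set set" where
  "gen_sigma \<Omega> S X = sets (vimage_algebra (space \<Omega>) X S)"

definition indep_rvs ::
    "'w measure \<Rightarrow> 'x measure \<Rightarrow> ('w \<Rightarrow> 'x) \<Rightarrow> 'z measure \<Rightarrow> ('w \<Rightarrow> 'z) \<Rightarrow> bool" where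
  "indep_rvs \<Omega> S X S' Z \<longleftrightarrow> prob_space.indep_set \<Omega> (gen_sigma \<Omega> S X) (gen_sigma \<Omega> S' Z)"

text \<open>Scale 1.  Shape 0 is the point mass at 0, needed for \<open>\<mu>(A)\<close> when \<open>H(A) = 0\<close>.\<close>

definition gamma_dist :: "real \<Rightarrow> real measure" where
  "gamma_dist a = (if a = 0 then return borel 0
     else density lborel (\<lambda>x. ennreal (indicator {0<..} x * x powr (a - 1) * exp (- x) / Gamma a)))"

definition beta_dist :: "real \<Rightarrow> real \<Rightarrow> real measure" where
  "beta_dist a b = density lborel
     (\<lambda>u. ennreal (indicator {0<..<1} u * u powr (a - 1) * (1 - u) powr (b - 1) / Beta a b))"

text \<open>\<open>gamma_process_law \<theta> H \<G>\<close>: \<open>\<G>\<close> is the law of the gamma process with shape \<open>\<theta> H\<close>.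
  The marginals are laws of \<^typ>\<open>ennreal\<close>-valued variables because a boundedly finite measure may
  be infinite on unbounded sets.\<close>

definition gamma_process_law ::
    "real \<Rightarrow> 'y::polish_space measure \<Rightarrow> 'y measure measure \<Rightarrow> bool" where
  "gamma_process_law \<theta> H \<G> \<longleftrightarrow>
     prob_space \<G> \<and> sets \<G> = sets bf_measures \<and>
     (\<forall>A\<in>sets borel. distr \<G> borel (\<lambda>m. emeasure m A)
        = distr (gamma_dist (\<theta> * measure H A)) borel ennreal) \<and>
     (\<forall>(A :: nat \<Rightarrow> 'y set) k. (\<forall>i<k. A i \<in> sets borel) \<and> disjoint_family_on A {..<k} \<longrightarrow>
        prob_space.indep_vars \<G> (\<lambda>_. borel) (\<lambda>i m. emeasure m (A i)) {..<k})"

definition dirichlet_law :: "'y::polish_space measure measure \<Rightarrow> 'y measure measure" where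
  "dirichlet_law \<G> = distr \<G> bf_measures normalize_measure"

text \<open>For \<open>\<G>\<close> the gamma process law with shape \<open>\<theta> H\<close> this is \<open>\<B>\<G>(\<sqdot> | \<theta> H, \<theta> - q)\<close>.\<close>

definition beta_gamma_law ::
    "'y::polish_space measure measure \<Rightarrow> real \<Rightarrow> real \<Rightarrow> 'y measure measure" where
  "beta_gamma_law \<G> \<theta> q =
     density \<G> (\<lambda>m. ennreal (Gamma \<theta> / Gamma q * measure m UNIV powr (- (\<theta> - q))))"

definition partition_prob :: "real \<Rightarrow> nat \<Rightarrow> nat set set \<Rightarrow> real" where
  "partition_prob \<theta> n p =
     Gamma \<theta> / Gamma (\<theta> + real n) * \<theta> ^ card p * (\<Prod>C\<in>p. Gamma (real (card C)))"

definition random_partition :: "'w measure \<Rightarrow> real \<Rightarrow> nat \<Rightarrow> ('w \<Rightarrow> nat set set) \<Rightarrow> bool" where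
  "random_partition \<Omega> \<theta> n P \<longleftrightarrow>
     P \<in> measurable \<Omega> (count_space {p. partition_on {1..n} p}) \<and>
     (\<forall>p. partition_on {1..n} p \<longrightarrow>
        measure \<Omega> {\<omega> \<in> space \<Omega>. P \<omega> = p} = partition_prob \<theta> n p)"

text \<open>Names for the variables \<open>U\<close>, \<open>\<mu>\<close>, \<open>G\<^sub>j\<close>, \<open>Y\<^sub>j\<close>.  The latter two families are indexed by the
  cells of the partition themselves instead of by an enumeration of the cells.\<close>

datatype rv_index = IdxU | IdxMu | IdxG "nat set" | IdxY "nat set"

text \<open>On \<open>\<Omega>\<close>, the variables \<open>U\<close>, \<open>\<mu>\<close>, \<open>G C\<close>, \<open>Y C\<close> (\<open>C\<close> ranging over the cells of \<open>p\<close>) are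
  mutually independent with their prescribed laws.\<close>

definition cell_variables ::
    "'w measure \<Rightarrow> nat set set \<Rightarrow> real measure \<Rightarrow> 'y::polish_space measure measure \<Rightarrow> 'y measure \<Rightarrow>
     ('w \<Rightarrow> real) \<Rightarrow> ('w \<Rightarrow> 'y measure) \<Rightarrow> (nat set \<Rightarrow> 'w \<Rightarrow> real) \<Rightarrow> (nat set \<Rightarrow> 'w \<Rightarrow> 'y) \<Rightarrow> bool" where
  "cell_variables \<Omega> p \<B> \<G> H U \<mu> G Y \<longleftrightarrow>
     has_law \<Omega> borel U \<B> \<and>
     has_law \<Omega> bf_measures \<mu> \<G> \<and>
     (\<forall>C\<in>p. has_law \<Omega> borel (G C) (gamma_dist (real (card C)))) \<and>
     (\<forall>C\<in>p. has_law \<Omega> borel (Y C) H) \<and>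
     prob_space.indep_sets \<Omega>
       (\<lambda>i. case i of
          IdxU \<Rightarrow> gen_sigma \<Omega> borel U
        | IdxMu \<Rightarrow> gen_sigma \<Omega> bf_measures \<mu>
        | IdxG C \<Rightarrow> gen_sigma \<Omega> borel (G C)
        | IdxY C \<Rightarrow> gen_sigma \<Omega> borel (Y C))
       ({IdxU, IdxMu} \<union> IdxG ` p \<union> IdxY ` p)"

lemma space_bf_measures: "space bf_measures = {m. boundedly_finite m}"
  unfolding bf_measures_def by (subst space_Sup_eq_UN) auto

lemma measurable_emeasure_bf:
  "A \<in> sets borel \<Longrightarrow> (\<lambda>m. emeasure m A) \<in> borel_measurable bf_measures"
  unfolding bf_measures_def
  by (auto intro!: measurable_Sup1 measurable_vimage_algebra1)

lemma emeasure_add_measure: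
  assumes "sets m' = sets m" "A \<in> sets m"
  shows "emeasure (add_measure m m') A = emeasure m A + emeasure m' A"
  unfolding add_measure_def
proof (rule emeasure_measure_of_sigma)
  show "sigma_algebra (space m) (sets m)" ..
  show "positive (sets m) (\<lambda>A. emeasure m A + emeasure m' A)"
    by (simp add: positive_def)
  show "countably_additive (sets m) (\<lambda>A. emeasure m A + emeasure m' A)"
    unfolding countably_additive_def
  proof (intro allI impI)
    fix B :: "nat \<Rightarrow> _"
    assume B: "range B \<subseteq> sets m" "disjoint_family B"
    have "(\<Sum>i. emeasure m (B i)) = emeasure m (\<Union>i. B i)"
      "(\<Sum>i. emeasure m' (B i)) = emeasure m' (\<Union>i. B i)"
      using B assms by (auto intro!: suminf_emeasure)
    then show "(\<Sum>i. emeasure m (B i) + emeasure m' (B i)) = emeasure m (\<Union>i. B i) + emeasure m' (\<Union>i. B i)"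
      by (subst suminf_add[symmetric]) auto
  qed
qed fact

lemma emeasure_atoms_measure:
  fixes y :: "'i \<Rightarrow> 'y::topological_space"
  assumes "A \<in> sets borel"
  shows "emeasure (atoms_measure I g y) A = (\<Sum>i\<in>I. g i * indicator A (y i))"
  unfolding atoms_measure_def
proof (rule emeasure_measure_of_sigma)
  show "sigma_algebra UNIV (sets borel)"
    using sets.sigma_algebra_axioms[of borel] by simp
  show "positive (sets borel) (\<lambda>A. \<Sum>i\<in>I. g i * indicator A (y i))"
    by (simp add: positive_def)
  show "countably_additive (sets borel) (\<lambda>A. \<Sum>i\<in>I. g i * indicator A (y i))"
    unfolding countably_additive_def
  proof (intro allI impI)
    fix B :: "nat \<Rightarrow> 'y set"
    assume B: "range B \<subseteq> sets borel" "disjoint_family B"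
    have "(\<Sum>k. \<Sum>i\<in>I. g i * indicator (B k) (y i)) = (\<Sum>i\<in>I. \<Sum>k. g i * indicator (B k) (y i))"
      by (rule suminf_sum) simp
    also have "\<dots> = (\<Sum>i\<in>I. g i * indicator (\<Union>k. B k) (y i))"
      using B(2) by (simp add: suminf_indicator)
    finally show "(\<Sum>k. \<Sum>i\<in>I. g i * indicator (B k) (y i)) = (\<Sum>i\<in>I. g i * indicator (\<Union>k. B k) (y i))" .
  qed
qed fact

end

theory Submission
  imports Defs
begin

text \<open>Laws of random measures are compared through their Laplace functionals \<open>E e\<^sup>-\<^sup>\<mu>\<^sup>(\<^sup>f\<^sup>)\<close>, where \<open>f\<close> is a
  nonnegative step function with values \<open>c\<^sub>i\<close> on the sets \<open>A\<^sub>i\<close> of a finite Borel partition; these determine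
  the law (\<open>laplace_functional_determines_law\<close>).  The functional of the gamma process is
  \<open>\<Prod>\<^sub>i (1 + c\<^sub>i)\<close> with the exponents \<open>- \<theta> H(A\<^sub>i)\<close>.  Two properties of this product carry the proof.

  First, weighting the gamma process with \<open>e\<^sup>-\<^sup>s\<^sup>T\<close> has the same effect as scaling it with \<open>1 / (1 + s)\<close>
  (\<open>exponential_tilt_is_scaling\<close>).  Scaling does not change \<open>P = \<mu> / T\<close>, so \<open>T\<close> and \<open>P\<close> are independent
  (\<open>total_mass_indep_normalized\<close>).  The density \<open>T\<^sup>q\<^sup>-\<^sup>\<theta>\<close> of the beta-gamma process therefore affects only \<open>T\<close>,
  whose gamma law gets the shape \<open>q\<close> instead of \<open>\<theta>\<close>: the beta-gamma process is \<open>T\<^sub>q P\<close>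
  (\<open>nn_integral_beta_gamma\<close>), which is (iii).  Both sides of (iv) are then \<open>T\<^sub>\<theta> T\<^sub>q P\<close>.  Moreover a beta
  variable with parameters \<open>q\<close> and \<open>r - q\<close> times a gamma variable of shape \<open>r\<close> is a gamma variable of shape
  \<open>q\<close> (\<open>beta_times_gamma\<close>), so multiplication with such a beta variable turns the beta-gamma process with
  parameter \<open>r\<close> into the one with parameter \<open>q\<close>.  For \<open>r = \<theta>\<close>, where the beta-gamma process is the gamma process
  itself, this is (ii).

  Second, differentiating the functional \<open>n\<close> times at \<open>s = 0\<close> after replacing \<open>f\<close> by \<open>f + s\<close> computes
  \<open>E T\<^sup>n e\<^sup>-\<^sup>\<mu>\<^sup>(\<^sup>f\<^sup>)\<close>.  Every derivative either produces a new factor or acts on an existing one, just as a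
  new element of a set either forms a new cell of a partition or joins an existing one.  So the result is
  a sum over the partitions of \<open>{1..n}\<close>, in which a cell of size \<open>e\<close> contributes \<open>\<theta> \<Gamma>(e) \<integral> (1 + f)\<^sup>-\<^sup>e dH\<close>
  (\<open>moment_laplace\<close>).  Up to the factor \<open>\<theta> \<Gamma>(e)\<close>, which belongs to the probability of the partition, this
  integral is the Laplace functional of a gamma distributed atom of shape \<open>e\<close> at a point with law \<open>H\<close>.  Hence the gamma process
  together with the atoms is the beta-gamma process with parameter \<open>\<theta> + n\<close>, and (i) is the case \<open>r = \<theta> + n\<close>
  of the statement on beta multiples (\<open>law_random_partition_mixture\<close>).\<close>

section \<open>Laplace functionals determine laws of random measures\<close>

text \<open>The map \<open>x \<mapsto> e\<^sup>-\<^sup>x\<close> on \<open>[0,\<infinity>]\<close>, with value \<open>0\<close> at \<open>\<infinity>\<close>.  The evaluation of a boundedly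
  finite measure at an unbounded set may be infinite, and as this map embeds \<open>[0,\<infinity>]\<close> in \<open>[0,1]\<close>,
  Laplace transforms built from it see infinite values too.\<close>

definition expneg :: "ennreal \<Rightarrow> real" where
  "expneg x = (if x = \<infinity> then 0 else exp (- enn2real x))"

lemma expneg_nonneg [simp]: "0 \<le> expneg x"
  and expneg_le_1 [simp]: "expneg x \<le> 1"
  and expneg_0 [simp]: "expneg 0 = 1"
  by (auto simp: expneg_def)

lemma expneg_ennreal [simp]: "0 \<le> x \<Longrightarrow> expneg (ennreal x) = exp (- x)"
  by (simp add: expneg_def)

lemma expneg_add: "expneg (x + y) = expneg x * expneg y"
  by (auto simp: expneg_def exp_add[symmetric] enn2real_plus less_top)

lemma expneg_sum: "finite I \<Longrightarrow> expneg (\<Sum>i\<in>I. f i) = (\<Prod>i\<in>I. expneg (f i))"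
  by (induction I rule: finite_induct) (auto simp: expneg_add)

lemma expneg_of_nat_mult: "expneg (of_nat n * x) = expneg x ^ n"
  by (induction n) (auto simp: expneg_add distrib_right)

lemma measurable_expneg [measurable]: "expneg \<in> borel_measurable borel"
  unfolding expneg_def by measurable

lemma expneg_inverse: "(if expneg x = 0 then \<infinity> else ennreal (- ln (expneg x))) = x"
  by (cases x) (auto simp: expneg_def)

text \<open>On \<open>[0,1]\<close> the exponential series of \<open>e\<^sup>i\<^sup>t\<^sup>x\<close> may be integrated term by term, so the moments
  determine the characteristic function, and this determines the measure by Levy's theorem.\<close>

lemma moments_determine_measure:
  fixes M N :: "real measure"
  assumes M: "finite_measure M" "sets M = sets borel" "AE x in M. 0 \<le> x \<and> x \<le> 1"
    and N: "finite_measure N" "sets N = sets borel" "AE x in N. 0 \<le> x \<and> x \<le> 1"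
    and moments: "\<And>n. (\<integral>\<^sup>+x. ennreal (x ^ n) \<partial>M) = (\<integral>\<^sup>+x. ennreal (x ^ n) \<partial>N)"
  shows "M = N"
proof -
  interpret M: finite_measure M by fact
  interpret N: finite_measure N by fact
  note [measurable_cong] = M(2) N(2)
  have space[simp]: "space M = UNIV" "space N = UNIV"
    using M(2) N(2) by (auto dest: sets_eq_imp_space_eq)
  have mass: "emeasure M UNIV = emeasure N UNIV"
    using moments[of 0] by simp
  define c where "c = measure M UNIV"
  have c: "emeasure M UNIV = ennreal c" "emeasure N UNIV = ennreal c"
    using mass M.emeasure_eq_measure by (auto simp: c_def)
  show ?thesis
  proof (cases "c = 0")
    case True
    then have 0: "emeasure M UNIV = 0" "emeasure N UNIV = 0" using c by auto
    show ?thesis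
    proof (rule measure_eqI)
      fix A
      have "emeasure M A \<le> emeasure M UNIV" "emeasure N A \<le> emeasure N UNIV"
        by (rule emeasure_mono; simp add: M N)+
      then show "emeasure M A = emeasure N A" using 0 by simp
    qed (simp add: M N)
  next
    case False
    then have c0: "c > 0" by (simp add: c_def zero_less_measure_iff)
    have char: "integral\<^sup>L K (\<lambda>x. iexp (t * x))
        = (\<Sum>n. (\<i> * t) ^ n / fact n * enn2real (\<integral>\<^sup>+x. ennreal (x ^ n) \<partial>K))"
      if K: "finite_measure K" "sets K = sets borel" "AE x in K. 0 \<le> x \<and> x \<le> 1"
      for K :: "real measure" and t :: real
    proof -
      interpret K: finite_measure K by fact
      note [measurable_cong] = K(2)
      have int: "integrable K (\<lambda>x. x ^ n)" for n
        using K(3) by (intro K.integrable_const_bound[where B=1]) (auto simp: power_le_one)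
      have moment: "(\<integral>x. x ^ n \<partial>K) = enn2real (\<integral>\<^sup>+x. ennreal (x ^ n) \<partial>K)" for n
        using K(3) by (intro integral_eq_nn_integral) auto
      define f where "f n x = (\<i> * t) ^ n / fact n * complex_of_real (x ^ n)" for n x
      have f_int: "integrable K (f n)" for n
        unfolding f_def using int by (intro integrable_mult_right integrable_of_real)
      have f_norm: "norm (f n x) = \<bar>t * x\<bar> ^ n / fact n" for n x
        by (simp add: f_def norm_mult norm_power norm_divide power_mult_distrib abs_mult)
      have "(\<lambda>n. integral\<^sup>L K (f n)) sums (\<integral>x. (\<Sum>n. f n x) \<partial>K)"
      proof (rule sums_integral)
        show "AE x in K. summable (\<lambda>n. norm (f n x))"
          unfolding f_norm using summable_exp[of "\<bar>t * _\<bar>"] by (simp add: divide_inverse_commute)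
        show "summable (\<lambda>n. \<integral>x. norm (f n x) \<partial>K)"
        proof (rule summable_comparison_test')
          show "summable (\<lambda>n. inverse (fact n) * \<bar>t\<bar> ^ n * measure K (space K))"
            using summable_exp[of "\<bar>t\<bar>"] by (intro summable_mult2)
          fix n :: nat
          have "(\<integral>x. norm (f n x) \<partial>K) \<le> (\<integral>x. \<bar>t\<bar> ^ n / fact n \<partial>K)"
          proof (intro integral_mono_AE integrable_norm f_int)
            show "AE x in K. norm (f n x) \<le> \<bar>t\<bar> ^ n / fact n"
              using K(3)
            proof eventually_elim
              case (elim x)
              then show ?case
                by (auto simp: f_norm abs_mult power_mult_distrib
                    intro!: divide_right_mono mult_left_le power_le_one)
            qed
          qed simp
          then show "norm (\<integral>x. norm (f n x) \<partial>K) \<le> inverse (fact n) * \<bar>t\<bar> ^ n * measure K (space K)"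
            by (simp add: divide_inverse mult_ac)
        qed
      qed (rule f_int)
      moreover have "(\<Sum>n. f n x) = iexp (t * x)" for x
        using exp_converges[of "\<i> * complex_of_real (t * x)"]
        by (intro sums_unique[symmetric])
           (simp add: f_def scaleR_conv_of_real power_mult_distrib field_simps)
      moreover have "integral\<^sup>L K (f n)
          = (\<i> * t) ^ n / fact n * enn2real (\<integral>\<^sup>+x. ennreal (x ^ n) \<partial>K)" for n
        unfolding f_def moment[symmetric] by (simp del: of_real_power add: int)
      ultimately show ?thesis by (simp add: sums_iff)
    qed
    \<comment> \<open>Levy's theorem is about probability measures, so both measures are divided by their common mass.\<close>
    define M' N' where "M' = density M (\<lambda>_. ennreal (1 / c))" and "N' = density N (\<lambda>_. ennreal (1 / c))"
    have dist: "real_distribution M'" "real_distribution N'"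
      unfolding M'_def N'_def real_distribution_def real_distribution_axioms_def using c0
      by (auto intro!: prob_spaceI simp: emeasure_density M N c
               simp flip: ennreal_mult')
    have "M' = N'"
    proof (rule Levy_uniqueness[OF dist], rule ext)
      fix t
      show "char M' t = char N' t"
        using c0 char[OF M, of t] char[OF N, of t] unfolding char_def M'_def N'_def
        by (simp add: integral_density moments)
    qed
    moreover have "density M' (\<lambda>_. ennreal c) = M" "density N' (\<lambda>_. ennreal c) = N"
      using c0 unfolding M'_def N'_def
      by (simp_all add: density_density_eq density_1 flip: ennreal_mult')
    ultimately show ?thesis by metis
  qed
qed

text \<open>Uniqueness of the Laplace transform at integer arguments: these transforms are the moments of the
  image under \<open>expneg\<close>, which is injective.\<close>

lemma expneg_moments_determine_measure:
  fixes M N :: "ennreal measure"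
  assumes M: "finite_measure M" "sets M = sets borel"
    and N: "finite_measure N" "sets N = sets borel"
    and eq: "\<And>n. (\<integral>\<^sup>+x. ennreal (expneg (of_nat n * x)) \<partial>M) = (\<integral>\<^sup>+x. ennreal (expneg (of_nat n * x)) \<partial>N)"
  shows "M = N"
proof -
  note [measurable_cong] = M(2) N(2)
  define inv where "inv = (\<lambda>y. if y = (0::real) then \<infinity> else ennreal (- ln y))"
  have [measurable]: "inv \<in> borel_measurable borel" unfolding inv_def by measurable
  have inv: "inv (expneg x) = x" for x unfolding inv_def by (rule expneg_inverse)
  have "distr M borel expneg = distr N borel expneg"
    by (rule moments_determine_measure)
       (use eq in \<open>auto intro!: finite_measure.finite_measure_distr M N simp: AE_distr_iff
          nn_integral_distr expneg_of_nat_mult\<close>)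
  then have "distr (distr M borel expneg) borel inv = distr (distr N borel expneg) borel inv"
    by simp
  then show ?thesis
    by (simp add: distr_distr o_def inv distr_id2 M N)
qed

text \<open>Simple functions are closed under addition and finite partitions are what the gamma process is
  defined on; this passes from the former to the latter.\<close>

lemma nn_integral_simple_function_step:
  fixes g :: "'y::topological_space \<Rightarrow> ennreal"
  assumes g: "simple_function borel g" and fin: "\<And>y. g y < \<infinity>"
  obtains k :: nat and A and c :: "nat \<Rightarrow> real"
  where "\<forall>i<k. A i \<in> sets borel" "disjoint_family_on A {..<k}" "(\<Union>i<k. A i) = UNIV"
    "\<forall>i<k. 0 \<le> c i"
    "\<forall>m. sets m = sets borel \<longrightarrow> (\<integral>\<^sup>+y. g y \<partial>m) = (\<Sum>i<k. ennreal (c i) * emeasure m (A i))"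
proof -
  have fin_range: "finite (range g)" using g by (simp add: simple_function_def)
  then obtain h where h: "bij_betw h {..<card (range g)} (range g)"
    using ex_bij_betw_nat_finite[of "range g"] by (auto simp: atLeast0LessThan)
  define A where "A i = g -` {h i}" for i
  define c where "c i = enn2real (h i)" for i
  have hg: "i < card (range g) \<Longrightarrow> h i \<in> range g" for i using h by (auto simp: bij_betw_def)
  show thesis
  proof (rule that[of "card (range g)" A c])
    show "\<forall>i<card (range g). A i \<in> sets borel"
    proof (intro allI impI)
      fix i assume "i < card (range g)"
      then obtain y where "h i = g y" using hg by blast
      then show "A i \<in> sets borel" using g by (simp add: A_def simple_function_def)
    qed
    show "disjoint_family_on A {..<card (range g)}"
      using h by (auto simp: disjoint_family_on_def A_def bij_betw_def inj_on_def)
    show "(\<Union>i<card (range g). A i) = UNIV"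
    proof -
      have "\<exists>i<card (range g). g y = h i" for y
        using h unfolding bij_betw_def by (metis imageE lessThan_iff rangeI)
      then show ?thesis unfolding A_def by blast
    qed
    show "\<forall>i<card (range g). 0 \<le> c i" by (simp add: c_def)
    show "\<forall>m. sets m = sets borel \<longrightarrow>
        (\<integral>\<^sup>+y. g y \<partial>m) = (\<Sum>i<card (range g). ennreal (c i) * emeasure m (A i))"
    proof (intro allI impI)
      fix m :: "'y measure" assume m: "sets m = sets borel"
      have sp: "space m = UNIV" using m by (auto dest: sets_eq_imp_space_eq)
      have gm: "simple_function m g" using g m by (simp add: simple_function_def sp)
      have "(\<integral>\<^sup>+y. g y \<partial>m) = (\<Sum>x\<in>range g. x * emeasure m (g -` {x}))"
        by (simp add: nn_integral_eq_simple_integral[OF gm] simple_integral_def sp)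
      also have "\<dots> = (\<Sum>i<card (range g). h i * emeasure m (g -` {h i}))"
        by (rule sum.reindex_bij_betw[OF h, symmetric])
      also have "\<dots> = (\<Sum>i<card (range g). ennreal (c i) * emeasure m (A i))"
      proof (rule sum.cong[OF refl])
        fix i assume "i \<in> {..<card (range g)}"
        then have "h i < \<infinity>" using fin hg[of i] by auto
        then show "h i * emeasure m (g -` {h i}) = ennreal (c i) * emeasure m (A i)"
          by (simp add: A_def c_def)
      qed
      finally show "(\<integral>\<^sup>+y. g y \<partial>m) = (\<Sum>i<card (range g). ennreal (c i) * emeasure m (A i))" .
    qed
  qed
qed

lemma boundedly_finite_sets: "m \<in> space bf_measures \<Longrightarrow> sets m = sets borel"
  by (simp add: space_bf_measures boundedly_finite_def)

lemma boundedly_finite_space: "m \<in> space bf_measures \<Longrightarrow> space m = UNIV"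
  using sets_eq_imp_space_eq[OF boundedly_finite_sets] by simp

declare measurable_emeasure_bf [measurable]

lemma measurable_bfI:
  assumes "\<And>x. x \<in> space K \<Longrightarrow> boundedly_finite (f x)"
    and "\<And>A. A \<in> sets borel \<Longrightarrow> (\<lambda>x. emeasure (f x) A) \<in> borel_measurable K"
  shows "f \<in> measurable K bf_measures"
  unfolding bf_measures_def
  by (rule measurable_Sup2) (use assms in \<open>auto intro!: measurable_vimage_algebra2\<close>)

lemma measurable_integral_bf:
  fixes g :: "'y::polish_space \<Rightarrow> ennreal"
  assumes g: "simple_function borel g" "\<And>y. g y < \<infinity>"
  shows "(\<lambda>m. \<integral>\<^sup>+y. g y \<partial>m) \<in> borel_measurable bf_measures"
proof -
  obtain k A and c :: "nat \<Rightarrow> real" where A: "\<And>i. i < k \<Longrightarrow> A i \<in> sets borel"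
    and eq: "\<And>m. sets m = sets borel \<Longrightarrow> (\<integral>\<^sup>+y. g y \<partial>m) = (\<Sum>i<k. ennreal (c i) * emeasure m (A i))"
    using nn_integral_simple_function_step[OF g] by metis
  have "(\<lambda>m. \<Sum>i<k. ennreal (c i) * emeasure m (A i)) \<in> borel_measurable bf_measures"
    using A by measurable
  then show ?thesis
    by (subst measurable_cong[OF eq[OF boundedly_finite_sets]]) auto
qed

definition cylinder :: "nat \<Rightarrow> (nat \<Rightarrow> 'y::polish_space set) \<Rightarrow> (nat \<Rightarrow> ennreal set) \<Rightarrow> 'y measure set" where
  "cylinder k A B = {m. boundedly_finite m \<and> (\<forall>i<k. emeasure m (A i) \<in> B i)}"

text \<open>A generator of the \<open>\<sigma>\<close>-algebra that is closed under intersection.\<close>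

definition evaluation_cylinders :: "'y::polish_space measure set set" where
  "evaluation_cylinders = {cylinder k A B | k A B. \<forall>i<k. A i \<in> sets borel \<and> B i \<in> sets borel}"

lemma Int_stable_evaluation_cylinders: "Int_stable evaluation_cylinders"
proof (rule Int_stableI)
  fix a b :: "'y::polish_space measure set"
  assume "a \<in> evaluation_cylinders" "b \<in> evaluation_cylinders"
  then obtain A B k A' B' k' where
    a: "a = cylinder k A B"
      "\<forall>i<k. A i \<in> sets borel \<and> B i \<in> sets borel" and
    b: "b = cylinder k' A' B'"
      "\<forall>i<k'. A' i \<in> sets borel \<and> B' i \<in> sets borel"
    unfolding evaluation_cylinders_def by blast
  define A'' B'' where "A'' i = (if i < k then A i else A' (i - k))"
    and "B'' i = (if i < k then B i else B' (i - k))" for i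
  have split: "(\<forall>i<k+k'. Q i) \<longleftrightarrow> (\<forall>i<k. Q i) \<and> (\<forall>i<k'. Q (k + i))" for Q
    by (metis add.commute add_less_cancel_left le_Suc_ex less_diff_conv2 not_le trans_less_add1)
  have "a \<inter> b = cylinder (k + k') A'' B''"
    unfolding cylinder_def split by (auto simp: a b cylinder_def A''_def B''_def)
  moreover have "\<forall>i<k+k'. A'' i \<in> sets borel \<and> B'' i \<in> sets borel"
    unfolding split using a b by (auto simp: A''_def B''_def)
  ultimately show "a \<inter> b \<in> evaluation_cylinders"
    unfolding evaluation_cylinders_def by blast
qed

lemma sets_bf_measures_cylinders:
  "sets (bf_measures :: 'y::polish_space measure measure)
     = sigma_sets {m. boundedly_finite m} evaluation_cylinders"
proof
  let ?S = "sigma {m :: 'y measure. boundedly_finite m} evaluation_cylinders"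
  have sub: "evaluation_cylinders \<subseteq> Pow {m :: 'y measure. boundedly_finite m}"
    by (auto simp: evaluation_cylinders_def cylinder_def)
  have "(\<lambda>m. m) \<in> measurable ?S bf_measures"
  proof (rule measurable_bfI)
    fix A :: "'y set" assume A: "A \<in> sets borel"
    show "(\<lambda>m. emeasure m A) \<in> borel_measurable ?S"
    proof (rule measurableI)
      fix B :: "ennreal set" assume B: "B \<in> sets borel"
      have "(\<lambda>m. emeasure m A) -` B \<inter> space ?S
          = cylinder 1 (\<lambda>_. A) (\<lambda>_. B)"
        using sub by (auto simp: space_measure_of_conv cylinder_def)
      also have "\<dots> \<in> evaluation_cylinders"
        unfolding evaluation_cylinders_def using A B
        by (intro CollectI exI[of _ "\<lambda>_. A"] exI[of _ "\<lambda>_. B"] exI[of _ 1] conjI refl) simp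
      also have "\<dots> \<subseteq> sets ?S" using sub by auto
      finally show "(\<lambda>m. emeasure m A) -` B \<inter> space ?S \<in> sets ?S" .
    qed auto
  qed (use sub in \<open>auto simp: space_measure_of_conv\<close>)
  then have "X \<in> sets bf_measures \<Longrightarrow> (\<lambda>m. m) -` X \<inter> space ?S \<in> sets ?S" for X
    by (rule measurable_sets)
  moreover have "X \<in> sets bf_measures \<Longrightarrow> (\<lambda>m. m) -` X \<inter> space ?S = X" for X
    using sub sets.sets_into_space[of X bf_measures]
    by (auto simp: space_measure_of_conv space_bf_measures)
  ultimately show "sets bf_measures \<subseteq> sigma_sets {m :: 'y measure. boundedly_finite m} evaluation_cylinders"
    using sub by (auto simp: sets_measure_of_conv)
next
  have "evaluation_cylinders \<subseteq> sets (bf_measures :: 'y measure measure)"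
  proof
    fix X :: "'y measure set" assume "X \<in> evaluation_cylinders"
    then obtain A B k where X: "X = cylinder k A B"
      and AB: "\<forall>i<k. A i \<in> sets borel \<and> B i \<in> sets borel"
      unfolding evaluation_cylinders_def by blast
    have [measurable]: "\<And>i. i \<in> {..<k} \<Longrightarrow> A i \<in> sets borel" "\<And>i. i \<in> {..<k} \<Longrightarrow> B i \<in> sets borel"
      using AB by auto
    have "X = {m \<in> space bf_measures. \<forall>i\<in>{..<k}. emeasure m (A i) \<in> B i}"
      by (auto simp: X cylinder_def space_bf_measures)
    also have "\<dots> \<in> sets bf_measures"
      by (intro sets.sets_Collect_finite_All) auto
    finally show "X \<in> sets bf_measures" .
  qed
  then show "sigma_sets {m. boundedly_finite m} evaluation_cylinders \<subseteq> sets (bf_measures :: 'y measure measure)"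
    using sets.sigma_sets_subset[of _ "bf_measures :: 'y measure measure"] by (simp add: space_bf_measures)
qed

text \<open>The joint law of finitely many evaluations is recovered one coordinate at a time.  If some of the
  coordinates are already restricted to Borel sets and the others still enter through a Laplace
  functional, then replacing \<open>f\<close> by \<open>f + n 1\<^sub>A\<close> for all \<open>n\<close> gives all moments of \<open>expneg (m A)\<close> under the
  weighted measure.  So one-dimensional uniqueness restricts the coordinate \<open>m A\<close> as well.\<close>

theorem laplace_functional_determines_law:
  fixes P Q :: "'y::polish_space measure measure"
  assumes P: "finite_measure P" "sets P = sets bf_measures"
    and Q: "finite_measure Q" "sets Q = sets bf_measures"
    and laplace: "\<And>(k::nat) A (c :: nat \<Rightarrow> real). (\<And>i. i < k \<Longrightarrow> A i \<in> sets borel) \<Longrightarrow>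
        disjoint_family_on A {..<k} \<Longrightarrow> (\<Union>i<k. A i) = UNIV \<Longrightarrow> (\<And>i. i < k \<Longrightarrow> 0 \<le> c i) \<Longrightarrow>
        (\<integral>\<^sup>+m. ennreal (expneg (\<Sum>i<k. ennreal (c i) * emeasure m (A i))) \<partial>P)
        = (\<integral>\<^sup>+m. ennreal (expneg (\<Sum>i<k. ennreal (c i) * emeasure m (A i))) \<partial>Q)"
  shows "P = Q"
proof -
  note [measurable_cong] = P(2) Q(2)
  have spP: "space P = space bf_measures" and spQ: "space Q = space bf_measures"
    using P(2) Q(2) by (auto dest: sets_eq_imp_space_eq)
  note [measurable] = measurable_integral_bf
  have simple: "(\<integral>\<^sup>+m. ennreal (expneg (\<integral>\<^sup>+y. g y \<partial>m)) \<partial>P) = (\<integral>\<^sup>+m. ennreal (expneg (\<integral>\<^sup>+y. g y \<partial>m)) \<partial>Q)"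
    if g: "simple_function borel g" "\<And>y. g y < \<infinity>" for g :: "'y \<Rightarrow> ennreal"
  proof -
    obtain k A and c :: "nat \<Rightarrow> real" where A: "\<forall>i<k. A i \<in> sets borel"
        "disjoint_family_on A {..<k}" "(\<Union>i<k. A i) = UNIV" "\<forall>i<k. 0 \<le> c i"
      and eq: "\<forall>m. sets m = sets borel \<longrightarrow> (\<integral>\<^sup>+y. g y \<partial>m) = (\<Sum>i<k. ennreal (c i) * emeasure m (A i))"
      by (rule nn_integral_simple_function_step[OF g])
    have "(\<integral>\<^sup>+m. ennreal (expneg (\<integral>\<^sup>+y. g y \<partial>m)) \<partial>P)
        = (\<integral>\<^sup>+m. ennreal (expneg (\<Sum>i<k. ennreal (c i) * emeasure m (A i))) \<partial>P)"
      by (intro nn_integral_cong) (simp add: eq boundedly_finite_sets spP)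
    also have "\<dots> = (\<integral>\<^sup>+m. ennreal (expneg (\<Sum>i<k. ennreal (c i) * emeasure m (A i))) \<partial>Q)"
      using A by (intro laplace) auto
    also have "\<dots> = (\<integral>\<^sup>+m. ennreal (expneg (\<integral>\<^sup>+y. g y \<partial>m)) \<partial>Q)"
      by (intro nn_integral_cong) (simp add: eq boundedly_finite_sets spQ)
    finally show ?thesis .
  qed
  have mixed: "(\<integral>\<^sup>+m. (\<Prod>i<k. indicator (B i) (emeasure m (A i))) * ennreal (expneg (\<integral>\<^sup>+y. g y \<partial>m)) \<partial>P)
      = (\<integral>\<^sup>+m. (\<Prod>i<k. indicator (B i) (emeasure m (A i))) * ennreal (expneg (\<integral>\<^sup>+y. g y \<partial>m)) \<partial>Q)"
    if "simple_function borel g" "\<And>y. g y < \<infinity>"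
      "\<And>i. i < k \<Longrightarrow> A i \<in> sets borel" "\<And>i. i < k \<Longrightarrow> B i \<in> sets borel"
    for g :: "'y \<Rightarrow> ennreal" and A B and k :: nat
    using that
  proof (induction k arbitrary: g)
    case 0
    then show ?case using simple by simp
  next
    case (Suc k)
    note [measurable] = Suc.prems
    have [measurable]: "A k \<in> sets borel" "B k \<in> sets borel"
      "\<And>i. i \<in> {..<k} \<Longrightarrow> A i \<in> sets borel" "\<And>i. i \<in> {..<k} \<Longrightarrow> B i \<in> sets borel"
      using Suc.prems by auto
    \<comment> \<open>The coordinates that are already restricted, and the Laplace functional of the others, form a density.\<close>
    define w where "w m = (\<Prod>i<k. indicator (B i) (emeasure m (A i))) * ennreal (expneg (\<integral>\<^sup>+y. g y \<partial>m))"
      for m :: "'y measure"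
    have [measurable]: "w \<in> borel_measurable bf_measures"
      unfolding w_def using measurable_integral_bf[OF Suc.prems(1,2)]
      by (intro borel_measurable_times_ennreal borel_measurable_prod_ennreal) measurable
    have w_le: "w m \<le> 1" for m
      unfolding w_def
      by (intro mult_le_one prod_le_1) (auto simp: indicator_def)
    have fin: "finite_measure (distr (density K w) borel (\<lambda>m. emeasure m (A k)))"
      if "finite_measure K" "sets K = sets bf_measures" for K
    proof -
      interpret K: finite_measure K by fact
      note [measurable_cong] = that(2)
      have "(\<integral>\<^sup>+m. w m \<partial>K) \<le> (\<integral>\<^sup>+m. 1 \<partial>K)" by (intro nn_integral_mono w_le)
      also have "\<dots> < \<infinity>" by (simp add: less_top[symmetric])
      finally have "finite_measure (density K w)"
        by (intro finite_measureI) (auto simp: emeasure_density cong: nn_integral_cong)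
      then show ?thesis
        by (rule finite_measure.finite_measure_distr) measurable
    qed
    have "distr (density P w) borel (\<lambda>m. emeasure m (A k)) = distr (density Q w) borel (\<lambda>m. emeasure m (A k))"
    proof (rule expneg_moments_determine_measure)
      fix n :: nat
      define g' where "g' y = g y + of_nat n * indicator (A k) y" for y
      have ind: "simple_function borel (\<lambda>y. of_nat n * indicator (A k) y :: ennreal)"
        by (intro simple_function_mult simple_function_const simple_function_indicator) auto
      have g': "simple_function borel g'" "\<And>y. g' y < \<infinity>"
        unfolding g'_def
        using simple_function_add[OF Suc.prems(1) ind] Suc.prems(2)
        by (auto simp: ennreal_mult_less_top of_nat_less_top indicator_def)
      have gm: "g \<in> borel_measurable borel"
        using borel_measurable_simple_function[OF Suc.prems(1)] .
      have int: "(\<integral>\<^sup>+y. g' y \<partial>m) = (\<integral>\<^sup>+y. g y \<partial>m) + of_nat n * emeasure m (A k)"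
        if "m \<in> space bf_measures" for m
        unfolding g'_def using gm boundedly_finite_sets[OF that]
        by (subst nn_integral_add) (auto simp: nn_integral_cmult_indicator cong: measurable_cong_sets)
      have *: "(\<integral>\<^sup>+x. ennreal (expneg (of_nat n * x)) \<partial>distr (density K w) borel (\<lambda>m. emeasure m (A k)))
         = (\<integral>\<^sup>+m. (\<Prod>i<k. indicator (B i) (emeasure m (A i))) * ennreal (expneg (\<integral>\<^sup>+y. g' y \<partial>m)) \<partial>K)"
        if [measurable_cong]: "sets K = sets bf_measures" for K
      proof -
        have "space K = space bf_measures" using that by (rule sets_eq_imp_space_eq)
        then show ?thesis
          by (simp add: nn_integral_distr nn_integral_density w_def int expneg_add ennreal_mult mult.assoc
                cong: nn_integral_cong_simp)
      qed
      show "(\<integral>\<^sup>+x. ennreal (expneg (of_nat n * x)) \<partial>distr (density P w) borel (\<lambda>m. emeasure m (A k)))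
          = (\<integral>\<^sup>+x. ennreal (expneg (of_nat n * x)) \<partial>distr (density Q w) borel (\<lambda>m. emeasure m (A k)))"
        unfolding *[OF P(2)] *[OF Q(2)] using Suc.IH[OF g'] Suc.prems(3,4) by simp
    qed (simp_all add: fin P Q)
    then have "emeasure (distr (density P w) borel (\<lambda>m. emeasure m (A k))) (B k)
        = emeasure (distr (density Q w) borel (\<lambda>m. emeasure m (A k))) (B k)" by simp
    moreover have "emeasure (distr (density K w) borel (\<lambda>m. emeasure m (A k))) (B k)
        = (\<integral>\<^sup>+m. (\<Prod>i<Suc k. indicator (B i) (emeasure m (A i))) * ennreal (expneg (\<integral>\<^sup>+y. g y \<partial>m)) \<partial>K)"
      if [measurable_cong]: "sets K = sets bf_measures" for K
    proof -
      have "emeasure (distr (density K w) borel (\<lambda>m. emeasure m (A k))) (B k)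
          = (\<integral>\<^sup>+x. indicator (B k) x \<partial>distr (density K w) borel (\<lambda>m. emeasure m (A k)))"
        by simp
      also have "\<dots> = (\<integral>\<^sup>+m. w m * indicator (B k) (emeasure m (A k)) \<partial>K)"
        by (subst nn_integral_distr, measurable, subst nn_integral_density) auto
      finally show ?thesis
        by (simp add: w_def mult_ac)
    qed
    ultimately show ?case using P(2) Q(2) by simp
  qed
  show ?thesis
  proof (rule measure_eqI_generator_eq[OF Int_stable_evaluation_cylinders _ _ P(2)[unfolded sets_bf_measures_cylinders]
        Q(2)[unfolded sets_bf_measures_cylinders], where A="\<lambda>_. {m. boundedly_finite m}"])
    show "evaluation_cylinders \<subseteq> Pow {m :: 'y measure. boundedly_finite m}"
      by (auto simp: evaluation_cylinders_def cylinder_def)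
    show "range (\<lambda>_::nat. {m :: 'y measure. boundedly_finite m}) \<subseteq> evaluation_cylinders"
      unfolding evaluation_cylinders_def cylinder_def by (auto intro!: exI[of _ "0::nat"])
    show "emeasure P {m. boundedly_finite m} \<noteq> \<infinity>"
      using P(1) by (simp add: finite_measure.emeasure_finite)
    fix X :: "'y measure set" assume "X \<in> evaluation_cylinders"
    then obtain A B k where X: "X = cylinder k A B"
      and AB: "\<forall>i<k. A i \<in> sets borel \<and> B i \<in> sets borel"
      unfolding evaluation_cylinders_def by blast
    have prod: "(\<Prod>i<k. indicator (B i) (emeasure m (A i))) = (indicator X m :: ennreal)"
      if "m \<in> space bf_measures" for m
      using that by (cases "m \<in> X") (auto simp: X cylinder_def space_bf_measures indicator_def)
    have "X \<in> sets bf_measures"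
      using \<open>X \<in> evaluation_cylinders\<close> by (auto simp: sets_bf_measures_cylinders)
    then show "emeasure P X = emeasure Q X"
      using mixed[of "\<lambda>_. 0" k A B] AB P(2) Q(2)
      by (simp add: prod spP spQ cong: nn_integral_cong_simp)
  qed simp
qed

section \<open>Gamma and beta distributions\<close>

lemma nn_integral_gamma_kernel:
  fixes a s :: real
  assumes a: "a > 0" and s: "s > 0"
  shows "(\<integral>\<^sup>+x. ennreal (indicator {0<..} x * x powr (a - 1) * exp (- (s * x))) \<partial>lborel) = ennreal (Gamma a / s powr a)"
proof -
  have "ennreal (Gamma a) = (\<integral>\<^sup>+t. ennreal (indicator {0..} t * t powr (a - 1) / exp t) \<partial>lborel)"
    using Gamma_conv_nn_integral_real[OF a] by simp
  also have "\<dots> = ennreal \<bar>s\<bar> * (\<integral>\<^sup>+x. ennreal (indicator {0..} (0 + s * x) * (0 + s * x) powr (a - 1) / exp (0 + s * x)) \<partial>lborel)"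
    using s by (intro nn_integral_real_affine) auto
  also have "\<dots> = (\<integral>\<^sup>+x. ennreal (s powr a) * ennreal (indicator {0<..} x * x powr (a - 1) * exp (- (s * x))) \<partial>lborel)"
    using s a
    by (subst nn_integral_cmult[symmetric], measurable, intro nn_integral_cong)
       (auto simp: ennreal_mult'[symmetric] indicator_def powr_mult exp_minus powr_diff zero_le_mult_iff field_simps
          split: if_splits)
  also have "\<dots> = ennreal (s powr a) * (\<integral>\<^sup>+x. ennreal (indicator {0<..} x * x powr (a - 1) * exp (- (s * x))) \<partial>lborel)"
    by (rule nn_integral_cmult) measurable
  finally have *: "ennreal (Gamma a) = \<dots>" .
  have "ennreal (Gamma a / s powr a) = ennreal (1 / s powr a) * ennreal (Gamma a)"
    using s a by (simp flip: ennreal_mult')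
  also have "\<dots> = (ennreal (1 / s powr a) * ennreal (s powr a)) * (\<integral>\<^sup>+x. ennreal (indicator {0<..} x * x powr (a - 1) * exp (- (s * x))) \<partial>lborel)"
    unfolding * by (simp only: mult.assoc)
  also have "ennreal (1 / s powr a) * ennreal (s powr a) = 1"
    using s by (simp flip: ennreal_mult')
  finally show ?thesis by simp
qed

lemma sets_gamma_dist [simp, measurable_cong]: "sets (gamma_dist a) = sets borel"
  by (simp add: gamma_dist_def)

lemma space_gamma_dist [simp]: "space (gamma_dist a) = UNIV"
  by (simp add: gamma_dist_def)

lemma gamma_dist_laplace:
  assumes a: "a \<ge> 0" and s: "s \<ge> 0"
  shows "(\<integral>\<^sup>+x. ennreal (exp (- (s * x))) \<partial>gamma_dist a) = ennreal ((1 + s) powr (- a))"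
proof (cases "a = 0")
  case True
  then show ?thesis using s by (simp add: gamma_dist_def nn_integral_return)
next
  case False
  with a have a: "a > 0" by simp
  have "(\<integral>\<^sup>+x. ennreal (exp (- (s * x))) \<partial>gamma_dist a)
      = (\<integral>\<^sup>+x. ennreal (1 / Gamma a) * ennreal (indicator {0<..} x * x powr (a - 1) * exp (- ((1 + s) * x))) \<partial>lborel)"
  proof -
    have "exp (- ((1 + s) * x)) = exp (- x) * exp (- (s * x))" for x
      by (simp add: exp_add[symmetric] algebra_simps)
    then show ?thesis
      using a Gamma_real_pos[OF a] unfolding gamma_dist_def
      by (simp add: nn_integral_density, intro nn_integral_cong)
         (simp add: ennreal_mult'[symmetric] mult_ac divide_inverse)
  qed
  also have "\<dots> = ennreal (1 / Gamma a) * (\<integral>\<^sup>+x. ennreal (indicator {0<..} x * x powr (a - 1) * exp (- ((1 + s) * x))) \<partial>lborel)"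
    by (rule nn_integral_cmult) measurable
  also have "\<dots> = ennreal (1 / Gamma a) * ennreal (Gamma a / (1 + s) powr a)"
    using a s by (subst nn_integral_gamma_kernel) auto
  also have "\<dots> = ennreal ((1 + s) powr (- a))"
  proof -
    have "1 / Gamma a * (Gamma a / (1 + s) powr a) = (1 + s) powr (- a)"
      using Gamma_real_pos[OF a] by (simp add: powr_minus_divide)
    then show ?thesis
      using Gamma_real_pos[OF a] ennreal_mult'[of "1 / Gamma a" "Gamma a / (1 + s) powr a"] by simp
  qed
  finally show ?thesis .
qed

lemma prob_space_gamma_dist: "a \<ge> 0 \<Longrightarrow> prob_space (gamma_dist a)"
  using gamma_dist_laplace[of a 0] by (intro prob_spaceI) simp

lemma AE_gamma_dist_pos: "a > 0 \<Longrightarrow> AE x in gamma_dist a. 0 < x"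
  unfolding gamma_dist_def by (subst if_not_P, simp, subst AE_density) (auto simp: indicator_def)

lemma AE_gamma_dist_nonneg:
  assumes "a \<ge> 0"
  shows "AE x in gamma_dist a. 0 \<le> x"
proof (cases "a = 0")
  case True
  have "AE x in return borel 0. 0 \<le> (x :: real)" by (subst AE_return) auto
  then show ?thesis by (simp only: True gamma_dist_def if_True simp_thms)
next
  case False
  then show ?thesis
    using AE_gamma_dist_pos[of a] assms by (auto elim: eventually_mono)
qed

text \<open>A power of \<open>t\<close> as a density only changes the shape; this is how the density \<open>T\<^sup>q\<^sup>-\<^sup>\<theta>\<close> of a beta-gamma
  process acts on the total mass.\<close>

lemma gamma_dist_reweight:
  assumes "a > 0" "b > 0"
  shows "density (gamma_dist a) (\<lambda>t. ennreal (Gamma a / Gamma b * t powr (b - a))) = gamma_dist b"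
proof -
  have "density (gamma_dist a) (\<lambda>t. ennreal (Gamma a / Gamma b * t powr (b - a)))
      = density lborel (\<lambda>x. ennreal (indicator {0<..} x * x powr (a - 1) * exp (- x) / Gamma a) * ennreal (Gamma a / Gamma b * x powr (b - a)))"
    using assms by (simp add: gamma_dist_def density_density_eq)
  also have "\<dots> = density lborel (\<lambda>x. ennreal (indicator {0<..} x * x powr (b - 1) * exp (- x) / Gamma b))"
  proof (intro density_cong AE_I2)
    fix x :: real
    show "ennreal (indicator {0<..} x * x powr (a - 1) * exp (- x) / Gamma a) * ennreal (Gamma a / Gamma b * x powr (b - a))
        = ennreal (indicator {0<..} x * x powr (b - 1) * exp (- x) / Gamma b)"
    proof (cases "x > 0")
      case True
      have "x powr (a - 1) * x powr (b - a) = x powr (b - 1)"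
        by (simp add: powr_add[symmetric])
      then show ?thesis
        using True Gamma_real_pos[OF assms(1)] Gamma_real_pos[OF assms(2)]
        by (subst ennreal_mult'[symmetric]) (auto simp: field_simps)
    qed simp
  qed measurable
  finally show ?thesis using assms by (simp add: gamma_dist_def)
qed

lemma sets_beta_dist [simp, measurable_cong]: "sets (beta_dist a b) = sets borel"
  by (simp add: beta_dist_def)

lemma space_beta_dist [simp]: "space (beta_dist a b) = UNIV"
  by (simp add: beta_dist_def)

lemma AE_beta_dist_pos: "AE u in beta_dist a b. 0 < u"
  unfolding beta_dist_def by (subst AE_density) (auto simp: indicator_def)

text \<open>A beta variable with parameters \<open>q\<close>, \<open>r - q\<close> is the proportion \<open>v / (v + w)\<close> of independent gamma
  variables \<open>v\<close>, \<open>w\<close> with shapes \<open>q\<close>, \<open>r - q\<close>, and it is independent of the sum \<open>v + w\<close>, which has shape \<open>r\<close>.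
  The substitutions \<open>v = u t\<close> and \<open>w = t - v\<close> turn the joint density of \<open>u\<close> and \<open>t\<close> into that of \<open>v\<close> and \<open>w\<close>.\<close>

lemma beta_times_gamma:
  fixes F :: "real \<Rightarrow> ennreal"
  assumes q: "0 < q" "q < r" and F[measurable]: "F \<in> borel_measurable borel"
  shows "(\<integral>\<^sup>+u. \<integral>\<^sup>+t. F (u * t) \<partial>gamma_dist r \<partial>beta_dist q (r - q)) = (\<integral>\<^sup>+v. F v \<partial>gamma_dist q)"
proof -
  define b where "b = r - q"
  have b: "b > 0" and r: "r > 0" "r = q + b" using q by (auto simp: b_def)
  have pos: "Gamma q > 0" "Gamma b > 0" "Gamma r > 0" using q b r(1) by (auto intro: Gamma_real_pos)
  have Beta: "Beta q b * Gamma r = Gamma q * Gamma b"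
    using pos r(2) by (simp add: Beta_def)
  have Beta_pos: "Beta q b > 0" using pos r(2) by (simp add: Beta_def)
  define K where "K = Beta q b * Gamma r"
  have K: "K > 0" using Beta_pos pos by (simp add: K_def)
  \<comment> \<open>The unnormalised joint densities, in the coordinates \<open>(u, t)\<close> and \<open>(v, w)\<close>.\<close>
  define h where "h u t = indicator {0<..<1} u * u powr (q - 1) * (1 - u) powr (b - 1) *
      (indicator {0<..} t * t powr (r - 1) * exp (- t))" for u t :: real
  define k where "k v w = indicator {0<..} v * v powr (q - 1) * exp (- v) *
      (indicator {0<..} w * w powr (b - 1) * exp (- w))" for v w :: real
  have [measurable]: "case_prod h \<in> borel_measurable (borel \<Otimes>\<^sub>M borel)"
    "case_prod k \<in> borel_measurable (borel \<Otimes>\<^sub>M borel)"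
    unfolding h_def k_def by measurable
  have "(\<integral>\<^sup>+u. \<integral>\<^sup>+t. F (u * t) \<partial>gamma_dist r \<partial>beta_dist q (r - q))
      = (\<integral>\<^sup>+u. \<integral>\<^sup>+t. ennreal (1 / K) * (ennreal (h u t) * F (u * t)) \<partial>lborel \<partial>lborel)"
  proof -
    have "(\<integral>\<^sup>+u. \<integral>\<^sup>+t. F (u * t) \<partial>gamma_dist r \<partial>beta_dist q (r - q))
      = (\<integral>\<^sup>+u. ennreal (indicator {0<..<1} u * u powr (q - 1) * (1 - u) powr (b - 1) / Beta q b) *
          (\<integral>\<^sup>+t. ennreal (indicator {0<..} t * t powr (r - 1) * exp (- t) / Gamma r) * F (u * t) \<partial>lborel) \<partial>lborel)"
      using r by (simp add: gamma_dist_def beta_dist_def b_def[symmetric] nn_integral_density)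
    also have "\<dots> = (\<integral>\<^sup>+u. \<integral>\<^sup>+t. ennreal (1 / K) * (ennreal (h u t) * F (u * t)) \<partial>lborel \<partial>lborel)"
    proof (rule nn_integral_cong)
      fix u :: real
      have eq: "ennreal (indicator {0<..<1} u * u powr (q - 1) * (1 - u) powr (b - 1) / Beta q b) *
          ennreal (indicator {0<..} t * t powr (r - 1) * exp (- t) / Gamma r) = ennreal (1 / K) * ennreal (h u t)" for t
        using pos Beta_pos K
        by (subst (1 2) ennreal_mult'[symmetric]) (auto simp: h_def K_def)
      show "ennreal (indicator {0<..<1} u * u powr (q - 1) * (1 - u) powr (b - 1) / Beta q b) *
          (\<integral>\<^sup>+t. ennreal (indicator {0<..} t * t powr (r - 1) * exp (- t) / Gamma r) * F (u * t) \<partial>lborel)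
        = (\<integral>\<^sup>+t. ennreal (1 / K) * (ennreal (h u t) * F (u * t)) \<partial>lborel)"
        by (subst nn_integral_cmult[symmetric], measurable)
           (simp add: mult.assoc[symmetric] eq)
    qed
    finally show ?thesis .
  qed
  also have "\<dots> = (\<integral>\<^sup>+t. \<integral>\<^sup>+u. ennreal (1 / K) * (ennreal (h u t) * F (u * t)) \<partial>lborel \<partial>lborel)"
    by (rule lborel_pair.Fubini'[symmetric]) measurable
  also have "\<dots> = (\<integral>\<^sup>+t. \<integral>\<^sup>+v. ennreal (1 / K) * (ennreal (k v (t - v)) * F v) \<partial>lborel \<partial>lborel)"
  proof (rule nn_integral_cong)
    fix t :: real
    show "(\<integral>\<^sup>+u. ennreal (1 / K) * (ennreal (h u t) * F (u * t)) \<partial>lborel)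
        = (\<integral>\<^sup>+v. ennreal (1 / K) * (ennreal (k v (t - v)) * F v) \<partial>lborel)"
    proof (cases "t > 0")
      case True
      have "(\<integral>\<^sup>+v. ennreal (1 / K) * (ennreal (k v (t - v)) * F v) \<partial>lborel)
          = ennreal \<bar>t\<bar> * (\<integral>\<^sup>+u. ennreal (1 / K) * (ennreal (k (0 + t * u) (t - (0 + t * u))) * F (0 + t * u)) \<partial>lborel)"
        using True by (intro nn_integral_real_affine) auto
      also have "\<dots> = (\<integral>\<^sup>+u. ennreal (1 / K) * (ennreal (t * k (t * u) (t - t * u)) * F (u * t)) \<partial>lborel)"
        using True by (subst nn_integral_cmult[symmetric], measurable)
          (simp add: ennreal_mult' mult_ac)
      also have "\<dots> = (\<integral>\<^sup>+u. ennreal (1 / K) * (ennreal (h u t) * F (u * t)) \<partial>lborel)"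
      proof (rule nn_integral_cong)
        fix u :: real
        have "t * k (t * u) (t - t * u) = h u t"
        proof (cases "0 < u \<and> u < 1")
          case u: True
          then have tu: "0 < t * u" "0 < t - t * u" using True by (auto simp: mult_less_cancel_left2)
          have "(t - t * u) powr (b - 1) = t powr (b - 1) * (1 - u) powr (b - 1)"
            using True u by (subst powr_mult[symmetric]) (auto simp: algebra_simps)
          moreover have "(t * u) powr (q - 1) = t powr (q - 1) * u powr (q - 1)"
            using True u by (simp add: powr_mult)
          moreover have "t * (t powr (q - 1) * t powr (b - 1)) = t powr (r - 1)"
            using True by (simp add: r(2) powr_add[symmetric] powr_mult_base)
          moreover have "exp (- (t * u)) * exp (- (t - t * u)) = exp (- t)"
            by (simp add: exp_add[symmetric])
          moreover have "k (t * u) (t - t * u) = (t * u) powr (q - 1) * (t - t * u) powr (b - 1) * (exp (- (t * u)) * exp (- (t - t * u)))"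
            using tu by (simp add: k_def)
          ultimately show ?thesis
            using u True by (simp add: h_def)
        next
          case False
          then have "\<not> (0 < t * u \<and> 0 < t - t * u)" using True
            by (auto simp: zero_less_mult_iff mult_less_cancel_left2)
          then have "k (t * u) (t - t * u) = 0" by (auto simp: k_def)
          then show ?thesis using False by (auto simp: h_def)
        qed
        then show "ennreal (1 / K) * (ennreal (t * k (t * u) (t - t * u)) * F (u * t)) = ennreal (1 / K) * (ennreal (h u t) * F (u * t))"
          by simp
      qed
      finally show ?thesis by simp
    next
      case False
      then have "h u t = 0" "k u (t - u) = 0" for u by (auto simp: h_def k_def indicator_def)
      then show ?thesis by simp
    qed
  qed
  also have "\<dots> = (\<integral>\<^sup>+v. \<integral>\<^sup>+t. ennreal (1 / K) * (ennreal (k v (t - v)) * F v) \<partial>lborel \<partial>lborel)"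
    by (rule lborel_pair.Fubini') measurable
  also have "\<dots> = (\<integral>\<^sup>+v. ennreal (indicator {0<..} v * v powr (q - 1) * exp (- v) / Gamma q) * F v \<partial>lborel)"
  proof (rule nn_integral_cong)
    fix v :: real
    let ?f = "indicator {0<..} v * v powr (q - 1) * exp (- v)"
    have "(\<integral>\<^sup>+t. ennreal (1 / K) * (ennreal (k v (t - v)) * F v) \<partial>lborel)
        = (\<integral>\<^sup>+w. ennreal (1 / K) * (ennreal (k v w) * F v) \<partial>lborel)"
      using nn_integral_real_affine[of "\<lambda>t. ennreal (1 / K) * (ennreal (k v (t - v)) * F v)" 1 v] by simp
    also have "\<dots> = (\<integral>\<^sup>+w. (ennreal (1 / K) * ennreal ?f * F v) * ennreal (indicator {0<..} w * w powr (b - 1) * exp (- (1 * w))) \<partial>lborel)"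
      by (intro nn_integral_cong) (simp add: k_def ennreal_mult' mult_ac)
    also have "\<dots> = (ennreal (1 / K) * ennreal ?f * F v) * ennreal (Gamma b)"
      using b by (subst nn_integral_cmult, measurable, subst nn_integral_gamma_kernel) auto
    also have "\<dots> = ennreal (1 / K * ?f * Gamma b) * F v"
    proof -
      have "ennreal (1 / K * ?f * Gamma b) = ennreal (1 / K) * ennreal ?f * ennreal (Gamma b)"
        using pos K ennreal_mult[of "1 / K * ?f" "Gamma b"] ennreal_mult[of "1 / K" ?f] by simp
      then show ?thesis by (simp only: mult_ac)
    qed
    also have "1 / K * ?f * Gamma b = ?f / Gamma q"
      using pos Beta unfolding K_def by simp
    finally show "(\<integral>\<^sup>+t. ennreal (1 / K) * (ennreal (k v (t - v)) * F v) \<partial>lborel) = ennreal (?f / Gamma q) * F v" .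
  qed
  also have "\<dots> = (\<integral>\<^sup>+v. F v \<partial>gamma_dist q)"
    using q by (simp add: gamma_dist_def nn_integral_density)
  finally show ?thesis .
qed

text \<open>The previous lemma with \<open>F = 1\<close> computes the total mass.\<close>

lemma prob_space_beta_dist:
  assumes "0 < q" "q < r"
  shows "prob_space (beta_dist q (r - q))"
proof (rule prob_spaceI)
  interpret G: prob_space "gamma_dist r" using assms by (intro prob_space_gamma_dist) auto
  interpret Gq: prob_space "gamma_dist q" using assms by (intro prob_space_gamma_dist) auto
  show "emeasure (beta_dist q (r - q)) (space (beta_dist q (r - q))) = 1"
    using beta_times_gamma[OF assms, of "\<lambda>_. 1"] G.emeasure_space_1 Gq.emeasure_space_1 by simp
qed

section \<open>Scaling and normalising random measures\<close>

lemma boundedly_finite_scale: "boundedly_finite m \<Longrightarrow> r < \<infinity> \<Longrightarrow> boundedly_finite (scale_measure r m)"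
  by (auto simp: boundedly_finite_def ennreal_mult_less_top)

lemma measurable_scale_measure [measurable (raw)]:
  assumes u[measurable]: "u \<in> borel_measurable K" and f[measurable]: "f \<in> measurable K bf_measures"
  shows "(\<lambda>x. scale_measure (ennreal (u x)) (f x)) \<in> measurable K bf_measures"
proof (rule measurable_bfI)
  fix x assume "x \<in> space K"
  then show "boundedly_finite (scale_measure (ennreal (u x)) (f x))"
    using measurable_space[OF f] by (intro boundedly_finite_scale) (auto simp: space_bf_measures)
next
  fix A :: "'b set" assume [measurable]: "A \<in> sets borel"
  show "(\<lambda>x. emeasure (scale_measure (ennreal (u x)) (f x)) A) \<in> borel_measurable K"
    by simp
qed

lemma measurable_scale_measure_const [measurable]:
  "scale_measure (ennreal r) \<in> measurable bf_measures bf_measures"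
  by measurable

lemma boundedly_finite_normalize:
  assumes "boundedly_finite m"
  shows "boundedly_finite (normalize_measure m)"
proof (cases "emeasure m (space m) = 0")
  case True
  have "emeasure m A = 0" for A
    using True emeasure_space[of m A] by simp
  then show ?thesis using assms by (simp add: normalize_measure_def boundedly_finite_def)
next
  case False
  then show ?thesis unfolding normalize_measure_def using assms
    by (intro boundedly_finite_scale) (auto simp: ennreal_divide_eq_top_iff less_top[symmetric])
qed

lemma measurable_normalize [measurable]: "normalize_measure \<in> measurable bf_measures bf_measures"
proof (rule measurable_bfI)
  fix A :: "'a set" assume [measurable]: "A \<in> sets borel"
  have "(\<lambda>m :: 'a measure. 1 / emeasure m UNIV * emeasure m A) \<in> borel_measurable bf_measures"
    by measurable
  then show "(\<lambda>m. emeasure (normalize_measure m) A) \<in> borel_measurable bf_measures"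
    by (subst measurable_cong[where g="\<lambda>m. 1 / emeasure m UNIV * emeasure m A"])
       (auto simp: normalize_measure_def boundedly_finite_space)
qed (auto simp: space_bf_measures intro: boundedly_finite_normalize)

text \<open>Holds for every \<open>m\<close>: the null measure and measures of infinite mass are normalised to the null
  measure.\<close>

lemma normalize_scale_measure:
  assumes "0 < r" "r < \<infinity>"
  shows "normalize_measure (scale_measure r m) = normalize_measure m"
proof -
  have "1 / (r * t) * r = 1 / t" for t
  proof (cases "t = 0 \<or> t = \<infinity>")
    case True
    then show ?thesis
      using assms by (auto simp: ennreal_mult_top ennreal_top_mult)
  next
    case False
    then obtain x y where "r = ennreal x" "t = ennreal y" "0 < x" "0 < y"
      using assms by (cases r; cases t) (auto simp: less_le)
    then show ?thesis
      by (simp add: ennreal_mult'[symmetric] divide_ennreal flip: ennreal_1)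
  qed
  then show ?thesis
    by (simp add: normalize_measure_def space_scale_measure)
qed

lemma measurable_measure_bf [measurable]:
  "A \<in> sets borel \<Longrightarrow> (\<lambda>m. measure m A) \<in> borel_measurable bf_measures"
  unfolding measure_def by (rule measurable_compose[OF measurable_emeasure_bf]) auto

lemma partition_emeasure_UNIV:
  assumes "sets m = sets borel" "\<And>i. i < k \<Longrightarrow> A i \<in> sets borel" "disjoint_family_on A {..<(k::nat)}" "(\<Union>i<k. A i) = UNIV"
  shows "(\<Sum>i<k. emeasure m (A i)) = emeasure m UNIV"
  using assms(4) sum_emeasure[of A "{..<k}" m] assms by auto

section \<open>The gamma process and its total mass\<close>

locale gamma_process =
  fixes \<theta> :: real and H :: "'y::polish_space measure" and \<G> :: "'y measure measure"
  assumes H: "prob_space H" "sets H = sets borel"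
    and \<theta>: "\<theta> > 0"
    and law: "gamma_process_law \<theta> H \<G>"
begin

sublocale \<G>: prob_space \<G> using law by (simp add: gamma_process_law_def)
sublocale H: prob_space H by (rule H)

lemma sets_\<G> [measurable_cong]: "sets \<G> = sets bf_measures"
  using law by (simp add: gamma_process_law_def)

lemma space_\<G>: "space \<G> = space bf_measures"
  using sets_\<G> by (rule sets_eq_imp_space_eq)

lemma space_H [simp]: "space H = UNIV"
  using sets_eq_imp_space_eq[OF H(2)] by simp

lemma measure_H_UNIV [simp]: "measure H UNIV = 1"
  using H.prob_space by simp

lemma marginal: "A \<in> sets borel \<Longrightarrow>
    distr \<G> borel (\<lambda>m. emeasure m A) = distr (gamma_dist (\<theta> * measure H A)) borel ennreal"
  using law by (simp add: gamma_process_law_def)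

lemma nn_integral_marginal:
  assumes A[measurable]: "A \<in> sets borel" and f[measurable]: "f \<in> borel_measurable borel"
  shows "(\<integral>\<^sup>+m. f (emeasure m A) \<partial>\<G>) = (\<integral>\<^sup>+x. f (ennreal x) \<partial>gamma_dist (\<theta> * measure H A))"
proof -
  have "(\<integral>\<^sup>+m. f (emeasure m A) \<partial>\<G>) = (\<integral>\<^sup>+x. f x \<partial>distr \<G> borel (\<lambda>m. emeasure m A))"
    by (subst nn_integral_distr) auto
  also have "\<dots> = (\<integral>\<^sup>+x. f (ennreal x) \<partial>gamma_dist (\<theta> * measure H A))"
    unfolding marginal[OF A] by (subst nn_integral_distr) auto
  finally show ?thesis .
qed

lemma AE_total_mass: "AE m in \<G>. 0 < emeasure m UNIV \<and> emeasure m UNIV < \<infinity>"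
proof -
  have "AE x in gamma_dist \<theta>. 0 < ennreal x \<and> ennreal x < \<infinity>"
    using AE_gamma_dist_pos[OF \<theta>] by eventually_elim simp
  then have "AE x in distr \<G> borel (\<lambda>m. emeasure m UNIV). 0 < x \<and> x < \<infinity>"
    unfolding marginal[OF sets.top[of borel, unfolded space_borel]] measure_H_UNIV mult_1_right
    by (subst AE_distr_iff) simp_all
  then show ?thesis by (subst (asm) AE_distr_iff) simp_all
qed

lemma AE_sets_borel: "AE m in \<G>. sets m = sets borel"
  by (rule AE_I2) (simp add: space_\<G> boundedly_finite_sets)

text \<open>The values on disjoint sets are independent gamma variables, so the Laplace functional is a product
  of gamma transforms.\<close>

lemma laplace:
  assumes A: "\<And>i. i < k \<Longrightarrow> A i \<in> sets borel" "disjoint_family_on A {..<(k::nat)}"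
    and c: "\<And>i. i < k \<Longrightarrow> 0 \<le> c i"
  shows "(\<integral>\<^sup>+m. ennreal (expneg (\<Sum>i<k. ennreal (c i) * emeasure m (A i))) \<partial>\<G>)
    = ennreal (\<Prod>i<k. (1 + c i) powr (- \<theta> * measure H (A i)))"
proof -
  have indep: "\<G>.indep_vars (\<lambda>_. borel) (\<lambda>i m. emeasure m (A i)) {..<k}"
    using law A by (auto simp: gamma_process_law_def)
  have "(\<integral>\<^sup>+m. ennreal (expneg (\<Sum>i<k. ennreal (c i) * emeasure m (A i))) \<partial>\<G>)
      = (\<integral>\<^sup>+m. (\<Prod>i<k. ennreal (expneg (ennreal (c i) * emeasure m (A i)))) \<partial>\<G>)"
    by (simp add: expneg_sum prod_ennreal)
  also have "\<dots> = (\<Prod>i<k. \<integral>\<^sup>+m. ennreal (expneg (ennreal (c i) * emeasure m (A i))) \<partial>\<G>)"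
    by (intro \<G>.indep_vars_nn_integral \<G>.indep_vars_compose2[OF indep]) auto
  also have "\<dots> = (\<Prod>i<k. ennreal ((1 + c i) powr (- \<theta> * measure H (A i))))"
  proof (intro prod.cong refl)
    fix i assume "i \<in> {..<k}"
    then have i: "A i \<in> sets borel" "0 \<le> c i" using A c by auto
    have nn: "0 \<le> \<theta> * measure H (A i)" using \<theta> by simp
    have "(\<integral>\<^sup>+m. ennreal (expneg (ennreal (c i) * emeasure m (A i))) \<partial>\<G>)
        = (\<integral>\<^sup>+x. ennreal (expneg (ennreal (c i) * ennreal x)) \<partial>gamma_dist (\<theta> * measure H (A i)))"
      by (rule nn_integral_marginal) (use i in auto)
    also have "\<dots> = (\<integral>\<^sup>+x. ennreal (exp (- (c i * x))) \<partial>gamma_dist (\<theta> * measure H (A i)))"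
      using AE_gamma_dist_nonneg[OF nn] i
      by (intro nn_integral_cong_AE) (auto simp flip: ennreal_mult elim!: eventually_mono)
    also have "\<dots> = ennreal ((1 + c i) powr (- \<theta> * measure H (A i)))"
      using gamma_dist_laplace[OF nn i(2)] by simp
    finally show "(\<integral>\<^sup>+m. ennreal (expneg (ennreal (c i) * emeasure m (A i))) \<partial>\<G>)
        = ennreal ((1 + c i) powr (- \<theta> * measure H (A i)))" .
  qed
  finally show ?thesis by (simp add: prod_ennreal)
qed

lemma sum_measure_H:
  assumes "\<And>i. i < k \<Longrightarrow> A i \<in> sets borel" "disjoint_family_on A {..<(k::nat)}" "(\<Union>i<k. A i) = UNIV"
  shows "(\<Sum>i<k. measure H (A i)) = 1"
  using assms(3) H.finite_measure_finite_Union[of "{..<k}" A] assms by (auto simp: H)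

text \<open>Weighting a gamma process with \<open>e\<^sup>-\<^sup>s\<^sup>T\<close> replaces \<open>f\<close> by \<open>f + s\<close> in the Laplace functional.  Since \<open>H\<close> has
  mass 1, the normalising factor \<open>(1 + s)\<^sup>\<theta>\<close> can be distributed over the cells of the partition, and
  \<open>(1 + c + s) / (1 + s) = 1 + c / (1 + s)\<close> is the effect of scaling with \<open>1 / (1 + s)\<close>.\<close>

lemma exponential_tilt_is_scaling:
  assumes s: "s \<ge> 0"
  shows "density \<G> (\<lambda>m. ennreal ((1 + s) powr \<theta> * expneg (ennreal s * emeasure m UNIV)))
    = distr \<G> bf_measures (scale_measure (ennreal (1 / (1 + s))))" (is "?D = ?S")
proof (rule laplace_functional_determines_law)
  have [measurable]: "(\<lambda>m. ennreal ((1 + s) powr \<theta> * expneg (ennreal s * emeasure m UNIV))) \<in> borel_measurable \<G>"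
    by measurable
  have "emeasure ?D (space ?D) = ennreal ((1 + s) powr \<theta>) * (\<integral>\<^sup>+m. ennreal (expneg (ennreal s * emeasure m UNIV)) \<partial>\<G>)"
    by (simp add: emeasure_density nn_integral_cmult[symmetric] ennreal_mult cong: nn_integral_cong)
  also have "\<dots> = ennreal ((1 + s) powr \<theta>) * ennreal ((1 + s) powr (- \<theta>))"
    using laplace[of 1 "\<lambda>_. UNIV" "\<lambda>_. s"] s by (simp add: disjoint_family_on_def)
  also have "\<dots> < \<infinity>" by (simp flip: ennreal_mult')
  finally show "finite_measure ?D" by (intro finite_measureI) auto
  show "finite_measure ?S" by (rule \<G>.finite_measure_distr) measurable
  fix k :: nat and A and c :: "nat \<Rightarrow> real"
  assume A: "\<And>i. i < k \<Longrightarrow> A i \<in> sets borel" "disjoint_family_on A {..<k}" "(\<Union>i<k. A i) = (UNIV :: 'y set)"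
    and c: "\<And>i. i < k \<Longrightarrow> 0 \<le> c i"
  have [measurable]: "\<And>i. i \<in> {..<k} \<Longrightarrow> A i \<in> sets borel" using A by auto
  have sp: "m \<in> space \<G> \<Longrightarrow> sets m = sets borel" for m by (simp add: space_\<G> boundedly_finite_sets)
  have "(\<integral>\<^sup>+m. ennreal (expneg (\<Sum>i<k. ennreal (c i) * emeasure m (A i))) \<partial>?D)
      = (\<integral>\<^sup>+m. ennreal ((1 + s) powr \<theta>) * ennreal (expneg (\<Sum>i<k. ennreal (c i + s) * emeasure m (A i))) \<partial>\<G>)"
  proof (subst nn_integral_density, measurable, intro nn_integral_cong)
    fix m assume m: "m \<in> space \<G>"
    have "(\<Sum>i<k. ennreal (c i + s) * emeasure m (A i))
        = (\<Sum>i<k. ennreal (c i) * emeasure m (A i)) + ennreal s * (\<Sum>i<k. emeasure m (A i))"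
      using c s by (simp add: sum_distrib_left distrib_right sum.distrib[symmetric])
    also have "(\<Sum>i<k. emeasure m (A i)) = emeasure m UNIV"
      by (rule partition_emeasure_UNIV[OF sp[OF m] A])
    finally show "ennreal ((1 + s) powr \<theta> * expneg (ennreal s * emeasure m UNIV)) *
        ennreal (expneg (\<Sum>i<k. ennreal (c i) * emeasure m (A i)))
      = ennreal ((1 + s) powr \<theta>) * ennreal (expneg (\<Sum>i<k. ennreal (c i + s) * emeasure m (A i)))"
      by (simp add: expneg_add ennreal_mult' mult_ac)
  qed
  also have "\<dots> = ennreal ((1 + s) powr \<theta>) * (\<integral>\<^sup>+m. ennreal (expneg (\<Sum>i<k. ennreal (c i + s) * emeasure m (A i))) \<partial>\<G>)"
    by (rule nn_integral_cmult) measurable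
  also have "\<dots> = ennreal ((1 + s) powr \<theta>) * ennreal (\<Prod>i<k. (1 + (c i + s)) powr (- \<theta> * measure H (A i)))"
    using c s A by (subst laplace) auto
  also have "\<dots> = ennreal ((\<Prod>i<k. (1 + s) powr (\<theta> * measure H (A i))) * (\<Prod>i<k. (1 + (c i + s)) powr (- \<theta> * measure H (A i))))"
  proof -
    have "(\<Prod>i<k. (1 + s) powr (\<theta> * measure H (A i))) = (1 + s) powr (\<Sum>i<k. \<theta> * measure H (A i))"
      using s by (subst powr_sum) auto
    also have "(\<Sum>i<k. \<theta> * measure H (A i)) = \<theta>"
      using sum_measure_H[OF A] by (simp add: sum_distrib_left[symmetric])
    finally show ?thesis by (simp add: ennreal_mult')
  qed
  also have "\<dots> = ennreal (\<Prod>i<k. (1 + c i / (1 + s)) powr (- \<theta> * measure H (A i)))"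
    unfolding prod.distrib[symmetric]
  proof (intro arg_cong[of _ _ ennreal] prod.cong refl)
    fix i assume "i \<in> {..<k}"
    then have ci: "0 \<le> c i" using c by auto
    have "1 + (c i + s) = (1 + s) * (1 + c i / (1 + s))" using s by (simp add: field_simps)
    then have "(1 + (c i + s)) powr (- \<theta> * measure H (A i))
        = (1 + s) powr (- \<theta> * measure H (A i)) * (1 + c i / (1 + s)) powr (- \<theta> * measure H (A i))"
      using s ci by (simp only: powr_mult)
    moreover have "(1 + s) powr (\<theta> * measure H (A i)) * (1 + s) powr (- \<theta> * measure H (A i)) = 1"
      using s by (simp flip: powr_add)
    ultimately show "(1 + s) powr (\<theta> * measure H (A i)) * (1 + (c i + s)) powr (- \<theta> * measure H (A i))
        = (1 + c i / (1 + s)) powr (- \<theta> * measure H (A i))"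
      by (simp only: mult.assoc[symmetric] mult_1_left)
  qed
  also have "\<dots> = (\<integral>\<^sup>+m. ennreal (expneg (\<Sum>i<k. ennreal (c i / (1 + s)) * emeasure m (A i))) \<partial>\<G>)"
    using c s A by (subst laplace) auto
  also have "\<dots> = (\<integral>\<^sup>+m. ennreal (expneg (\<Sum>i<k. ennreal (c i) * emeasure m (A i))) \<partial>?S)"
  proof -
    have "ennreal (c i / (1 + s)) = ennreal (c i) * ennreal (1 / (1 + s))" if "i < k" for i
      using c[OF that] s by (simp flip: ennreal_mult)
    then show ?thesis
      by (subst nn_integral_distr) (auto intro!: nn_integral_cong arg_cong[of _ _ expneg] sum.cong simp: mult.assoc)
  qed
  finally show "(\<integral>\<^sup>+m. ennreal (expneg (\<Sum>i<k. ennreal (c i) * emeasure m (A i))) \<partial>?D)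
      = (\<integral>\<^sup>+m. ennreal (expneg (\<Sum>i<k. ennreal (c i) * emeasure m (A i))) \<partial>?S)" .
qed (simp_all add: sets_\<G>)

lemma sets_dirichlet [simp, measurable_cong]: "sets (dirichlet_law \<G>) = sets bf_measures"
  by (simp add: dirichlet_law_def)

lemma measurable_normalize_\<G>: "normalize_measure \<in> measurable \<G> bf_measures"
  by measurable

sublocale D: prob_space "dirichlet_law \<G>"
  unfolding dirichlet_law_def by (rule \<G>.prob_space_distr) (rule measurable_normalize_\<G>)

text \<open>Scaling leaves the normalised measure \<open>P\<close> unchanged, so by \<open>exponential_tilt_is_scaling\<close> the event \<open>P \<in> E\<close> has
  the same probability after weighting with \<open>e\<^sup>-\<^sup>s\<^sup>T\<close>.  Hence the Laplace transform of \<open>T\<close> restricted to this event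
  is a multiple of that of \<open>T\<close>, and uniqueness at \<open>s = 0, 1, 2, \<dots>\<close> gives the independence of \<open>T\<close> and \<open>P\<close>.\<close>

lemma emeasure_total_normalized:
  assumes E[measurable]: "E \<in> sets bf_measures" and B[measurable]: "B \<in> sets (borel :: ennreal measure)"
  shows "emeasure \<G> {m \<in> space \<G>. emeasure m UNIV \<in> B \<and> normalize_measure m \<in> E}
    = emeasure (dirichlet_law \<G>) E * emeasure (distr \<G> borel (\<lambda>m. emeasure m UNIV)) B"
proof -
  note measurable_normalize_\<G> [measurable]
  define w where "w m = (indicator E (normalize_measure m) :: ennreal)" for m
  have [measurable]: "w \<in> borel_measurable bf_measures" unfolding w_def by measurable
  let ?L = "distr (density \<G> w) borel (\<lambda>m. emeasure m UNIV)"
  let ?R = "density (distr \<G> borel (\<lambda>m. emeasure m UNIV)) (\<lambda>_. emeasure (dirichlet_law \<G>) E)"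
  have w_int: "(\<integral>\<^sup>+m. w m \<partial>\<G>) = emeasure (dirichlet_law \<G>) E"
  proof -
    have "emeasure (dirichlet_law \<G>) E = (\<integral>\<^sup>+p. indicator E p \<partial>dirichlet_law \<G>)" by simp
    also have "\<dots> = (\<integral>\<^sup>+m. w m \<partial>\<G>)"
      unfolding dirichlet_law_def w_def by (subst nn_integral_distr) auto
    finally show ?thesis by simp
  qed
  have "?L = ?R"
  proof (rule expneg_moments_determine_measure)
    have "emeasure (density \<G> w) (space \<G>) = (\<integral>\<^sup>+m. w m \<partial>\<G>)"
      by (simp add: emeasure_density cong: nn_integral_cong)
    then have "finite_measure (density \<G> w)"
      by (intro finite_measureI) (simp add: w_int D.emeasure_finite)
    then show "finite_measure ?L" by (rule finite_measure.finite_measure_distr) measurable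
    show "finite_measure ?R"
      by (intro finite_measureI)
         (simp add: emeasure_density emeasure_distr ennreal_mult_eq_top_iff D.emeasure_finite \<G>.emeasure_finite)
    fix n :: nat
    have pos: "(0::real) < 1 + real n" by simp
    have "(\<integral>\<^sup>+x. ennreal (expneg (of_nat n * x)) \<partial>?L) = (\<integral>\<^sup>+m. w m * ennreal (expneg (ennreal (real n) * emeasure m UNIV)) \<partial>\<G>)"
      by (simp add: nn_integral_distr nn_integral_density ennreal_of_nat_eq_real_of_nat)
    also have "\<dots> = ennreal ((1 + real n) powr (- \<theta>)) *
        (\<integral>\<^sup>+m. w m \<partial>density \<G> (\<lambda>m. ennreal ((1 + real n) powr \<theta> * expneg (ennreal (real n) * emeasure m UNIV))))"
    proof (subst nn_integral_density, measurable, subst nn_integral_cmult[symmetric], measurable, intro nn_integral_cong)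
      fix m :: "'y measure"
      have "ennreal ((1 + real n) powr (- \<theta>)) * ennreal ((1 + real n) powr \<theta> * expneg (ennreal (real n) * emeasure m UNIV))
        = ennreal (expneg (ennreal (real n) * emeasure m UNIV))"
        using pos by (simp add: powr_minus field_simps flip: ennreal_mult')
      then show "w m * ennreal (expneg (ennreal (real n) * emeasure m UNIV))
        = ennreal ((1 + real n) powr (- \<theta>)) * (ennreal ((1 + real n) powr \<theta> * expneg (ennreal (real n) * emeasure m UNIV)) * w m)"
        by (simp add: mult_ac)
    qed
    also have "\<dots> = ennreal ((1 + real n) powr (- \<theta>)) * (\<integral>\<^sup>+m. w (scale_measure (ennreal (1 / (1 + real n))) m) \<partial>\<G>)"
      unfolding exponential_tilt_is_scaling[OF of_nat_0_le_iff] by (subst nn_integral_distr) simp_all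
    also have "\<dots> = ennreal ((1 + real n) powr (- \<theta>)) * emeasure (dirichlet_law \<G>) E"
      using pos by (simp add: w_def normalize_scale_measure flip: w_int)
    also have "\<dots> = emeasure (dirichlet_law \<G>) E * (\<integral>\<^sup>+m. ennreal (expneg (ennreal (real n) * emeasure m UNIV)) \<partial>\<G>)"
      using laplace[of 1 "\<lambda>_. UNIV" "\<lambda>_. real n"] by (simp add: disjoint_family_on_def mult.commute)
    also have "\<dots> = (\<integral>\<^sup>+x. ennreal (expneg (of_nat n * x)) \<partial>?R)"
      by (simp add: nn_integral_distr nn_integral_density nn_integral_cmult ennreal_of_nat_eq_real_of_nat)
    finally show "(\<integral>\<^sup>+x. ennreal (expneg (of_nat n * x)) \<partial>?L) = (\<integral>\<^sup>+x. ennreal (expneg (of_nat n * x)) \<partial>?R)" .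
  qed simp_all
  then have "emeasure ?L B = emeasure ?R B" by simp
  moreover have "emeasure ?L B = emeasure \<G> {m \<in> space \<G>. emeasure m UNIV \<in> B \<and> normalize_measure m \<in> E}"
  proof -
    let ?S = "{m \<in> space \<G>. emeasure m UNIV \<in> B \<and> normalize_measure m \<in> E}"
    have "emeasure ?L B = (\<integral>\<^sup>+m. w m * indicator ((\<lambda>m. emeasure m UNIV) -` B \<inter> space \<G>) m \<partial>\<G>)"
      by (simp add: emeasure_distr emeasure_density)
    also have "\<dots> = (\<integral>\<^sup>+m. indicator ?S m \<partial>\<G>)"
      by (intro nn_integral_cong) (auto simp: w_def indicator_def)
    also have "\<dots> = emeasure \<G> ?S" by (rule nn_integral_indicator) measurable
    finally show ?thesis .
  qed
  moreover have "emeasure ?R B = emeasure (dirichlet_law \<G>) E * emeasure (distr \<G> borel (\<lambda>m. emeasure m UNIV)) B"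
    by (simp add: emeasure_density nn_integral_cmult_indicator)
  ultimately show ?thesis by simp
qed

lemma total_mass_indep_normalized:
  "gamma_dist \<theta> \<Otimes>\<^sub>M dirichlet_law \<G>
    = distr \<G> (borel \<Otimes>\<^sub>M bf_measures) (\<lambda>m. (measure m UNIV, normalize_measure m))"
proof (rule pair_measure_eqI)
  note measurable_normalize_\<G> [measurable]
  interpret g: prob_space "gamma_dist \<theta>" using \<theta> by (intro prob_space_gamma_dist) auto
  show "sigma_finite_measure (gamma_dist \<theta>)" "sigma_finite_measure (dirichlet_law \<G>)" by unfold_locales
  show "sets (gamma_dist \<theta> \<Otimes>\<^sub>M dirichlet_law \<G>)
      = sets (distr \<G> (borel \<Otimes>\<^sub>M bf_measures) (\<lambda>m. (measure m UNIV, normalize_measure m)))"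
    by (simp cong: sets_pair_measure_cong)
  fix A E assume "A \<in> sets (gamma_dist \<theta>)" "E \<in> sets (dirichlet_law \<G>)"
  then have [measurable]: "A \<in> sets borel" "E \<in> sets bf_measures" by auto
  let ?B = "enn2real -` A"
  have [measurable]: "?B \<in> sets borel" using measurable_sets[of enn2real borel borel A] by simp
  have "ennreal -` ?B \<in> sets borel" using measurable_sets[of ennreal borel borel ?B] by simp
  have "emeasure (distr \<G> (borel \<Otimes>\<^sub>M bf_measures) (\<lambda>m. (measure m UNIV, normalize_measure m))) (A \<times> E)
      = emeasure \<G> {m \<in> space \<G>. emeasure m UNIV \<in> ?B \<and> normalize_measure m \<in> E}"
    by (subst emeasure_distr) (auto intro!: arg_cong2[where f=emeasure] simp: measure_def)
  also have "\<dots> = emeasure (dirichlet_law \<G>) E * emeasure (distr \<G> borel (\<lambda>m. emeasure m UNIV)) ?B"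
    by (rule emeasure_total_normalized) measurable
  also have "emeasure (distr \<G> borel (\<lambda>m. emeasure m UNIV)) ?B = emeasure (gamma_dist \<theta>) (ennreal -` ?B)"
    by (simp add: marginal emeasure_distr)
  also have "\<dots> = emeasure (gamma_dist \<theta>) A"
    using \<open>ennreal -` ?B \<in> sets borel\<close> AE_gamma_dist_pos[OF \<theta>]
    by (intro emeasure_eq_AE) (auto elim!: eventually_mono)
  finally show "emeasure (gamma_dist \<theta>) A * emeasure (dirichlet_law \<G>) E =
      emeasure (distr \<G> (borel \<Otimes>\<^sub>M bf_measures) (\<lambda>m. (measure m UNIV, normalize_measure m))) (A \<times> E)"
    by (simp add: mult.commute)
qed

lemma sets_beta_gamma [simp, measurable_cong]: "sets (beta_gamma_law \<G> \<theta> q) = sets bf_measures"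
  by (simp add: beta_gamma_law_def sets_\<G>)

lemma scale_normalize:
  assumes "0 < emeasure m UNIV" "emeasure m UNIV < \<infinity>" "space m = UNIV"
  shows "scale_measure (ennreal (measure m UNIV)) (normalize_measure m) = m"
proof -
  have "ennreal (measure m UNIV) = emeasure m UNIV" using assms by (simp add: emeasure_eq_ennreal_measure)
  moreover have "emeasure m UNIV * (1 / emeasure m UNIV) = 1"
    using assms by (simp add: ennreal_times_divide ennreal_divide_self)
  ultimately show ?thesis using assms by (simp add: normalize_measure_def)
qed

text \<open>The beta-gamma process is \<open>T\<^sub>q P\<close>: its density depends on \<open>\<mu> = T P\<close> only through \<open>T\<close>, which is
  independent of \<open>P\<close>, and turns the shape \<open>\<theta>\<close> of \<open>T\<close> into \<open>q\<close>.\<close>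

lemma nn_integral_beta_gamma:
  assumes q: "q > 0" and F[measurable]: "F \<in> borel_measurable bf_measures"
  shows "(\<integral>\<^sup>+m. F m \<partial>beta_gamma_law \<G> \<theta> q)
    = (\<integral>\<^sup>+p. \<integral>\<^sup>+t. F (scale_measure (ennreal t) p) \<partial>gamma_dist q \<partial>dirichlet_law \<G>)"
proof -
  note measurable_normalize_\<G> [measurable]
  interpret g: prob_space "gamma_dist \<theta>" using \<theta> by (intro prob_space_gamma_dist) auto
  interpret pair_sigma_finite "gamma_dist \<theta>" "dirichlet_law \<G>" ..
  define w where "w t = ennreal (Gamma \<theta> / Gamma q * t powr (q - \<theta>))" for t
  have [measurable]: "w \<in> borel_measurable borel" unfolding w_def by measurable
  have "(\<integral>\<^sup>+m. F m \<partial>beta_gamma_law \<G> \<theta> q) = (\<integral>\<^sup>+m. w (measure m UNIV) * F m \<partial>\<G>)"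
    unfolding beta_gamma_law_def by (subst nn_integral_density) (auto simp: w_def)
  also have "\<dots> = (\<integral>\<^sup>+m. w (measure m UNIV) * F (scale_measure (ennreal (measure m UNIV)) (normalize_measure m)) \<partial>\<G>)"
  proof (rule nn_integral_cong_AE)
    have "AE m in \<G>. space m = UNIV" by (rule AE_I2) (simp add: space_\<G> boundedly_finite_space)
    then show "AE m in \<G>. w (measure m UNIV) * F m =
        w (measure m UNIV) * F (scale_measure (ennreal (measure m UNIV)) (normalize_measure m))"
      using AE_total_mass by eventually_elim (simp add: scale_normalize)
  qed
  also have "\<dots> = (\<integral>\<^sup>+x. w (fst x) * F (scale_measure (ennreal (fst x)) (snd x)) \<partial>(gamma_dist \<theta> \<Otimes>\<^sub>M dirichlet_law \<G>))"
    unfolding total_mass_indep_normalized by (subst nn_integral_distr) auto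
  also have "\<dots> = (\<integral>\<^sup>+p. \<integral>\<^sup>+t. w t * F (scale_measure (ennreal t) p) \<partial>gamma_dist \<theta> \<partial>dirichlet_law \<G>)"
    by (subst nn_integral_snd[symmetric]) auto
  also have "\<dots> = (\<integral>\<^sup>+p. \<integral>\<^sup>+t. F (scale_measure (ennreal t) p) \<partial>gamma_dist q \<partial>dirichlet_law \<G>)"
  proof (rule nn_integral_cong)
    fix p assume "p \<in> space (dirichlet_law \<G>)"
    then have [measurable]: "p \<in> space bf_measures" by (simp add: sets_eq_imp_space_eq[OF sets_dirichlet])
    have "(\<integral>\<^sup>+t. F (scale_measure (ennreal t) p) \<partial>gamma_dist q)
        = (\<integral>\<^sup>+t. F (scale_measure (ennreal t) p) \<partial>density (gamma_dist \<theta>) w)"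
      using gamma_dist_reweight[OF \<theta> q] by (simp add: w_def[abs_def])
    also have "\<dots> = (\<integral>\<^sup>+t. w t * F (scale_measure (ennreal t) p) \<partial>gamma_dist \<theta>)"
      by (rule nn_integral_density) measurable
    finally show "(\<integral>\<^sup>+t. w t * F (scale_measure (ennreal t) p) \<partial>gamma_dist \<theta>)
        = (\<integral>\<^sup>+t. F (scale_measure (ennreal t) p) \<partial>gamma_dist q)" ..
  qed
  finally show ?thesis .
qed

text \<open>Writing both processes as a gamma variable times \<open>P\<close> reduces this to \<open>beta_times_gamma\<close>.\<close>

lemma nn_integral_beta_scaled_beta_gamma:
  assumes q: "0 < q" "q < r" and F[measurable]: "F \<in> borel_measurable bf_measures"
  shows "(\<integral>\<^sup>+u. \<integral>\<^sup>+m. F (scale_measure (ennreal u) m) \<partial>beta_gamma_law \<G> \<theta> r \<partial>beta_dist q (r - q))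
    = (\<integral>\<^sup>+m. F m \<partial>beta_gamma_law \<G> \<theta> q)"
proof -
  interpret g: prob_space "gamma_dist r" using q by (intro prob_space_gamma_dist) auto
  interpret b: prob_space "beta_dist q (r - q)" by (rule prob_space_beta_dist[OF q])
  interpret pair_sigma_finite "beta_dist q (r - q)" "dirichlet_law \<G>" ..
  have "(\<integral>\<^sup>+u. \<integral>\<^sup>+m. F (scale_measure (ennreal u) m) \<partial>beta_gamma_law \<G> \<theta> r \<partial>beta_dist q (r - q))
      = (\<integral>\<^sup>+u. \<integral>\<^sup>+p. \<integral>\<^sup>+t. F (scale_measure (ennreal (u * t)) p) \<partial>gamma_dist r \<partial>dirichlet_law \<G> \<partial>beta_dist q (r - q))"
  proof (rule nn_integral_cong_AE)
    show "AE u in beta_dist q (r - q). (\<integral>\<^sup>+m. F (scale_measure (ennreal u) m) \<partial>beta_gamma_law \<G> \<theta> r)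
      = (\<integral>\<^sup>+p. \<integral>\<^sup>+t. F (scale_measure (ennreal (u * t)) p) \<partial>gamma_dist r \<partial>dirichlet_law \<G>)"
      using AE_beta_dist_pos
    proof eventually_elim
      case (elim u)
      then show ?case using q by (subst nn_integral_beta_gamma) (auto simp: ennreal_mult')
    qed
  qed
  also have "\<dots> = (\<integral>\<^sup>+p. \<integral>\<^sup>+u. \<integral>\<^sup>+t. F (scale_measure (ennreal (u * t)) p) \<partial>gamma_dist r \<partial>beta_dist q (r - q) \<partial>dirichlet_law \<G>)"
    by (rule Fubini'[symmetric]) measurable
  also have "\<dots> = (\<integral>\<^sup>+p. \<integral>\<^sup>+t. F (scale_measure (ennreal t) p) \<partial>gamma_dist q \<partial>dirichlet_law \<G>)"
  proof (rule nn_integral_cong)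
    fix p assume "p \<in> space (dirichlet_law \<G>)"
    then have [measurable]: "p \<in> space bf_measures" by (simp add: sets_eq_imp_space_eq[OF sets_dirichlet])
    show "(\<integral>\<^sup>+u. \<integral>\<^sup>+t. F (scale_measure (ennreal (u * t)) p) \<partial>gamma_dist r \<partial>beta_dist q (r - q))
        = (\<integral>\<^sup>+t. F (scale_measure (ennreal t) p) \<partial>gamma_dist q)"
      by (rule beta_times_gamma[OF q]) measurable
  qed
  also have "\<dots> = (\<integral>\<^sup>+m. F m \<partial>beta_gamma_law \<G> \<theta> q)"
    using q by (subst nn_integral_beta_gamma) auto
  finally show ?thesis .
qed

end

section \<open>Moments of the total mass and set partitions\<close>

text \<open>A partition of \<open>insert a A\<close> arises from one of \<open>A\<close> by adding \<open>a\<close> to a cell \<open>D\<close> or by making \<open>{a}\<close> a new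
  cell.  Taking \<open>D = {}\<close> for the second case covers both with a single formula.\<close>

lemma sum_partition_on_insert:
  fixes g :: "'b set set \<Rightarrow> 'c::comm_monoid_add"
  assumes A: "finite A" "a \<notin> A"
  shows "(\<Sum>q | partition_on (insert a A) q. g q)
    = (\<Sum>p | partition_on A p. \<Sum>D\<in>insert {} p. g (insert (insert a D) (p - {D})))"
proof -
  let ?P = "{p. partition_on A p}"
  define cell where "cell q = \<Union>{C \<in> q. a \<in> C}" for q :: "'b set set"
  have fin: "finite ?P" "\<And>p. p \<in> ?P \<Longrightarrow> finite (insert {} p)"
    using A finitely_many_partition_on finite_elements by auto
  have "(\<Sum>p\<in>?P. \<Sum>D\<in>insert {} p. g (insert (insert a D) (p - {D})))
      = (\<Sum>(p, D)\<in>Sigma ?P (insert {}). g (insert (insert a D) (p - {D})))"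
    by (rule sum.Sigma) (use fin in auto)
  also have "\<dots> = (\<Sum>q | partition_on (insert a A) q. g q)"
  proof (rule sum.reindex_bij_witness[where j="\<lambda>(p, D). insert (insert a D) (p - {D})"
        and i="\<lambda>q. (insert (cell q - {a}) (q - {cell q}) - {{}}, cell q - {a})"])
    fix x assume "x \<in> Sigma ?P (insert {})"
    then obtain p D where x: "x = (p, D)" and p: "partition_on A p" and D: "D = {} \<or> D \<in> p" by auto
    have sub: "C \<in> p \<Longrightarrow> C \<subseteq> A" for C using partition_onD1[OF p] by auto
    have disj: "C \<in> p \<Longrightarrow> C' \<in> p \<Longrightarrow> C \<noteq> C' \<Longrightarrow> C \<inter> C' = {}" for C C'
      using partition_onD2[OF p] by (auto simp: disjoint_def)
    have empty: "{} \<notin> p" using partition_onD3[OF p] .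
    have aC: "C \<in> p \<Longrightarrow> a \<notin> C" for C using sub A by auto
    have aD: "a \<notin> D" using D aC by auto
    let ?q = "insert (insert a D) (p - {D})"
    have cell: "cell ?q = insert a D"
      unfolding cell_def using aC by auto
    have "insert a D \<notin> p" using aC by auto
    then have rest: "?q - {insert a D} = p - {D}" by auto
    have diff: "insert a D - {a} = D" using aD by auto
    have "insert D (p - {D}) - {{}} = p" using D empty by auto
    then show "(\<lambda>q. (insert (cell q - {a}) (q - {cell q}) - {{}}, cell q - {a})) ((\<lambda>(p, D). insert (insert a D) (p - {D})) x) = x"
      by (simp add: x cell rest diff)
    have "partition_on (insert a A) ?q"
    proof (rule partition_onI)
      have "\<Union>p = D \<union> \<Union>(p - {D})" using D by auto
      then show "\<Union>?q = insert a A" using partition_onD1[OF p] by auto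
      show "disjnt C C'" if cells: "C \<in> ?q" "C' \<in> ?q" "C \<noteq> C'" for C C'
      proof -
        have *: "X \<in> p - {D} \<Longrightarrow> X \<inter> insert a D = {}" for X
          using D disj[of X D] aC by auto
        consider "C \<in> p - {D}" "C' \<in> p - {D}" | "C = insert a D" "C' \<in> p - {D}" | "C \<in> p - {D}" "C' = insert a D"
          using cells by blast
        then show ?thesis
          unfolding disjnt_def using * cells(3) disj by cases (simp_all add: Int_commute)
      qed
      show "{} \<notin> ?q" using empty by auto
    qed
    then show "(\<lambda>(p, D). insert (insert a D) (p - {D})) x \<in> {q. partition_on (insert a A) q}"
      by (simp add: x)
    show "g ((\<lambda>(p, D). insert (insert a D) (p - {D})) x) = (case x of (p, D) \<Rightarrow> g (insert (insert a D) (p - {D})))"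
      by (simp add: x)
  next
    fix q assume "q \<in> {q. partition_on (insert a A) q}"
    then have q: "partition_on (insert a A) q" by simp
    have disj: "C \<in> q \<Longrightarrow> C' \<in> q \<Longrightarrow> C \<noteq> C' \<Longrightarrow> C \<inter> C' = {}" for C C'
      using partition_onD2[OF q] by (auto simp: disjoint_def)
    have empty: "{} \<notin> q" using partition_onD3[OF q] .
    obtain C where C: "C \<in> q" "a \<in> C" using partition_onD1[OF q] by auto
    have only: "C' = C" if "C' \<in> q" "a \<in> C'" for C'
      using disj[OF that(1) C(1)] that C by auto
    have "{C' \<in> q. a \<in> C'} = {C}" using C only by blast
    then have cell: "cell q = C" by (simp add: cell_def)
    let ?p = "insert (C - {a}) (q - {C}) - {{}}"
    have notin: "C - {a} \<notin> q - {C}" if "C - {a} \<noteq> {}"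
    proof
      assume "C - {a} \<in> q - {C}"
      then have "(C - {a}) \<inter> C = {}" using disj[of "C - {a}" C] C by auto
      then show False using that by auto
    qed
    have "insert D (q - {C}) - {{}} - {D} = q - {C}" if "D \<noteq> {} \<Longrightarrow> D \<notin> q - {C}" for D
      using that empty by blast
    from this[OF notin] have "?p - {C - {a}} = q - {C}" .
    then show "(\<lambda>(p, D). insert (insert a D) (p - {D})) (insert (cell q - {a}) (q - {cell q}) - {{}}, cell q - {a}) = q"
      using C by (auto simp: cell insert_absorb)
    have "partition_on A ?p"
    proof (rule partition_onI)
      define U where "U = \<Union>(q - {C})"
      have "insert a A = C \<union> U" using C(1) partition_onD1[OF q] unfolding U_def by blast
      moreover have "a \<notin> U" using only unfolding U_def by blast
      ultimately have "(C - {a}) \<union> U = insert a A - {a}" by (simp add: Un_Diff)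
      also have "\<dots> = A" using A(2) by simp
      finally have "(C - {a}) \<union> U = A" .
      moreover have "\<Union>?p = (C - {a}) \<union> U" unfolding U_def by auto
      ultimately show "\<Union>?p = A" by simp
      show "disjnt X Y" if cells: "X \<in> ?p" "Y \<in> ?p" "X \<noteq> Y" for X Y
      proof -
        have *: "Z \<in> q - {C} \<Longrightarrow> Z \<inter> C = {}" for Z using disj[of Z C] C by auto
        consider "X \<in> q - {C}" "Y \<in> q - {C}" | "X = C - {a}" "Y \<in> q - {C}" | "X \<in> q - {C}" "Y = C - {a}"
          using cells by blast
        then show ?thesis
        proof cases
          case 1
          then show ?thesis using disj cells(3) by (simp add: disjnt_def)
        next
          case 2
          then show ?thesis using *[of Y] by (auto simp: disjnt_def)
        next
          case 3
          then show ?thesis using *[of X] by (auto simp: disjnt_def)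
        qed
      qed
    qed simp
    then show "(insert (cell q - {a}) (q - {cell q}) - {{}}, cell q - {a}) \<in> Sigma ?P (insert {})"
      by (simp add: cell)
  qed
  finally show ?thesis ..
qed

lemma card_cell_pos: "finite A \<Longrightarrow> partition_on A p \<Longrightarrow> C \<in> p \<Longrightarrow> 0 < card C"
  using partition_onD1[of A p] partition_onD3[of A p] finite_subset[of C A]
  by (auto simp: card_gt_0_iff)

text \<open>By the product rule a derivative falls on \<open>L\<close>, which creates the factor \<open>W 1\<close> of a new singleton, or on
  the factor of a cell, which grows by one element.  These are the two ways of extending a partition.\<close>

lemma has_derivative_partition_sum:
  fixes W :: "nat \<Rightarrow> real \<Rightarrow> real" and L :: "real \<Rightarrow> real"
  assumes W: "\<And>e. e > 0 \<Longrightarrow> (W e has_real_derivative - W (Suc e) s) (at s)"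
    and L: "(L has_real_derivative - (W 1 s * L s)) (at s)"
    and A: "finite A" "a \<notin> A"
  shows "((\<lambda>s. \<Sum>p | partition_on A p. L s * (\<Prod>C\<in>p. W (card C) s)) has_real_derivative
    - (\<Sum>q | partition_on (insert a A) q. L s * (\<Prod>C\<in>q. W (card C) s))) (at s)"
proof -
  have step: "((\<lambda>s. L s * (\<Prod>C\<in>p. W (card C) s)) has_real_derivative
      - (\<Sum>D\<in>insert {} p. L s * (\<Prod>C\<in>insert (insert a D) (p - {D}). W (card C) s))) (at s)"
    if p: "partition_on A p" for p
  proof -
    have fin: "finite p" using finite_elements[OF A(1) p] .
    have cells: "a \<notin> C" "0 < card C" "finite C" if "C \<in> p" for C
      using partition_onD1[OF p] A that card_cell_pos[OF A(1) p that] by (auto intro: card_ge_0_finite)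
    have new: "insert a D \<notin> p - {D}" for D using cells(1) by auto
    have "((\<lambda>s. \<Prod>C\<in>p. W (card C) s) has_real_derivative
        (\<Sum>D\<in>p. - W (Suc (card D)) s * (\<Prod>C\<in>p - {D}. W (card C) s))) (at s)"
      by (rule has_field_derivative_prod) (use W cells in auto)
    note deriv = DERIV_mult[OF L this]
    have "(\<Sum>D\<in>insert {} p. L s * (\<Prod>C\<in>insert (insert a D) (p - {D}). W (card C) s))
        = L s * (W 1 s * (\<Prod>C\<in>p. W (card C) s))
          + (\<Sum>D\<in>p. L s * (W (Suc (card D)) s * (\<Prod>C\<in>p - {D}. W (card C) s)))"
    proof -
      have "(\<Prod>C\<in>insert (insert a D) (p - {D}). W (card C) s)
          = W (Suc (card D)) s * (\<Prod>C\<in>p - {D}. W (card C) s)" if "D \<in> p" for D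
        using fin new[of D] cells[OF that] by (subst prod.insert) auto
      moreover have "(\<Prod>C\<in>insert {a} p. W (card C) s) = W 1 s * (\<Prod>C\<in>p. W (card C) s)"
        using fin cells(1)[of "{a}"] by (subst prod.insert) auto
      ultimately show ?thesis
        using fin partition_onD3[OF p] by (subst sum.insert) auto
    qed
    then show ?thesis
      by (intro DERIV_cong[OF deriv]) (simp add: sum_negf sum_distrib_left sum_distrib_right mult_ac)
  qed
  have "((\<lambda>s. \<Sum>p | partition_on A p. L s * (\<Prod>C\<in>p. W (card C) s)) has_real_derivative
    (\<Sum>p | partition_on A p. - (\<Sum>D\<in>insert {} p. L s * (\<Prod>C\<in>insert (insert a D) (p - {D}). W (card C) s)))) (at s)"
    by (rule DERIV_sum) (use step in blast)
  then show ?thesis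
    unfolding sum_partition_on_insert[OF A] by (simp only: sum_negf)
qed

context gamma_process
begin

text \<open>The density \<open>T\<^sup>0\<close> is 1 only where \<open>T > 0\<close>, because \<open>0 powr 0 = 0\<close>; this holds almost surely.\<close>

lemma \<G>_eq_beta_gamma: "beta_gamma_law \<G> \<theta> \<theta> = \<G>"
proof -
  have "beta_gamma_law \<G> \<theta> \<theta> = density \<G> (\<lambda>_. 1)"
    unfolding beta_gamma_law_def
  proof (rule density_cong)
    show "AE m in \<G>. ennreal (Gamma \<theta> / Gamma \<theta> * measure m UNIV powr - (\<theta> - \<theta>)) = 1"
      using AE_total_mass
    proof eventually_elim
      case (elim m)
      then have "measure m UNIV \<noteq> 0" by (auto simp: enn2real_eq_0_iff measure_def)
      then show ?case using Gamma_real_pos[OF \<theta>] by simp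
    qed
  qed measurable
  then show ?thesis by (simp add: density_1)
qed

lemma prob_space_beta_gamma: "q > 0 \<Longrightarrow> prob_space (beta_gamma_law \<G> \<theta> q)"
  using nn_integral_beta_gamma[of q "\<lambda>_. 1"] prob_space.emeasure_space_1[OF prob_space_gamma_dist, of q]
  by (intro prob_spaceI) (simp add: D.emeasure_space_1)

lemma nn_integral_total_mass_power: "(\<integral>\<^sup>+m. ennreal (measure m UNIV ^ n) \<partial>\<G>) < \<infinity>"
proof -
  interpret g: prob_space "beta_gamma_law \<G> \<theta> (\<theta> + n)"
    using \<theta> by (intro prob_space_beta_gamma) auto
  define K where "K = Gamma \<theta> / Gamma (\<theta> + n)"
  have K: "K > 0" using \<theta> by (auto simp: K_def intro!: divide_pos_pos Gamma_real_pos add_pos_nonneg)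
  have "(\<integral>\<^sup>+m. ennreal (measure m UNIV ^ n) \<partial>\<G>)
      = (\<integral>\<^sup>+m. ennreal (1 / K) * ennreal (K * measure m UNIV powr - (\<theta> - (\<theta> + n))) \<partial>\<G>)"
  proof (rule nn_integral_cong_AE)
    show "AE m in \<G>. ennreal (measure m UNIV ^ n) = ennreal (1 / K) * ennreal (K * measure m UNIV powr - (\<theta> - (\<theta> + n)))"
      using AE_total_mass
    proof eventually_elim
      case (elim m)
      then have "measure m UNIV > 0" by (simp add: measure_def enn2real_positive_iff)
      then show ?case using K by (simp add: powr_realpow flip: ennreal_mult')
    qed
  qed
  also have "\<dots> = ennreal (1 / K) * (\<integral>\<^sup>+m. ennreal (K * measure m UNIV powr - (\<theta> - (\<theta> + n))) \<partial>\<G>)"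
    by (rule nn_integral_cmult) measurable
  also have "(\<integral>\<^sup>+m. ennreal (K * measure m UNIV powr - (\<theta> - (\<theta> + n))) \<partial>\<G>)
      = emeasure (beta_gamma_law \<G> \<theta> (\<theta> + n)) (space \<G>)"
    unfolding beta_gamma_law_def K_def by (subst emeasure_density) (auto cong: nn_integral_cong)
  also have "\<dots> = 1"
    using g.emeasure_space_1 by (simp add: beta_gamma_law_def)
  finally show ?thesis by simp
qed

text \<open>Shifting all values \<open>c i\<close> by \<open>s\<close> inserts the weight \<open>e\<^sup>-\<^sup>s\<^sup>T\<close>, so the derivative in \<open>s\<close> at 0 multiplies the
  integrand with \<open>- T\<close>.  On the right-hand side the same derivative is
  \<open>has_derivative_partition_sum\<close>, and the formula follows by induction on \<open>n\<close>.\<close>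

lemma moment_laplace:
  assumes A: "\<And>i. i < k \<Longrightarrow> A i \<in> sets borel" "disjoint_family_on A {..<(k::nat)}" "(\<Union>i<k. A i) = UNIV"
    and c: "\<And>i. i < k \<Longrightarrow> 0 \<le> c i"
  shows "(\<integral>\<^sup>+m. ennreal (measure m UNIV ^ n * expneg (\<Sum>i<k. ennreal (c i) * emeasure m (A i))) \<partial>\<G>)
    = ennreal (\<Sum>p | partition_on {1..n} p. (\<Prod>i<k. (1 + c i) powr (- \<theta> * measure H (A i))) *
        (\<Prod>C\<in>p. \<theta> * Gamma (real (card C)) * (\<Sum>i<k. measure H (A i) / (1 + c i) ^ card C)))"
  using c
proof (induction n arbitrary: c)
  case 0
  then show ?case
    using laplace[OF A(1,2), of c] by (simp add: partition_on_empty)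
next
  case (Suc n)
  note c = Suc.prems
  have [measurable]: "\<And>i. i \<in> {..<k} \<Longrightarrow> A i \<in> sets borel" using A by auto
  define h where "h i = measure H (A i)" for i
  define L where "L s = (\<Prod>i<k. (1 + (c i + s)) powr (- \<theta> * h i))" for s
  define W where "W e s = \<theta> * Gamma (real e) * (\<Sum>i<k. h i / (1 + (c i + s)) ^ e)" for e s
  define R where "R n s = (\<Sum>p | partition_on {1..n} p. L s * (\<Prod>C\<in>p. W (card C) s))" for n :: nat and s
  define K where "K n s = (\<integral>\<^sup>+m. ennreal (measure m UNIV ^ n * expneg (\<Sum>i<k. ennreal (c i + s) * emeasure m (A i))) \<partial>\<G>)" for n :: nat and s
  have IH: "K n s = ennreal (R n s)" if "s \<ge> 0" for s
    using Suc.IH[of "\<lambda>i. c i + s"] c that by (simp add: K_def R_def L_def W_def h_def)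
  have W': "(W e has_real_derivative - W (Suc e) 0) (at 0)" if e: "e > 0" for e
  proof -
    have "((\<lambda>s. h i / (1 + (c i + s)) ^ e) has_real_derivative - (real e * (h i / (1 + (c i + 0)) ^ Suc e))) (at 0)" if "i < k" for i
    proof -
      define y where "y = 1 + (c i + 0)"
      have y: "y > 0" using c[OF that] by (simp add: y_def)
      obtain d where d: "e = Suc d" using e by (cases e) auto
      have "((\<lambda>s. (1 + (c i + s)) ^ e) has_real_derivative real e * y ^ d) (at 0)"
        unfolding y_def d by (rule derivative_eq_intros refl | simp)+
      from DERIV_quotient[OF DERIV_const[of "h i"] this]
      have "((\<lambda>s. h i / (1 + (c i + s)) ^ e) has_real_derivative
          (0 * y ^ e - real e * y ^ d * h i) / (y ^ e) ^ Suc (Suc 0)) (at 0)"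
        using y by (simp add: y_def)
      moreover have "(0 * y ^ e - real e * y ^ d * h i) / (y ^ e) ^ Suc (Suc 0) = - (real e * (h i / y ^ Suc e))"
        using y by (simp add: d)
      ultimately show ?thesis unfolding y_def by (rule DERIV_cong)
    qed
    then have "(W e has_real_derivative \<theta> * Gamma (real e) * (\<Sum>i<k. - (real e * (h i / (1 + (c i + 0)) ^ Suc e)))) (at 0)"
      unfolding W_def by (intro DERIV_cmult DERIV_sum) auto
    moreover have "Gamma (real (Suc e)) = real e * Gamma (real e)"
    proof -
      have "real e \<notin> \<int>\<^sub>\<le>\<^sub>0" using e by (auto elim!: nonpos_Ints_cases)
      from Gamma_plus1[OF this] show ?thesis by (simp add: add.commute)
    qed
    ultimately show ?thesis
      by (simp add: W_def sum_negf sum_distrib_left mult_ac)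
  qed
  have L': "(L has_real_derivative - (W 1 0 * L 0)) (at 0)"
  proof -
    have "(L has_real_derivative L 0 * (\<Sum>i<k. (- \<theta> * h i * (1 + (c i + 0)) powr (- \<theta> * h i - 1)) / (1 + (c i + 0)) powr (- \<theta> * h i))) (at 0)"
      unfolding L_def
    proof (rule has_field_derivative_prod')
      fix i assume "i \<in> {..<k}"
      then have "c i \<ge> 0" using c by auto
      then show "(1 + (c i + 0)) powr (- \<theta> * h i) \<noteq> 0" by simp
      show "((\<lambda>s. (1 + (c i + s)) powr (- \<theta> * h i)) has_real_derivative
          - \<theta> * h i * (1 + (c i + 0)) powr (- \<theta> * h i - 1)) (at 0)"
        using \<open>c i \<ge> 0\<close> by (auto intro!: derivative_eq_intros)
    qed
    also have "(\<Sum>i<k. (- \<theta> * h i * (1 + (c i + 0)) powr (- \<theta> * h i - 1)) / (1 + (c i + 0)) powr (- \<theta> * h i)) = - W 1 0"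
      unfolding W_def sum_distrib_left sum_negf[symmetric]
    proof (intro sum.cong refl)
      fix i assume "i \<in> {..<k}"
      then have "c i \<ge> 0" using c by auto
      then show "(- \<theta> * h i * (1 + (c i + 0)) powr (- \<theta> * h i - 1)) / (1 + (c i + 0)) powr (- \<theta> * h i)
          = - (\<theta> * Gamma (real 1) * (h i / (1 + (c i + 0)) ^ 1))"
        by (simp add: powr_diff)
    qed
    finally show ?thesis by (simp add: mult.commute)
  qed
  have R': "(R n has_real_derivative - R (Suc n) 0) (at 0)"
  proof -
    have "{1..Suc n} = insert (Suc n) {1..n}" by auto
    then show ?thesis
      unfolding R_def using has_derivative_partition_sum[OF W' L', of "{1..n}" "Suc n"] by simp
  qed
  \<comment> \<open>Difference quotients along \<open>s = 1 / (j + 1)\<close>; they are dominated by \<open>T\<^sup>n\<^sup>+\<^sup>1\<close>, which is integrable.\<close>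
  define eps where "eps j = inverse (real (Suc j))" for j
  have eps: "eps j > 0" "eps j \<noteq> 0" for j by (simp_all add: eps_def)
  define u where "u j m = ennreal (measure m UNIV ^ n * expneg (\<Sum>i<k. ennreal (c i) * emeasure m (A i)) *
      ((1 - exp (- (eps j * measure m UNIV))) / eps j))" for j m
  have u_le: "u j m \<le> ennreal (measure m UNIV ^ Suc n)" for j m
  proof -
    have "(1 - exp (- (eps j * measure m UNIV))) / eps j \<le> measure m UNIV"
      using exp_ge_add_one_self[of "- (eps j * measure m UNIV)"] eps[of j] by (simp add: field_simps)
    moreover have "expneg (\<Sum>i<k. ennreal (c i) * emeasure m (A i)) \<le> 1" by simp
    ultimately have "measure m UNIV ^ n * expneg (\<Sum>i<k. ennreal (c i) * emeasure m (A i)) *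
      ((1 - exp (- (eps j * measure m UNIV))) / eps j) \<le> (measure m UNIV ^ n * 1) * measure m UNIV"
      using eps[of j] by (intro mult_mono) (auto simp: mult_left_le)
    then show ?thesis unfolding u_def by (intro ennreal_leI) (simp add: mult.commute)
  qed
  have "(\<lambda>j. \<integral>\<^sup>+m. u j m \<partial>\<G>) \<longlonglongrightarrow> (\<integral>\<^sup>+m. ennreal (measure m UNIV ^ Suc n * expneg (\<Sum>i<k. ennreal (c i) * emeasure m (A i))) \<partial>\<G>)"
  proof (rule nn_integral_dominated_convergence)
    show "AE m in \<G>. (\<lambda>j. u j m) \<longlonglongrightarrow> ennreal (measure m UNIV ^ Suc n * expneg (\<Sum>i<k. ennreal (c i) * emeasure m (A i)))"
    proof (rule AE_I2)
      fix m :: "'y measure"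
      define T where "T = measure m UNIV"
      have "((\<lambda>x. exp (- (x * T))) has_real_derivative - T) (at 0)"
        by (auto intro!: derivative_eq_intros)
      then have "((\<lambda>x. (exp (- (x * T)) - 1) / x) \<longlongrightarrow> - T) (at 0)"
        by (simp add: has_field_derivative_iff)
      moreover have "filterlim eps (at 0) sequentially"
        unfolding eps_def filterlim_at using LIMSEQ_inverse_real_of_nat by auto
      ultimately have "(\<lambda>j. (exp (- (eps j * T)) - 1) / eps j) \<longlonglongrightarrow> - T"
        by (rule filterlim_compose)
      then have "(\<lambda>j. - ((exp (- (eps j * T)) - 1) / eps j)) \<longlonglongrightarrow> - (- T)"
        by (rule tendsto_minus)
      then have "(\<lambda>j. (1 - exp (- (eps j * T))) / eps j) \<longlonglongrightarrow> T"
        by (simp add: diff_divide_distrib)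
      then have "(\<lambda>j. T ^ n * expneg (\<Sum>i<k. ennreal (c i) * emeasure m (A i)) * ((1 - exp (- (eps j * T))) / eps j))
          \<longlonglongrightarrow> T ^ n * expneg (\<Sum>i<k. ennreal (c i) * emeasure m (A i)) * T"
        by (intro tendsto_intros)
      then show "(\<lambda>j. u j m) \<longlonglongrightarrow> ennreal (measure m UNIV ^ Suc n * expneg (\<Sum>i<k. ennreal (c i) * emeasure m (A i)))"
        unfolding u_def T_def by (intro tendsto_ennrealI) (simp add: mult_ac)
    qed
    show "AE m in \<G>. u j m \<le> ennreal (measure m UNIV ^ Suc n)" for j
      by (rule AE_I2) (rule u_le)
    show "(\<integral>\<^sup>+m. ennreal (measure m UNIV ^ Suc n) \<partial>\<G>) < \<infinity>"
      by (rule nn_integral_total_mass_power)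
  qed (unfold u_def, measurable)
  moreover have "(\<lambda>j. \<integral>\<^sup>+m. u j m \<partial>\<G>) \<longlonglongrightarrow> ennreal (R (Suc n) 0)"
  proof -
    \<comment> \<open>The induction hypothesis at the shifts 0 and \<open>eps j\<close>.  The identity is proved in additive form, as
        subtraction of extended nonnegative reals is truncated.\<close>
    have int_u: "(\<integral>\<^sup>+m. u j m \<partial>\<G>) = ennreal ((R n 0 - R n (eps j)) / eps j)" for j
    proof -
      have R_nonneg: "R n s \<ge> 0" if "s \<ge> 0" for s
      proof -
        have "partition_on {1..n} p \<Longrightarrow> C \<in> p \<Longrightarrow> card C > 0" for p C
          by (rule card_cell_pos) auto
        then show ?thesis
          unfolding R_def L_def W_def h_def using \<theta> c that
          by (auto intro!: sum_nonneg mult_nonneg_nonneg prod_nonneg Gamma_real_nonneg divide_nonneg_nonneg)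
      qed
      have "K n 0 = K n (eps j) + ennreal (eps j) * (\<integral>\<^sup>+m. u j m \<partial>\<G>)"
      proof -
        have "K n 0 = (\<integral>\<^sup>+m. ennreal (measure m UNIV ^ n * expneg (\<Sum>i<k. ennreal (c i + eps j) * emeasure m (A i))) + ennreal (eps j) * u j m \<partial>\<G>)"
          unfolding K_def
        proof (rule nn_integral_cong_AE)
          show "AE m in \<G>. ennreal (measure m UNIV ^ n * expneg (\<Sum>i<k. ennreal (c i + 0) * emeasure m (A i)))
              = ennreal (measure m UNIV ^ n * expneg (\<Sum>i<k. ennreal (c i + eps j) * emeasure m (A i))) + ennreal (eps j) * u j m"
            using AE_total_mass AE_sets_borel
          proof eventually_elim
            case (elim m)
            have T: "emeasure m UNIV = ennreal (measure m UNIV)"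
              using elim by (auto simp: emeasure_eq_ennreal_measure)
            have "(\<Sum>i<k. ennreal (c i + eps j) * emeasure m (A i))
                = (\<Sum>i<k. ennreal (c i) * emeasure m (A i)) + ennreal (eps j) * (\<Sum>i<k. emeasure m (A i))"
              using c eps(1)[of j] by (simp add: sum_distrib_left distrib_right sum.distrib[symmetric] less_imp_le)
            also have "(\<Sum>i<k. emeasure m (A i)) = ennreal (measure m UNIV)"
              using partition_emeasure_UNIV[OF elim(2) A] T by simp
            finally have e: "expneg (\<Sum>i<k. ennreal (c i + eps j) * emeasure m (A i))
                = expneg (\<Sum>i<k. ennreal (c i) * emeasure m (A i)) * exp (- (eps j * measure m UNIV))"
              using eps(1)[of j] by (simp add: expneg_add less_imp_le flip: ennreal_mult)
            define y where "y = measure m UNIV ^ n * expneg (\<Sum>i<k. ennreal (c i) * emeasure m (A i))"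
            define x where "x = exp (- (eps j * measure m UNIV))"
            have nn: "0 \<le> y" "0 \<le> x" "x \<le> 1"
              using eps(1)[of j] by (simp_all add: x_def y_def)
            have "y = y * x + eps j * (y * ((1 - x) / eps j))"
              using eps(2)[of j] by (simp add: field_simps)
            then have "ennreal y = ennreal (y * x) + ennreal (eps j) * ennreal (y * ((1 - x) / eps j))"
              using nn eps(1)[of j] by (simp flip: ennreal_mult' ennreal_plus)
            then show ?case
              unfolding e u_def by (simp add: x_def y_def mult.assoc)
          qed
        qed
        also have "\<dots> = K n (eps j) + ennreal (eps j) * (\<integral>\<^sup>+m. u j m \<partial>\<G>)"
          unfolding K_def u_def by (subst nn_integral_add, measurable, subst nn_integral_cmult, measurable)
        finally show ?thesis .
      qed
      then have eq: "ennreal (R n 0) = ennreal (R n (eps j)) + ennreal (eps j) * (\<integral>\<^sup>+m. u j m \<partial>\<G>)"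
        using IH[of 0] IH[of "eps j"] eps(1)[of j] by simp
      then have "(\<integral>\<^sup>+m. u j m \<partial>\<G>) \<noteq> \<infinity>"
        using eps(1)[of j] by (auto simp: ennreal_mult_top)
      then obtain x where x: "(\<integral>\<^sup>+m. u j m \<partial>\<G>) = ennreal x" "x \<ge> 0"
        by (cases "\<integral>\<^sup>+m. u j m \<partial>\<G>") auto
      with eq have "R n 0 = R n (eps j) + eps j * x"
        using R_nonneg[of 0] R_nonneg[of "eps j"] eps(1)[of j]
        by (simp flip: ennreal_mult' ennreal_plus)
      then show ?thesis using x eps(1)[of j] by simp
    qed
    have "((\<lambda>x. (R n x - R n 0) / x) \<longlongrightarrow> - R (Suc n) 0) (at 0)"
      using R' by (simp add: has_field_derivative_iff)
    moreover have "filterlim eps (at 0) sequentially"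
      unfolding eps_def filterlim_at using LIMSEQ_inverse_real_of_nat by auto
    ultimately have "(\<lambda>j. (R n (eps j) - R n 0) / eps j) \<longlonglongrightarrow> - R (Suc n) 0"
      by (rule filterlim_compose)
    then have "(\<lambda>j. - ((R n (eps j) - R n 0) / eps j)) \<longlonglongrightarrow> - (- R (Suc n) 0)"
      by (rule tendsto_minus)
    then show ?thesis
      unfolding int_u by (intro tendsto_ennrealI) (simp add: diff_divide_distrib)
  qed
  ultimately have "(\<integral>\<^sup>+m. ennreal (measure m UNIV ^ Suc n * expneg (\<Sum>i<k. ennreal (c i) * emeasure m (A i))) \<partial>\<G>) = ennreal (R (Suc n) 0)"
    by (rule LIMSEQ_unique)
  then show ?case by (simp add: R_def L_def W_def h_def)
qed

text \<open>The factor \<open>\<Gamma>(\<theta>) / \<Gamma>(\<theta> + n)\<close> of the beta-gamma density turns the weights in \<open>moment_laplace\<close> into the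
  probabilities of the random partition.\<close>

lemma beta_gamma_laplace:
  assumes A: "\<And>i. i < k \<Longrightarrow> A i \<in> sets borel" "disjoint_family_on A {..<(k::nat)}" "(\<Union>i<k. A i) = UNIV"
    and c: "\<And>i. i < k \<Longrightarrow> 0 \<le> c i"
  shows "(\<integral>\<^sup>+m. ennreal (expneg (\<Sum>i<k. ennreal (c i) * emeasure m (A i))) \<partial>beta_gamma_law \<G> \<theta> (\<theta> + real n))
    = ennreal (\<Sum>p | partition_on {1..n} p. partition_prob \<theta> n p *
        ((\<Prod>i<k. (1 + c i) powr (- \<theta> * measure H (A i))) *
        (\<Prod>C\<in>p. \<Sum>i<k. measure H (A i) / (1 + c i) ^ card C)))"
proof -
  have [measurable]: "\<And>i. i \<in> {..<k} \<Longrightarrow> A i \<in> sets borel" using A by auto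
  define K where "K = Gamma \<theta> / Gamma (\<theta> + n)"
  have K: "K > 0" using \<theta> by (auto simp: K_def intro!: divide_pos_pos Gamma_real_pos add_pos_nonneg)
  let ?e = "\<lambda>m. expneg (\<Sum>i<k. ennreal (c i) * emeasure m (A i))"
  have "(\<integral>\<^sup>+m. ennreal (?e m) \<partial>beta_gamma_law \<G> \<theta> (\<theta> + real n))
      = (\<integral>\<^sup>+m. ennreal (K * measure m UNIV powr - (\<theta> - (\<theta> + n))) * ennreal (?e m) \<partial>\<G>)"
    unfolding beta_gamma_law_def K_def by (rule nn_integral_density) measurable
  also have "\<dots> = (\<integral>\<^sup>+m. ennreal K * ennreal (measure m UNIV ^ n * ?e m) \<partial>\<G>)"
  proof (rule nn_integral_cong_AE)
    show "AE m in \<G>. ennreal (K * measure m UNIV powr - (\<theta> - (\<theta> + n))) * ennreal (?e m)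
        = ennreal K * ennreal (measure m UNIV ^ n * ?e m)"
      using AE_total_mass
    proof eventually_elim
      case (elim m)
      then have "measure m UNIV > 0" by (simp add: measure_def enn2real_positive_iff)
      then show ?case using K by (simp add: powr_realpow mult.assoc flip: ennreal_mult')
    qed
  qed
  also have "\<dots> = ennreal K * (\<integral>\<^sup>+m. ennreal (measure m UNIV ^ n * ?e m) \<partial>\<G>)"
    by (rule nn_integral_cmult) measurable
  also have "\<dots> = ennreal (K * (\<Sum>p | partition_on {1..n} p. (\<Prod>i<k. (1 + c i) powr (- \<theta> * measure H (A i))) *
        (\<Prod>C\<in>p. \<theta> * Gamma (real (card C)) * (\<Sum>i<k. measure H (A i) / (1 + c i) ^ card C))))"
    using K by (subst moment_laplace[OF A c]) (auto simp: ennreal_mult')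
  also have "\<dots> = ennreal (\<Sum>p | partition_on {1..n} p. partition_prob \<theta> n p *
        ((\<Prod>i<k. (1 + c i) powr (- \<theta> * measure H (A i))) *
        (\<Prod>C\<in>p. \<Sum>i<k. measure H (A i) / (1 + c i) ^ card C)))"
    by (subst sum_distrib_left, intro arg_cong[of _ _ ennreal] sum.cong refl)
       (simp add: partition_prob_def K_def prod.distrib mult_ac)
  finally show ?thesis .
qed

end

section \<open>Independence of random variables with different target spaces\<close>

lemma measurable_if_gen_sigma_subset:
  assumes "gen_sigma \<Omega> S X \<subseteq> sets K" "space K = space \<Omega>" "X \<in> space \<Omega> \<rightarrow> space S"
  shows "X \<in> measurable K S"
proof (rule measurableI)
  fix A assume "A \<in> sets S"
  then have "X -` A \<inter> space \<Omega> \<in> gen_sigma \<Omega> S X"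
    using assms(3) by (simp add: gen_sigma_def in_vimage_algebra)
  then show "X -` A \<inter> space K \<in> sets K" using assms by auto
qed (use assms in auto)

lemma gen_sigma_subset:
  assumes "X \<in> measurable K S" "space K = space \<Omega>"
  shows "gen_sigma \<Omega> S X \<subseteq> sets K"
proof -
  have "X \<in> space \<Omega> \<rightarrow> space S" using measurable_space[OF assms(1)] assms(2) by auto
  then have "sets (vimage_algebra (space \<Omega>) X S) = {X -` A \<inter> space \<Omega> | A. A \<in> sets S}"
    by (rule sets_vimage_algebra2)
  then show ?thesis
    using measurable_sets[OF assms(1)] assms(2) by (auto simp: gen_sigma_def)
qed

lemma Int_stable_gen_sigma: "Int_stable (gen_sigma \<Omega> S X)"
  by (auto simp: Int_stable_def gen_sigma_def)

context prob_space
begin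

lemma indep_rvs_joint_law:
  assumes X: "X \<in> measurable M S" and Z: "Z \<in> measurable M S'"
    and indep: "indep_rvs M S X S' Z"
  shows "distr M S X \<Otimes>\<^sub>M distr M S' Z = distr M (S \<Otimes>\<^sub>M S') (\<lambda>\<omega>. (X \<omega>, Z \<omega>))"
proof (rule pair_measure_eqI)
  note X[measurable] Z[measurable]
  interpret X: prob_space "distr M S X" by (rule prob_space_distr) fact
  interpret Z: prob_space "distr M S' Z" by (rule prob_space_distr) fact
  show "sigma_finite_measure (distr M S X)" "sigma_finite_measure (distr M S' Z)" by unfold_locales
  fix A B assume "A \<in> sets (distr M S X)" "B \<in> sets (distr M S' Z)"
  then have A[measurable]: "A \<in> sets S" and B[measurable]: "B \<in> sets S'" by auto
  have "X -` A \<inter> space M \<in> gen_sigma M S X" "Z -` B \<inter> space M \<in> gen_sigma M S' Z"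
    using A B measurable_space[OF X] measurable_space[OF Z] by (auto simp: gen_sigma_def intro!: in_vimage_algebra)
  then have "prob ((X -` A \<inter> space M) \<inter> (Z -` B \<inter> space M)) = prob (X -` A \<inter> space M) * prob (Z -` B \<inter> space M)"
    using indep unfolding indep_rvs_def by (rule indep_setD[rotated])
  moreover have "(X -` A \<inter> space M) \<inter> (Z -` B \<inter> space M) = (\<lambda>\<omega>. (X \<omega>, Z \<omega>)) -` (A \<times> B) \<inter> space M"
    by auto
  ultimately show "emeasure (distr M S X) A * emeasure (distr M S' Z) B
      = emeasure (distr M (S \<Otimes>\<^sub>M S') (\<lambda>\<omega>. (X \<omega>, Z \<omega>))) (A \<times> B)"
    by (simp add: emeasure_distr emeasure_eq_measure ennreal_mult)
qed (simp cong: sets_pair_measure_cong)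

lemma nn_integral_indep_rvs:
  assumes X: "X \<in> measurable M S" and Z: "Z \<in> measurable M S'"
    and indep: "indep_rvs M S X S' Z"
    and F[measurable]: "case_prod F \<in> borel_measurable (S \<Otimes>\<^sub>M S')"
  shows "(\<integral>\<^sup>+\<omega>. F (X \<omega>) (Z \<omega>) \<partial>M) = (\<integral>\<^sup>+x. \<integral>\<^sup>+z. F x z \<partial>distr M S' Z \<partial>distr M S X)"
proof -
  note X[measurable] Z[measurable]
  interpret Z: prob_space "distr M S' Z" by (rule prob_space_distr) fact
  have "(\<integral>\<^sup>+\<omega>. F (X \<omega>) (Z \<omega>) \<partial>M) = (\<integral>\<^sup>+y. case_prod F y \<partial>distr M (S \<Otimes>\<^sub>M S') (\<lambda>\<omega>. (X \<omega>, Z \<omega>)))"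
    by (subst nn_integral_distr) auto
  also have "\<dots> = (\<integral>\<^sup>+y. case_prod F y \<partial>(distr M S X \<Otimes>\<^sub>M distr M S' Z))"
    by (simp only: indep_rvs_joint_law[OF X Z indep])
  also have "\<dots> = (\<integral>\<^sup>+x. \<integral>\<^sup>+z. F x z \<partial>distr M S' Z \<partial>distr M S X)"
    by (subst Z.nn_integral_fst[symmetric]) (simp_all cong: measurable_cong_sets sets_pair_measure_cong)
  finally show ?thesis .
qed

text \<open>Functions of disjoint groups of independent variables, where the variables are only present
  through the \<open>\<sigma>\<close>-algebras \<open>E i\<close> that they generate.\<close>

lemma nn_integral_prod_groups:
  fixes X :: "'j \<Rightarrow> 'a \<Rightarrow> ennreal"
  assumes indep: "indep_sets E (\<Union>j\<in>J. I j)"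
    and stable: "\<And>i. i \<in> (\<Union>j\<in>J. I j) \<Longrightarrow> Int_stable (E i)"
    and disj: "disjoint_family_on I J" and J: "finite J"
    and X: "\<And>j. j \<in> J \<Longrightarrow> X j \<in> borel_measurable (sigma (space M) (\<Union>i\<in>I j. E i))"
  shows "(\<integral>\<^sup>+\<omega>. (\<Prod>j\<in>J. X j \<omega>) \<partial>M) = (\<Prod>j\<in>J. \<integral>\<^sup>+\<omega>. X j \<omega> \<partial>M)"
proof -
  have ev: "i \<in> (\<Union>j\<in>J. I j) \<Longrightarrow> E i \<subseteq> events" for i
    using indep by (auto simp: indep_sets_def)
  then have "i \<in> (\<Union>j\<in>J. I j) \<Longrightarrow> E i \<subseteq> Pow (space M)" for i
    using sets.space_closed by blast
  then have sets: "sets (sigma (space M) (\<Union>i\<in>I j. E i)) = sigma_sets (space M) (\<Union>i\<in>I j. E i)" if "j \<in> J" for j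
    using that by (intro sets_measure_of) blast
  have indep': "indep_sets (\<lambda>j. sigma_sets (space M) (\<Union>i\<in>I j. E i)) J"
    using stable by (intro indep_sets_collect_sigma indep disj) auto
  have sub: "{X j -` A \<inter> space M | A. A \<in> sets borel} \<subseteq> sigma_sets (space M) (\<Union>i\<in>I j. E i)" if "j \<in> J" for j
    using measurable_sets[OF X[OF that]] unfolding sets[OF that] by (auto simp: space_measure_of_conv)
  have "indep_vars (\<lambda>_. borel) X J"
    unfolding indep_vars_def2
  proof
    show "indep_sets (\<lambda>j. {X j -` A \<inter> space M | A. A \<in> sets borel}) J"
      by (rule indep_sets_mono_sets[OF indep' sub])
    have in_events: "sigma_sets (space M) (\<Union>i\<in>I j. E i) \<subseteq> events" if "j \<in> J" for j
      using indep' that by (auto simp: indep_sets_def)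
    show "\<forall>j\<in>J. random_variable borel (X j)"
    proof (intro ballI measurableI)
      fix j and A :: "ennreal set" assume "j \<in> J" "A \<in> sets borel"
      then have "X j -` A \<inter> space M \<in> sigma_sets (space M) (\<Union>i\<in>I j. E i)" using sub by blast
      then show "X j -` A \<inter> space M \<in> events"
        using in_events[OF \<open>j \<in> J\<close>] by (rule rev_subsetD)
    qed simp
  qed
  then show ?thesis by (intro indep_vars_nn_integral J) auto
qed

lemma indep_rvs_groups:
  assumes indep: "indep_sets E (I1 \<union> I2)"
    and stable: "\<And>i. i \<in> I1 \<union> I2 \<Longrightarrow> Int_stable (E i)"
    and disj: "I1 \<inter> I2 = {}"
    and X: "X \<in> measurable (sigma (space M) (\<Union>i\<in>I1. E i)) S"
    and Z: "Z \<in> measurable (sigma (space M) (\<Union>i\<in>I2. E i)) S'"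
  shows "indep_rvs M S X S' Z"
proof -
  have ev: "i \<in> I1 \<union> I2 \<Longrightarrow> E i \<subseteq> Pow (space M)" for i
    using indep sets.space_closed by (auto simp: indep_sets_def)
  have "(\<Union>b. case_bool I1 I2 b) = I1 \<union> I2" by (auto simp: UNIV_bool)
  then have "indep_sets (\<lambda>b. sigma_sets (space M) (\<Union>i\<in>case_bool I1 I2 b. E i)) UNIV"
    using stable indep disj
    by (intro indep_sets_collect_sigma) (auto simp: disjoint_family_on_def split: bool.splits)
  then have "indep_sets (case_bool (gen_sigma M S X) (gen_sigma M S' Z)) UNIV"
  proof (rule indep_sets_mono_sets)
    fix b :: bool
    have "gen_sigma M S X \<subseteq> sets (sigma (space M) (\<Union>i\<in>I1. E i))"
      "gen_sigma M S' Z \<subseteq> sets (sigma (space M) (\<Union>i\<in>I2. E i))"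
      by (intro gen_sigma_subset X Z; simp add: space_measure_of_conv)+
    moreover have "sets (sigma (space M) (\<Union>i\<in>I1. E i)) = sigma_sets (space M) (\<Union>i\<in>I1. E i)"
      "sets (sigma (space M) (\<Union>i\<in>I2. E i)) = sigma_sets (space M) (\<Union>i\<in>I2. E i)"
      using ev by (intro sets_measure_of; blast)+
    ultimately show "case_bool (gen_sigma M S X) (gen_sigma M S' Z) b \<subseteq> sigma_sets (space M) (\<Union>i\<in>case_bool I1 I2 b. E i)"
      by (cases b) auto
  qed
  then show ?thesis by (simp add: indep_rvs_def indep_set_def)
qed

end

lemma measure_eqI_nn_integral:
  assumes "sets P = sets Q"
    and "\<And>F. F \<in> borel_measurable P \<Longrightarrow> (\<integral>\<^sup>+x. F x \<partial>P) = (\<integral>\<^sup>+x. F x \<partial>Q)"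
  shows "P = Q"
proof (rule measure_eqI)
  fix A assume A: "A \<in> sets P"
  then have "(\<integral>\<^sup>+x. indicator A x \<partial>P) = (\<integral>\<^sup>+x. indicator A x \<partial>Q)"
    by (intro assms(2)) auto
  then show "emeasure P A = emeasure Q A" using A assms(1) by simp
qed fact

section \<open>A gamma process with random atoms\<close>

lemma sets_add_measure [simp]: "sets (add_measure m m') = sets m"
  by (simp add: add_measure_def sets.space_closed sets_measure_of_conv sets.sigma_sets_eq)

lemma sets_atoms_measure [simp]: "sets (atoms_measure I g y) = sets borel"
  using sets.sigma_sets_eq[of borel] by (simp add: atoms_measure_def sets_measure_of_conv)

lemma scale_add_measure:
  assumes "sets m = sets m'"
  shows "add_measure (scale_measure r m) (scale_measure r m') = scale_measure r (add_measure m m')"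
  by (rule measure_eqI) (use assms in \<open>auto simp: emeasure_add_measure distrib_left\<close>)

lemma measurable_add_atoms:
  fixes \<mu> :: "'w \<Rightarrow> 'y::polish_space measure"
  assumes p: "finite p"
    and \<mu>[measurable]: "\<mu> \<in> measurable K bf_measures"
    and G: "\<And>C. C \<in> p \<Longrightarrow> G C \<in> borel_measurable K"
    and Y: "\<And>C. C \<in> p \<Longrightarrow> Y C \<in> measurable K borel"
  shows "(\<lambda>\<omega>. add_measure (\<mu> \<omega>) (atoms_measure p (\<lambda>C. ennreal (G C \<omega>)) (\<lambda>C. Y C \<omega>))) \<in> measurable K bf_measures"
proof (rule measurable_bfI)
  note [measurable] = G Y
  fix \<omega> assume "\<omega> \<in> space K"
  then have "boundedly_finite (\<mu> \<omega>)" using measurable_space[OF \<mu>] by (simp add: space_bf_measures)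
  moreover have "(\<Sum>C\<in>p. ennreal (G C \<omega>) * indicator A (Y C \<omega>)) < \<infinity>" for A
    using p by (simp add: ennreal_mult_less_top indicator_def less_top[symmetric])
  ultimately show "boundedly_finite (add_measure (\<mu> \<omega>) (atoms_measure p (\<lambda>C. ennreal (G C \<omega>)) (\<lambda>C. Y C \<omega>)))"
    by (auto simp: boundedly_finite_def emeasure_add_measure emeasure_atoms_measure)
next
  note [measurable] = G Y
  fix A :: "'y set" assume A[measurable]: "A \<in> sets borel"
  have "(\<lambda>\<omega>. emeasure (\<mu> \<omega>) A + (\<Sum>C\<in>p. ennreal (G C \<omega>) * indicator A (Y C \<omega>))) \<in> borel_measurable K"
    by measurable
  then show "(\<lambda>\<omega>. emeasure (add_measure (\<mu> \<omega>) (atoms_measure p (\<lambda>C. ennreal (G C \<omega>)) (\<lambda>C. Y C \<omega>))) A) \<in> borel_measurable K"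
    using boundedly_finite_sets[OF measurable_space[OF \<mu>]] A
    by (subst measurable_cong[where g="\<lambda>\<omega>. emeasure (\<mu> \<omega>) A + (\<Sum>C\<in>p. ennreal (G C \<omega>) * indicator A (Y C \<omega>))"])
       (auto simp: emeasure_add_measure emeasure_atoms_measure)
qed

text \<open>Exactly one set of the partition contains the location \<open>y\<close> of the atom.\<close>

lemma expneg_step_at_atom:
  assumes "disjoint_family_on A {..<(k::nat)}" "(\<Union>i<k. A i) = UNIV"
  shows "ennreal (expneg (\<Sum>i<k. ennreal (c i) * (g * indicator (A i) y)))
    = (\<Sum>i<k. indicator (A i) y * ennreal (expneg (ennreal (c i) * g)))"
proof -
  obtain j where j: "j < k" "y \<in> A j" using assms(2) by auto
  have ind: "indicator (A i) y = (if i = j then 1 else 0 :: ennreal)" if "i \<in> {..<k}" for i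
    using j that assms(1) by (auto simp: disjoint_family_on_def indicator_def)
  have "(\<Sum>i<k. ennreal (c i) * (g * indicator (A i) y)) = (\<Sum>i<k. if i = j then ennreal (c i) * g else 0)"
    by (intro sum.cong refl) (simp add: ind)
  moreover have "(\<Sum>i<k. indicator (A i) y * ennreal (expneg (ennreal (c i) * g))) = (\<Sum>i<k. if i = j then ennreal (expneg (ennreal (c i) * g)) else 0)"
    by (intro sum.cong refl) (simp add: ind)
  ultimately show ?thesis using j by simp
qed

definition variable_sigma where
  "variable_sigma \<Omega> U \<mu> G Y i = (case i of
      IdxU \<Rightarrow> gen_sigma \<Omega> borel U
    | IdxMu \<Rightarrow> gen_sigma \<Omega> bf_measures \<mu>
    | IdxG C \<Rightarrow> gen_sigma \<Omega> borel (G C)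
    | IdxY C \<Rightarrow> gen_sigma \<Omega> borel (Y C))"

lemma Int_stable_variable_sigma: "Int_stable (variable_sigma \<Omega> U \<mu> G Y i)"
  by (cases i) (simp_all add: variable_sigma_def Int_stable_gen_sigma)

lemma cell_variables_indep_sets:
  assumes "cell_variables \<Omega> p \<B> \<G> H U \<mu> G Y"
  shows "prob_space.indep_sets \<Omega> (variable_sigma \<Omega> U \<mu> G Y) ({IdxU, IdxMu} \<union> IdxG ` p \<union> IdxY ` p)"
  using assms unfolding cell_variables_def variable_sigma_def[abs_def] by blast

lemma cell_variables_measurable_group:
  assumes \<Omega>: "prob_space \<Omega>" and cv: "cell_variables \<Omega> p \<B> \<G> H U \<mu> G Y"
    and I: "I \<subseteq> {IdxU, IdxMu} \<union> IdxG ` p \<union> IdxY ` p"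
  defines "K \<equiv> sigma (space \<Omega>) (\<Union>i\<in>I. variable_sigma \<Omega> U \<mu> G Y i)"
  shows "IdxU \<in> I \<Longrightarrow> U \<in> measurable K borel"
    and "IdxMu \<in> I \<Longrightarrow> \<mu> \<in> measurable K bf_measures"
    and "IdxG C \<in> I \<Longrightarrow> G C \<in> measurable K borel"
    and "IdxY C \<in> I \<Longrightarrow> Y C \<in> measurable K borel"
proof -
  interpret \<Omega>: prob_space \<Omega> by fact
  let ?E = "variable_sigma \<Omega> U \<mu> G Y"
  have \<mu>: "\<mu> \<in> measurable \<Omega> bf_measures"
    using cv unfolding cell_variables_def has_law_def by blast
  have "?E i \<subseteq> Pow (space \<Omega>)" if "i \<in> I" for i
  proof -
    have "\<forall>i\<in>({IdxU, IdxMu} \<union> IdxG ` p \<union> IdxY ` p). ?E i \<subseteq> \<Omega>.events"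
      using cell_variables_indep_sets[OF cv] unfolding \<Omega>.indep_sets_def by (rule conjunct1)
    moreover have "i \<in> {IdxU, IdxMu} \<union> IdxG ` p \<union> IdxY ` p" using I that by (rule subsetD)
    ultimately have "?E i \<subseteq> \<Omega>.events" by (rule bspec)
    also have "\<dots> \<subseteq> Pow (space \<Omega>)" by (rule sets.space_closed)
    finally show ?thesis .
  qed
  then have "(\<Union>i\<in>I. ?E i) \<subseteq> Pow (space \<Omega>)" by blast
  then have gen: "?E i \<subseteq> sets K" if "i \<in> I" for i
    using that unfolding K_def by (subst sets_measure_of) (auto intro: sigma_sets.Basic)
  have sp: "space K = space \<Omega>"
    by (simp add: K_def space_measure_of_conv)
  show "IdxU \<in> I \<Longrightarrow> U \<in> measurable K borel"
    using gen[of IdxU] by (intro measurable_if_gen_sigma_subset[OF _ sp]) (auto simp: variable_sigma_def)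
  show "IdxMu \<in> I \<Longrightarrow> \<mu> \<in> measurable K bf_measures"
    using gen[of IdxMu] measurable_space[OF \<mu>]
    by (intro measurable_if_gen_sigma_subset[OF _ sp]) (auto simp: variable_sigma_def)
  show "IdxG C \<in> I \<Longrightarrow> G C \<in> measurable K borel"
    using gen[of "IdxG C"] by (intro measurable_if_gen_sigma_subset[OF _ sp]) (auto simp: variable_sigma_def)
  show "IdxY C \<in> I \<Longrightarrow> Y C \<in> measurable K borel"
    using gen[of "IdxY C"] by (intro measurable_if_gen_sigma_subset[OF _ sp]) (auto simp: variable_sigma_def)
qed

lemma cell_variables_indep_rvs:
  assumes \<Omega>: "prob_space \<Omega>" and p: "finite p" and cv: "cell_variables \<Omega> p \<B> \<G> H U \<mu> G Y"
  shows "indep_rvs \<Omega> borel U bf_measures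
    (\<lambda>\<omega>. add_measure (\<mu> \<omega>) (atoms_measure p (\<lambda>C. ennreal (G C \<omega>)) (\<lambda>C. Y C \<omega>)))"
proof -
  interpret \<Omega>: prob_space \<Omega> by fact
  let ?E = "variable_sigma \<Omega> U \<mu> G Y" and ?rest = "{IdxMu} \<union> IdxG ` p \<union> IdxY ` p"
  have "{IdxU, IdxMu} \<union> IdxG ` p \<union> IdxY ` p = {IdxU} \<union> ?rest" by auto
  then have "\<Omega>.indep_sets ?E ({IdxU} \<union> ?rest)"
    using cell_variables_indep_sets[OF cv] by simp
  then show ?thesis
  proof (rule \<Omega>.indep_rvs_groups)
    show "U \<in> measurable (sigma (space \<Omega>) (\<Union>i\<in>{IdxU}. ?E i)) borel"
      by (rule cell_variables_measurable_group(1)[OF \<Omega> cv]) auto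
    show "(\<lambda>\<omega>. add_measure (\<mu> \<omega>) (atoms_measure p (\<lambda>C. ennreal (G C \<omega>)) (\<lambda>C. Y C \<omega>)))
        \<in> measurable (sigma (space \<Omega>) (\<Union>i\<in>?rest. ?E i)) bf_measures"
      by (intro measurable_add_atoms p cell_variables_measurable_group(2-4)[OF \<Omega> cv]) auto
  qed (auto intro: Int_stable_variable_sigma)
qed

context gamma_process
begin

text \<open>An independent atom \<open>G \<delta>\<^sub>Y\<close>, with \<open>G\<close> of shape \<open>e\<close> and \<open>Y\<close> of law \<open>H\<close>, has Laplace functional
  \<open>\<integral> (1 + f)\<^sup>-\<^sup>e dH\<close>.  By independence the functionals of \<open>\<mu>\<close> and of the atoms are multiplied.\<close>

lemma cell_variables_laplace:
  assumes \<Omega>: "prob_space \<Omega>" and p: "finite p" and cells: "\<And>C. C \<in> p \<Longrightarrow> 0 < card C"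
    and cv: "cell_variables \<Omega> p \<B> \<G> H U \<mu> G Y"
    and A: "\<And>i. i < k \<Longrightarrow> A i \<in> sets borel" "disjoint_family_on A {..<(k::nat)}" "(\<Union>i<k. A i) = UNIV"
    and c: "\<And>i. i < k \<Longrightarrow> 0 \<le> c i"
  shows "(\<integral>\<^sup>+\<omega>. ennreal (expneg (\<Sum>i<k. ennreal (c i) * emeasure (add_measure (\<mu> \<omega>) (atoms_measure p (\<lambda>C. ennreal (G C \<omega>)) (\<lambda>C. Y C \<omega>))) (A i))) \<partial>\<Omega>)
      = ennreal ((\<Prod>i<k. (1 + c i) powr (- \<theta> * measure H (A i))) *
        (\<Prod>C\<in>p. \<Sum>i<k. measure H (A i) / (1 + c i) ^ card C))"
proof -
  interpret \<Omega>: prob_space \<Omega> by fact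
  have \<mu>[measurable]: "\<mu> \<in> measurable \<Omega> bf_measures" and \<mu>_law: "distr \<Omega> bf_measures \<mu> = \<G>"
    and G[measurable]: "\<And>C. C \<in> p \<Longrightarrow> G C \<in> borel_measurable \<Omega>"
    and G_law: "\<And>C. C \<in> p \<Longrightarrow> distr \<Omega> borel (G C) = gamma_dist (real (card C))"
    and Y[measurable]: "\<And>C. C \<in> p \<Longrightarrow> Y C \<in> measurable \<Omega> borel"
    and Y_law: "\<And>C. C \<in> p \<Longrightarrow> distr \<Omega> borel (Y C) = H"
    using cv unfolding cell_variables_def has_law_def by auto
  define E where "E = variable_sigma \<Omega> U \<mu> G Y"
  have indep: "\<Omega>.indep_sets E ({IdxU, IdxMu} \<union> IdxG ` p \<union> IdxY ` p)"
    unfolding E_def by (rule cell_variables_indep_sets[OF cv])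
  have stable: "Int_stable (E i)" for i
    unfolding E_def by (rule Int_stable_variable_sigma)
  note group = cell_variables_measurable_group[OF \<Omega> cv, folded E_def]
  let ?rest = "{IdxMu} \<union> IdxG ` p \<union> IdxY ` p"
  have [measurable]: "\<And>i. i \<in> {..<k} \<Longrightarrow> A i \<in> sets borel" using A by auto
  define S where "S C \<omega> = ennreal (expneg (\<Sum>i<k. ennreal (c i) * (ennreal (G C \<omega>) * indicator (A i) (Y C \<omega>))))" for C \<omega>
  define X where "X j = (case j of None \<Rightarrow> (\<lambda>\<omega>. ennreal (expneg (\<Sum>i<k. ennreal (c i) * emeasure (\<mu> \<omega>) (A i)))) | Some C \<Rightarrow> S C)" for j
  \<comment> \<open>\<open>None\<close> stands for the gamma process and \<open>Some C\<close> for the atom that belongs to the cell \<open>C\<close>.\<close>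
  define I where "I j = (case j of None \<Rightarrow> {IdxMu} | Some C \<Rightarrow> {IdxG C, IdxY C})" for j
  let ?J = "insert None (Some ` p)"
  have "(\<integral>\<^sup>+\<omega>. ennreal (expneg (\<Sum>i<k. ennreal (c i) * emeasure (add_measure (\<mu> \<omega>) (atoms_measure p (\<lambda>C. ennreal (G C \<omega>)) (\<lambda>C. Y C \<omega>))) (A i))) \<partial>\<Omega>)
      = (\<integral>\<^sup>+\<omega>. (\<Prod>j\<in>?J. X j \<omega>) \<partial>\<Omega>)"
  proof (rule nn_integral_cong)
    fix \<omega> assume \<omega>: "\<omega> \<in> space \<Omega>"
    have sets: "sets (\<mu> \<omega>) = sets borel" using boundedly_finite_sets[OF measurable_space[OF \<mu> \<omega>]] .
    have "(\<Sum>i<k. ennreal (c i) * emeasure (add_measure (\<mu> \<omega>) (atoms_measure p (\<lambda>C. ennreal (G C \<omega>)) (\<lambda>C. Y C \<omega>))) (A i))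
        = (\<Sum>i<k. ennreal (c i) * emeasure (\<mu> \<omega>) (A i) + (\<Sum>C\<in>p. ennreal (c i) * (ennreal (G C \<omega>) * indicator (A i) (Y C \<omega>))))"
      using sets A(1) by (intro sum.cong refl) (simp add: emeasure_add_measure emeasure_atoms_measure distrib_left sum_distrib_left)
    also have "\<dots> = (\<Sum>i<k. ennreal (c i) * emeasure (\<mu> \<omega>) (A i)) + (\<Sum>C\<in>p. \<Sum>i<k. ennreal (c i) * (ennreal (G C \<omega>) * indicator (A i) (Y C \<omega>)))"
      unfolding sum.distrib by (subst (2) sum.swap) (rule refl)
    finally show "ennreal (expneg (\<Sum>i<k. ennreal (c i) * emeasure (add_measure (\<mu> \<omega>) (atoms_measure p (\<lambda>C. ennreal (G C \<omega>)) (\<lambda>C. Y C \<omega>))) (A i)))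
        = (\<Prod>j\<in>?J. X j \<omega>)"
      using p by (simp add: X_def S_def expneg_add expneg_sum ennreal_mult prod_ennreal[symmetric] prod_nonneg prod.reindex del: sum_ennreal)
  qed
  also have "\<dots> = (\<Prod>j\<in>?J. \<integral>\<^sup>+\<omega>. X j \<omega> \<partial>\<Omega>)"
  proof (rule \<Omega>.nn_integral_prod_groups[where E=E and I=I])
    have "(\<Union>j\<in>?J. I j) = ?rest" by (auto simp: I_def)
    then show "\<Omega>.indep_sets E (\<Union>j\<in>?J. I j)"
      using \<Omega>.indep_sets_mono_index[OF _ indep] by auto
    show "disjoint_family_on I ?J" by (auto simp: disjoint_family_on_def I_def)
    fix j assume j: "j \<in> ?J"
    show "X j \<in> borel_measurable (sigma (space \<Omega>) (\<Union>i\<in>I j. E i))"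
    proof (cases j)
      case None
      have [measurable]: "\<mu> \<in> measurable (sigma (space \<Omega>) (\<Union>i\<in>I None. E i)) bf_measures"
        by (rule group(2)) (auto simp: I_def)
      show ?thesis unfolding None X_def option.case by measurable
    next
      case (Some C)
      with j have "C \<in> p" by auto
      then have sub: "IdxG C \<in> I (Some C)" "IdxY C \<in> I (Some C)"
        "I (Some C) \<subseteq> {IdxU, IdxMu} \<union> IdxG ` p \<union> IdxY ` p"
        by (auto simp: I_def)
      note [measurable] = group(3)[OF sub(3,1)] group(4)[OF sub(3,2)]
      show ?thesis unfolding Some X_def option.case S_def by measurable
    qed
  qed (auto intro: stable p)
  also have "\<dots> = (\<integral>\<^sup>+\<omega>. X None \<omega> \<partial>\<Omega>) * (\<Prod>C\<in>p. \<integral>\<^sup>+\<omega>. S C \<omega> \<partial>\<Omega>)"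
    using p by (simp add: X_def prod.reindex)
  also have "(\<integral>\<^sup>+\<omega>. X None \<omega> \<partial>\<Omega>) = (\<integral>\<^sup>+m. ennreal (expneg (\<Sum>i<k. ennreal (c i) * emeasure m (A i))) \<partial>\<G>)"
    unfolding \<mu>_law[symmetric] X_def option.case by (subst nn_integral_distr) auto
  also have "\<dots> = ennreal (\<Prod>i<k. (1 + c i) powr (- \<theta> * measure H (A i)))"
    by (rule laplace[OF A(1,2) c])
  also have "(\<Prod>C\<in>p. \<integral>\<^sup>+\<omega>. S C \<omega> \<partial>\<Omega>) = (\<Prod>C\<in>p. ennreal (\<Sum>i<k. measure H (A i) / (1 + c i) ^ card C))"
  proof (intro prod.cong refl)
    fix C assume C: "C \<in> p"
    have card: "card C > 0" using cells C by auto
    have term_i: "(\<integral>\<^sup>+\<omega>. indicator (A i) (Y C \<omega>) * ennreal (expneg (ennreal (c i) * ennreal (G C \<omega>))) \<partial>\<Omega>)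
        = ennreal (measure H (A i) / (1 + c i) ^ card C)" if i: "i < k" for i
    proof -
      have [measurable]: "A i \<in> sets borel" using A i by auto
      have rv: "indep_rvs \<Omega> borel (Y C) borel (G C)"
      proof (rule \<Omega>.indep_rvs_groups[where E=E and ?I1.0="{IdxY C}" and ?I2.0="{IdxG C}"])
        show "\<Omega>.indep_sets E ({IdxY C} \<union> {IdxG C})"
          using C by (intro \<Omega>.indep_sets_mono_index[OF _ indep]) auto
        show "Y C \<in> measurable (sigma (space \<Omega>) (\<Union>i\<in>{IdxY C}. E i)) borel" using C by (intro group(4)) auto
        show "G C \<in> measurable (sigma (space \<Omega>) (\<Union>i\<in>{IdxG C}. E i)) borel" using C by (intro group(3)) auto
      qed (auto intro: stable)
      have "(\<integral>\<^sup>+\<omega>. indicator (A i) (Y C \<omega>) * ennreal (expneg (ennreal (c i) * ennreal (G C \<omega>))) \<partial>\<Omega>)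
          = (\<integral>\<^sup>+y. \<integral>\<^sup>+g. indicator (A i) y * ennreal (expneg (ennreal (c i) * ennreal g)) \<partial>distr \<Omega> borel (G C) \<partial>distr \<Omega> borel (Y C))"
        by (rule \<Omega>.nn_integral_indep_rvs[OF Y[OF C] G[OF C] rv]) measurable
      also have "\<dots> = (\<integral>\<^sup>+y. \<integral>\<^sup>+g. indicator (A i) y * ennreal (expneg (ennreal (c i) * ennreal g)) \<partial>gamma_dist (card C) \<partial>H)"
        by (simp only: G_law[OF C] Y_law[OF C])
      also have "\<dots> = (\<integral>\<^sup>+y. indicator (A i) y * (\<integral>\<^sup>+g. ennreal (expneg (ennreal (c i) * ennreal g)) \<partial>gamma_dist (card C)) \<partial>H)"
        by (intro nn_integral_cong nn_integral_cmult) measurable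
      also have "(\<integral>\<^sup>+g. ennreal (expneg (ennreal (c i) * ennreal g)) \<partial>gamma_dist (card C)) = (\<integral>\<^sup>+g. ennreal (exp (- (c i * g))) \<partial>gamma_dist (card C))"
      proof (rule nn_integral_cong_AE)
        show "AE g in gamma_dist (card C). ennreal (expneg (ennreal (c i) * ennreal g)) = ennreal (exp (- (c i * g)))"
          using AE_gamma_dist_nonneg[OF of_nat_0_le_iff]
          by eventually_elim (use c[OF i] in \<open>simp flip: ennreal_mult\<close>)
      qed
      also have "\<dots> = ennreal ((1 + c i) powr (- real (card C)))"
        using c[OF i] by (intro gamma_dist_laplace) auto
      also have "(1 + c i) powr (- real (card C)) = 1 / (1 + c i) ^ card C"
        using c[OF i] by (simp add: powr_minus powr_realpow divide_inverse)
      also have "(\<integral>\<^sup>+y. indicator (A i) y * ennreal (1 / (1 + c i) ^ card C) \<partial>H) = emeasure H (A i) * ennreal (1 / (1 + c i) ^ card C)"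
        by (subst nn_integral_multc) (auto simp: H cong: measurable_cong_sets)
      also have "\<dots> = ennreal (measure H (A i) / (1 + c i) ^ card C)"
        using c[OF i] by (simp add: H.emeasure_eq_measure ennreal_mult[symmetric])
      finally show ?thesis .
    qed
    have "(\<integral>\<^sup>+\<omega>. S C \<omega> \<partial>\<Omega>) = (\<integral>\<^sup>+\<omega>. (\<Sum>i<k. indicator (A i) (Y C \<omega>) * ennreal (expneg (ennreal (c i) * ennreal (G C \<omega>)))) \<partial>\<Omega>)"
      unfolding S_def by (simp only: expneg_step_at_atom[OF A(2,3)])
    also have "\<dots> = (\<Sum>i<k. \<integral>\<^sup>+\<omega>. indicator (A i) (Y C \<omega>) * ennreal (expneg (ennreal (c i) * ennreal (G C \<omega>))) \<partial>\<Omega>)"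
      using C by (intro nn_integral_sum) measurable
    also have "\<dots> = (\<Sum>i<k. ennreal (measure H (A i) / (1 + c i) ^ card C))"
      by (intro sum.cong refl) (simp add: term_i)
    also have "\<dots> = ennreal (\<Sum>i<k. measure H (A i) / (1 + c i) ^ card C)"
      using c by (intro sum_ennreal) (simp add: divide_nonneg_nonneg)
    finally show "(\<integral>\<^sup>+\<omega>. S C \<omega> \<partial>\<Omega>) = ennreal (\<Sum>i<k. measure H (A i) / (1 + c i) ^ card C)" .
  qed
  also have "ennreal (\<Prod>i<k. (1 + c i) powr (- \<theta> * measure H (A i))) * (\<Prod>C\<in>p. ennreal (\<Sum>i<k. measure H (A i) / (1 + c i) ^ card C))
     = ennreal ((\<Prod>i<k. (1 + c i) powr (- \<theta> * measure H (A i))) * (\<Prod>C\<in>p. \<Sum>i<k. measure H (A i) / (1 + c i) ^ card C))"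
  proof -
    have "(\<Sum>i<k. measure H (A i) / (1 + c i) ^ card C) \<ge> 0" for C :: "nat set"
      using c by (intro sum_nonneg) (simp add: divide_nonneg_nonneg)
    then show ?thesis by (simp add: prod_ennreal ennreal_mult prod_nonneg)
  qed
  finally show "(\<integral>\<^sup>+\<omega>. ennreal (expneg (\<Sum>i<k. ennreal (c i) * emeasure (add_measure (\<mu> \<omega>) (atoms_measure p (\<lambda>C. ennreal (G C \<omega>)) (\<lambda>C. Y C \<omega>))) (A i))) \<partial>\<Omega>)
      = ennreal ((\<Prod>i<k. (1 + c i) powr (- \<theta> * measure H (A i))) *
        (\<Prod>C\<in>p. \<Sum>i<k. measure H (A i) / (1 + c i) ^ card C))" .
qed

section \<open>Representations of the beta-gamma process\<close>

lemma law_beta_times: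
  assumes "prob_space \<Omega>" "0 < q" "q < r"
    and U: "has_law \<Omega> borel U (beta_dist q (r - q))" and Z: "has_law \<Omega> bf_measures Z (beta_gamma_law \<G> \<theta> r)"
    and indep: "indep_rvs \<Omega> borel U bf_measures Z"
  shows "distr \<Omega> bf_measures (\<lambda>\<omega>. scale_measure (ennreal (U \<omega>)) (Z \<omega>)) = beta_gamma_law \<G> \<theta> q"
proof (rule measure_eqI_nn_integral)
  interpret \<Omega>: prob_space \<Omega> by fact
  have [measurable]: "U \<in> borel_measurable \<Omega>" "Z \<in> measurable \<Omega> bf_measures"
    using U Z by (auto simp: has_law_def)
  fix F :: "'y measure \<Rightarrow> ennreal" assume "F \<in> borel_measurable (distr \<Omega> bf_measures (\<lambda>\<omega>. scale_measure (ennreal (U \<omega>)) (Z \<omega>)))"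
  then have [measurable]: "F \<in> borel_measurable bf_measures" by simp
  have "(\<integral>\<^sup>+m. F m \<partial>distr \<Omega> bf_measures (\<lambda>\<omega>. scale_measure (ennreal (U \<omega>)) (Z \<omega>)))
      = (\<integral>\<^sup>+\<omega>. F (scale_measure (ennreal (U \<omega>)) (Z \<omega>)) \<partial>\<Omega>)"
    by (subst nn_integral_distr) auto
  also have "\<dots> = (\<integral>\<^sup>+u. \<integral>\<^sup>+m. F (scale_measure (ennreal u) m) \<partial>distr \<Omega> bf_measures Z \<partial>distr \<Omega> borel U)"
    by (rule \<Omega>.nn_integral_indep_rvs[OF _ _ indep]) measurable
  also have "\<dots> = (\<integral>\<^sup>+m. F m \<partial>beta_gamma_law \<G> \<theta> q)"
    using U Z nn_integral_beta_scaled_beta_gamma[OF assms(2,3), of F] by (simp add: has_law_def)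
  finally show "(\<integral>\<^sup>+m. F m \<partial>distr \<Omega> bf_measures (\<lambda>\<omega>. scale_measure (ennreal (U \<omega>)) (Z \<omega>))) = (\<integral>\<^sup>+m. F m \<partial>beta_gamma_law \<G> \<theta> q)" .
qed simp

lemma law_gamma_times_dirichlet:
  assumes "prob_space \<Omega>" "0 < q"
    and T: "has_law \<Omega> borel T (gamma_dist q)" and Z: "has_law \<Omega> bf_measures Z (dirichlet_law \<G>)"
    and indep: "indep_rvs \<Omega> borel T bf_measures Z"
  shows "distr \<Omega> bf_measures (\<lambda>\<omega>. scale_measure (ennreal (T \<omega>)) (Z \<omega>)) = beta_gamma_law \<G> \<theta> q"
proof (rule measure_eqI_nn_integral)
  interpret \<Omega>: prob_space \<Omega> by fact
  interpret g: prob_space "gamma_dist q" using assms by (intro prob_space_gamma_dist) auto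
  interpret pair_sigma_finite "gamma_dist q" "dirichlet_law \<G>" ..
  have [measurable]: "T \<in> borel_measurable \<Omega>" "Z \<in> measurable \<Omega> bf_measures"
    using T Z by (auto simp: has_law_def)
  fix F :: "'y measure \<Rightarrow> ennreal" assume "F \<in> borel_measurable (distr \<Omega> bf_measures (\<lambda>\<omega>. scale_measure (ennreal (T \<omega>)) (Z \<omega>)))"
  then have [measurable]: "F \<in> borel_measurable bf_measures" by simp
  have "(\<integral>\<^sup>+m. F m \<partial>distr \<Omega> bf_measures (\<lambda>\<omega>. scale_measure (ennreal (T \<omega>)) (Z \<omega>)))
      = (\<integral>\<^sup>+\<omega>. F (scale_measure (ennreal (T \<omega>)) (Z \<omega>)) \<partial>\<Omega>)"
    by (subst nn_integral_distr) auto
  also have "\<dots> = (\<integral>\<^sup>+t. \<integral>\<^sup>+m. F (scale_measure (ennreal t) m) \<partial>distr \<Omega> bf_measures Z \<partial>distr \<Omega> borel T)"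
    by (rule \<Omega>.nn_integral_indep_rvs[OF _ _ indep]) measurable
  also have "\<dots> = (\<integral>\<^sup>+t. \<integral>\<^sup>+m. F (scale_measure (ennreal t) m) \<partial>dirichlet_law \<G> \<partial>gamma_dist q)"
    using T Z by (simp add: has_law_def)
  also have "\<dots> = (\<integral>\<^sup>+m. \<integral>\<^sup>+t. F (scale_measure (ennreal t) m) \<partial>gamma_dist q \<partial>dirichlet_law \<G>)"
    by (rule Fubini'[symmetric]) measurable
  also have "\<dots> = (\<integral>\<^sup>+m. F m \<partial>beta_gamma_law \<G> \<theta> q)"
    by (rule nn_integral_beta_gamma[symmetric]) (use assms in auto)
  finally show "(\<integral>\<^sup>+m. F m \<partial>distr \<Omega> bf_measures (\<lambda>\<omega>. scale_measure (ennreal (T \<omega>)) (Z \<omega>))) = (\<integral>\<^sup>+m. F m \<partial>beta_gamma_law \<G> \<theta> q)" .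
qed simp

text \<open>The beta-gamma process is itself a gamma variable of shape \<open>b\<close> times a Dirichlet process, so the product
  is \<open>T\<^sub>a T\<^sub>b P\<close> with independent factors, in which \<open>a\<close> and \<open>b\<close> may be exchanged.\<close>

lemma nn_integral_gamma_times_beta_gamma:
  assumes \<Omega>: "prob_space \<Omega>" and a: "0 < a" and b: "0 < b"
    and T: "has_law \<Omega> borel T (gamma_dist a)" and Z: "has_law \<Omega> bf_measures Z (beta_gamma_law \<G> \<theta> b)"
    and indep: "indep_rvs \<Omega> borel T bf_measures Z"
    and F[measurable]: "F \<in> borel_measurable bf_measures"
  shows "(\<integral>\<^sup>+\<omega>. F (scale_measure (ennreal (T \<omega>)) (Z \<omega>)) \<partial>\<Omega>)
    = (\<integral>\<^sup>+p. \<integral>\<^sup>+t. \<integral>\<^sup>+s. F (scale_measure (ennreal (t * s)) p) \<partial>gamma_dist b \<partial>gamma_dist a \<partial>dirichlet_law \<G>)"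
proof -
  interpret \<Omega>: prob_space \<Omega> by fact
  interpret a: prob_space "gamma_dist a" using a by (intro prob_space_gamma_dist) auto
  interpret b: prob_space "gamma_dist b" using b by (intro prob_space_gamma_dist) auto
  interpret pair_sigma_finite "gamma_dist a" "dirichlet_law \<G>" ..
  have [measurable]: "T \<in> borel_measurable \<Omega>" "Z \<in> measurable \<Omega> bf_measures"
    using T Z by (auto simp: has_law_def)
  have "(\<integral>\<^sup>+\<omega>. F (scale_measure (ennreal (T \<omega>)) (Z \<omega>)) \<partial>\<Omega>)
      = (\<integral>\<^sup>+t. \<integral>\<^sup>+m. F (scale_measure (ennreal t) m) \<partial>distr \<Omega> bf_measures Z \<partial>distr \<Omega> borel T)"
    by (rule \<Omega>.nn_integral_indep_rvs[OF _ _ indep]) measurable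
  also have "\<dots> = (\<integral>\<^sup>+t. \<integral>\<^sup>+m. F (scale_measure (ennreal t) m) \<partial>beta_gamma_law \<G> \<theta> b \<partial>gamma_dist a)"
    using T Z by (simp add: has_law_def)
  also have "\<dots> = (\<integral>\<^sup>+t. \<integral>\<^sup>+p. \<integral>\<^sup>+s. F (scale_measure (ennreal (t * s)) p) \<partial>gamma_dist b \<partial>dirichlet_law \<G> \<partial>gamma_dist a)"
  proof (rule nn_integral_cong_AE)
    show "AE t in gamma_dist a. (\<integral>\<^sup>+m. F (scale_measure (ennreal t) m) \<partial>beta_gamma_law \<G> \<theta> b)
        = (\<integral>\<^sup>+p. \<integral>\<^sup>+s. F (scale_measure (ennreal (t * s)) p) \<partial>gamma_dist b \<partial>dirichlet_law \<G>)"
      using AE_gamma_dist_pos[OF a]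
    proof eventually_elim
      case (elim t)
      then show ?case using b by (subst nn_integral_beta_gamma) (auto simp: ennreal_mult')
    qed
  qed
  also have "\<dots> = (\<integral>\<^sup>+p. \<integral>\<^sup>+t. \<integral>\<^sup>+s. F (scale_measure (ennreal (t * s)) p) \<partial>gamma_dist b \<partial>gamma_dist a \<partial>dirichlet_law \<G>)"
    by (rule Fubini'[symmetric]) measurable
  finally show ?thesis .
qed

lemma law_gamma_times_symmetric:
  assumes \<Omega>: "prob_space \<Omega>" and \<Omega>': "prob_space \<Omega>'" and a: "0 < a" and b: "0 < b"
    and T: "has_law \<Omega> borel T (gamma_dist a)" and Z: "has_law \<Omega> bf_measures Z (beta_gamma_law \<G> \<theta> b)"
    and indep: "indep_rvs \<Omega> borel T bf_measures Z"
    and T': "has_law \<Omega>' borel T' (gamma_dist b)" and Z': "has_law \<Omega>' bf_measures Z' (beta_gamma_law \<G> \<theta> a)"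
    and indep': "indep_rvs \<Omega>' borel T' bf_measures Z'"
  shows "distr \<Omega> bf_measures (\<lambda>\<omega>. scale_measure (ennreal (T \<omega>)) (Z \<omega>))
    = distr \<Omega>' bf_measures (\<lambda>\<omega>. scale_measure (ennreal (T' \<omega>)) (Z' \<omega>))" (is "?L = ?R")
proof (rule measure_eqI_nn_integral)
  interpret a: prob_space "gamma_dist a" using a by (intro prob_space_gamma_dist) auto
  interpret b: prob_space "gamma_dist b" using b by (intro prob_space_gamma_dist) auto
  interpret pair_sigma_finite "gamma_dist a" "gamma_dist b" ..
  have [measurable]: "T \<in> borel_measurable \<Omega>" "Z \<in> measurable \<Omega> bf_measures"
    "T' \<in> borel_measurable \<Omega>'" "Z' \<in> measurable \<Omega>' bf_measures"
    using T Z T' Z' by (auto simp: has_law_def)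
  fix F :: "'y measure \<Rightarrow> ennreal" assume "F \<in> borel_measurable ?L"
  then have F[measurable]: "F \<in> borel_measurable bf_measures" by simp
  have "(\<integral>\<^sup>+m. F m \<partial>?L) = (\<integral>\<^sup>+\<omega>. F (scale_measure (ennreal (T \<omega>)) (Z \<omega>)) \<partial>\<Omega>)"
    by (subst nn_integral_distr) auto
  also have "\<dots> = (\<integral>\<^sup>+p. \<integral>\<^sup>+t. \<integral>\<^sup>+s. F (scale_measure (ennreal (t * s)) p) \<partial>gamma_dist b \<partial>gamma_dist a \<partial>dirichlet_law \<G>)"
    by (rule nn_integral_gamma_times_beta_gamma[OF \<Omega> a b T Z indep F])
  also have "\<dots> = (\<integral>\<^sup>+p. \<integral>\<^sup>+t. \<integral>\<^sup>+s. F (scale_measure (ennreal (t * s)) p) \<partial>gamma_dist a \<partial>gamma_dist b \<partial>dirichlet_law \<G>)"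
  proof (rule nn_integral_cong)
    fix p assume "p \<in> space (dirichlet_law \<G>)"
    then have [measurable]: "p \<in> space bf_measures" by (simp add: sets_eq_imp_space_eq[OF sets_dirichlet])
    show "(\<integral>\<^sup>+t. \<integral>\<^sup>+s. F (scale_measure (ennreal (t * s)) p) \<partial>gamma_dist b \<partial>gamma_dist a)
        = (\<integral>\<^sup>+t. \<integral>\<^sup>+s. F (scale_measure (ennreal (t * s)) p) \<partial>gamma_dist a \<partial>gamma_dist b)"
      by (subst Fubini'[symmetric]) (measurable, simp add: mult.commute)
  qed
  also have "\<dots> = (\<integral>\<^sup>+\<omega>. F (scale_measure (ennreal (T' \<omega>)) (Z' \<omega>)) \<partial>\<Omega>')"
    by (rule nn_integral_gamma_times_beta_gamma[OF \<Omega>' b a T' Z' indep' F, symmetric])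
  also have "\<dots> = (\<integral>\<^sup>+m. F m \<partial>?R)"
    by (subst nn_integral_distr) auto
  finally show "(\<integral>\<^sup>+m. F m \<partial>?L) = (\<integral>\<^sup>+m. F m \<partial>?R)" .
qed simp

end

lemma partition_prob_pos:
  assumes "\<theta> > 0" "partition_on {1..n} p"
  shows "partition_prob \<theta> n p > 0"
proof -
  have "card C > 0" if "C \<in> p" for C
    using card_cell_pos[OF _ assms(2) that] by simp
  then show ?thesis
    unfolding partition_prob_def using assms(1)
    by (auto intro!: mult_pos_pos divide_pos_pos prod_pos Gamma_real_pos add_pos_nonneg)
qed

text \<open>The law of total expectation.  Every partition has positive probability, so conditioning is always
  on an event of positive probability.\<close>

lemma nn_integral_random_partition:
  assumes N: "prob_space N" and \<theta>: "\<theta> > 0" and P: "random_partition N \<theta> n P"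
    and F[measurable]: "F \<in> borel_measurable N"
  shows "(\<integral>\<^sup>+\<omega>. F \<omega> \<partial>N) = (\<Sum>p | partition_on {1..n} p. ennreal (partition_prob \<theta> n p) *
    (\<integral>\<^sup>+\<omega>. F \<omega> \<partial>uniform_measure N {\<omega> \<in> space N. P \<omega> = p}))"
proof -
  interpret N: prob_space N by fact
  let ?P = "{p. partition_on {1..n} p}"
  have fin: "finite ?P" by (rule finitely_many_partition_on) simp
  have Pm: "P \<in> measurable N (count_space ?P)"
    and mass: "\<And>p. p \<in> ?P \<Longrightarrow> measure N {\<omega> \<in> space N. P \<omega> = p} = partition_prob \<theta> n p"
    using P by (auto simp: random_partition_def)
  have ev: "{\<omega> \<in> space N. P \<omega> = p} \<in> sets N" if "p \<in> ?P" for p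
  proof -
    have "P -` {p} \<inter> space N \<in> sets N" by (rule measurable_sets[OF Pm]) (use that in simp)
    also have "P -` {p} \<inter> space N = {\<omega> \<in> space N. P \<omega> = p}" by auto
    finally show ?thesis .
  qed
  have "(\<integral>\<^sup>+\<omega>. F \<omega> \<partial>N) = (\<integral>\<^sup>+\<omega>. (\<Sum>p\<in>?P. F \<omega> * indicator {\<omega> \<in> space N. P \<omega> = p} \<omega>) \<partial>N)"
  proof (rule nn_integral_cong)
    fix \<omega> assume \<omega>: "\<omega> \<in> space N"
    then have "P \<omega> \<in> ?P" using measurable_space[OF Pm] by simp
    moreover have "F \<omega> * indicator {\<omega> \<in> space N. P \<omega> = p} \<omega> = (if P \<omega> = p then F \<omega> else 0)" for p
      using \<omega> by simp
    ultimately show "F \<omega> = (\<Sum>p\<in>?P. F \<omega> * indicator {\<omega> \<in> space N. P \<omega> = p} \<omega>)"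
      using fin by (simp only: sum.delta' if_True)
  qed
  also have "\<dots> = (\<Sum>p\<in>?P. \<integral>\<^sup>+\<omega>. F \<omega> * indicator {\<omega> \<in> space N. P \<omega> = p} \<omega> \<partial>N)"
    using ev by (intro nn_integral_sum borel_measurable_times_ennreal F borel_measurable_indicator) blast
  also have "\<dots> = (\<Sum>p\<in>?P. ennreal (partition_prob \<theta> n p) *
      (\<integral>\<^sup>+\<omega>. F \<omega> \<partial>uniform_measure N {\<omega> \<in> space N. P \<omega> = p}))"
  proof (intro sum.cong refl)
    fix p assume p: "p \<in> ?P"
    have pos: "partition_prob \<theta> n p > 0" using partition_prob_pos[OF \<theta>] p by simp
    have em: "emeasure N {\<omega> \<in> space N. P \<omega> = p} = ennreal (partition_prob \<theta> n p)"
      using mass[OF p] by (simp add: N.emeasure_eq_measure)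
    show "(\<integral>\<^sup>+\<omega>. F \<omega> * indicator {\<omega> \<in> space N. P \<omega> = p} \<omega> \<partial>N) = ennreal (partition_prob \<theta> n p) *
      (\<integral>\<^sup>+\<omega>. F \<omega> \<partial>uniform_measure N {\<omega> \<in> space N. P \<omega> = p})"
      unfolding nn_integral_uniform_measure[OF F ev[OF p]] em
      using pos ennreal_mult_divide_eq[of "ennreal (partition_prob \<theta> n p)"]
      by (simp add: ennreal_times_divide mult.commute[of "ennreal (partition_prob \<theta> n p)"])
  qed
  finally show ?thesis .
qed

context gamma_process
begin

text \<open>Conditionally on the partition, \<open>cell_variables_laplace\<close> gives the Laplace functional of
  \<open>\<mu> + \<Sum> G\<^sub>C \<delta>\<^bsub>Y C\<^esub>\<close>.  Averaged over the partition this becomes the right-hand side of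
  \<open>beta_gamma_laplace\<close>, so without the factor \<open>U\<close> the random measure is a beta-gamma process with \<open>\<theta> + n\<close> in
  place of \<open>q\<close>.  Given the partition, \<open>U\<close> is independent of this measure, with a law that is the same for all partitions;
  so the independence also holds unconditionally, and multiplication with \<open>U\<close> lowers \<open>\<theta> + n\<close> to \<open>q\<close>.\<close>

lemma law_random_partition_mixture:
  fixes N :: "'w measure"
  assumes N: "prob_space N" and q: "q > 0" "\<theta> + real n - q > 0"
    and P: "random_partition N \<theta> n P"
    and cv: "\<And>p. partition_on {1..n} p \<Longrightarrow> cell_variables (uniform_measure N {\<omega> \<in> space N. P \<omega> = p}) p
             (beta_dist q (\<theta> + real n - q)) \<G> H U \<mu> G Y"
  shows "distr N bf_measures (\<lambda>\<omega>. add_measure (scale_measure (ennreal (U \<omega>)) (\<mu> \<omega>))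
            (scale_measure (ennreal (U \<omega>)) (atoms_measure (P \<omega>) (\<lambda>C. ennreal (G C \<omega>)) (\<lambda>C. Y C \<omega>))))
    = beta_gamma_law \<G> \<theta> q"
proof -
  interpret N: prob_space N by fact
  let ?P = "{p. partition_on {1..n} p}"
  define Np where "Np p = uniform_measure N {\<omega> \<in> space N. P \<omega> = p}" for p
  define \<nu> where "\<nu> p \<omega> = add_measure (\<mu> \<omega>) (atoms_measure p (\<lambda>C. ennreal (G C \<omega>)) (\<lambda>C. Y C \<omega>))" for p \<omega>
  have fin: "finite ?P" by (rule finitely_many_partition_on) simp
  have Pm[measurable]: "P \<in> measurable N (count_space ?P)"
    and mass: "\<And>p. p \<in> ?P \<Longrightarrow> measure N {\<omega> \<in> space N. P \<omega> = p} = partition_prob \<theta> n p"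
    using P by (auto simp: random_partition_def)
  have sets_Np [measurable_cong]: "sets (Np p) = sets N" for p by (simp add: Np_def)
  have Np: "prob_space (Np p)" if "p \<in> ?P" for p
    unfolding Np_def using mass[OF that] partition_prob_pos[OF \<theta>, of n p] that
    by (intro prob_space_uniform_measure) (simp_all add: N.emeasure_eq_measure)
  have AE_P: "AE \<omega> in Np p. P \<omega> = p" if "p \<in> ?P" for p
    unfolding Np_def using mass[OF that] partition_prob_pos[OF \<theta>, of n p] that
    by (subst AE_uniform_measure) (auto simp: N.emeasure_eq_measure)
  have cells: "finite p" "C \<in> p \<Longrightarrow> 0 < card C" if "p \<in> ?P" for p C
    using that finite_elements[of "{1..n}" p] card_cell_pos[of "{1..n}" p C] by auto
  have cv: "cell_variables (Np p) p (beta_dist q (\<theta> + real n - q)) \<G> H U \<mu> G Y" if "p \<in> ?P" for p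
    using cv that by (simp add: Np_def)
  have meas: "U \<in> borel_measurable N" "\<mu> \<in> measurable N bf_measures"
    "\<And>C. C \<in> p \<Longrightarrow> G C \<in> borel_measurable N" "\<And>C. C \<in> p \<Longrightarrow> Y C \<in> measurable N borel" if "p \<in> ?P" for p
    using cv[OF that] by (auto simp: cell_variables_def has_law_def measurable_cong_sets[OF sets_Np refl])
  have U_law: "distr (Np p) borel U = beta_dist q (\<theta> + real n - q)" if "p \<in> ?P" for p
    using cv[OF that] by (simp add: cell_variables_def has_law_def)
  obtain p0 where p0: "p0 \<in> ?P"
  proof -
    obtain \<omega> where "\<omega> \<in> space N" using N.not_empty by auto
    then show ?thesis using that measurable_space[OF Pm] by auto
  qed
  note [measurable] = meas(1,2)[OF p0]
  have \<nu>_meas [measurable]: "\<nu> p \<in> measurable N bf_measures" if "p \<in> ?P" for p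
    unfolding \<nu>_def using meas[OF that] cells(1)[OF that] by (intro measurable_add_atoms) auto
  have \<nu>P_meas [measurable]: "(\<lambda>\<omega>. \<nu> (P \<omega>) \<omega>) \<in> measurable N bf_measures"
    by (rule measurable_compose_countable'[OF \<nu>_meas Pm countable_finite[OF fin]])
  have mix: "(\<integral>\<^sup>+\<omega>. F (P \<omega>) \<omega> \<partial>N) = (\<Sum>p\<in>?P. ennreal (partition_prob \<theta> n p) * (\<integral>\<^sup>+\<omega>. F p \<omega> \<partial>Np p))"
    if "\<And>p. p \<in> ?P \<Longrightarrow> F p \<in> borel_measurable N" for F
  proof -
    have "(\<lambda>\<omega>. F (P \<omega>) \<omega>) \<in> borel_measurable N"
      by (rule measurable_compose_countable'[OF that Pm countable_finite[OF fin]])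
    then have "(\<integral>\<^sup>+\<omega>. F (P \<omega>) \<omega> \<partial>N) = (\<Sum>p\<in>?P. ennreal (partition_prob \<theta> n p) * (\<integral>\<^sup>+\<omega>. F (P \<omega>) \<omega> \<partial>Np p))"
      unfolding Np_def by (rule nn_integral_random_partition[OF N \<theta> P])
    also have "\<dots> = (\<Sum>p\<in>?P. ennreal (partition_prob \<theta> n p) * (\<integral>\<^sup>+\<omega>. F p \<omega> \<partial>Np p))"
    proof (intro sum.cong refl arg_cong2[where f="(*)"])
      fix p assume "p \<in> ?P"
      then show "(\<integral>\<^sup>+\<omega>. F (P \<omega>) \<omega> \<partial>Np p) = (\<integral>\<^sup>+\<omega>. F p \<omega> \<partial>Np p)"
        by (intro nn_integral_cong_AE eventually_mono[OF AE_P]) auto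
    qed
    finally show ?thesis .
  qed
  have \<nu>_law: "distr N bf_measures (\<lambda>\<omega>. \<nu> (P \<omega>) \<omega>) = beta_gamma_law \<G> \<theta> (\<theta> + real n)"
  proof (rule laplace_functional_determines_law)
    show "finite_measure (distr N bf_measures (\<lambda>\<omega>. \<nu> (P \<omega>) \<omega>))" by (rule N.finite_measure_distr) measurable
    interpret bg: prob_space "beta_gamma_law \<G> \<theta> (\<theta> + real n)" using \<theta> by (intro prob_space_beta_gamma) simp
    show "finite_measure (beta_gamma_law \<G> \<theta> (\<theta> + real n))" by unfold_locales
    fix k :: nat and A and c :: "nat \<Rightarrow> real"
    assume A: "\<And>i. i < k \<Longrightarrow> A i \<in> sets borel" "disjoint_family_on A {..<k}" "(\<Union>i<k. A i) = (UNIV :: 'y set)"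
      and c: "\<And>i. i < k \<Longrightarrow> 0 \<le> c i"
    have [measurable]: "\<And>i. i \<in> {..<k} \<Longrightarrow> A i \<in> sets borel" using A by auto
    define w where "w p = (\<Prod>i<k. (1 + c i) powr (- \<theta> * measure H (A i))) *
        (\<Prod>C\<in>p. \<Sum>i<k. measure H (A i) / (1 + c i) ^ card C)" for p :: "nat set set"
    have w: "w p \<ge> 0" for p
      unfolding w_def using c by (intro mult_nonneg_nonneg prod_nonneg sum_nonneg) (auto intro!: divide_nonneg_nonneg)
    have "(\<integral>\<^sup>+m. ennreal (expneg (\<Sum>i<k. ennreal (c i) * emeasure m (A i))) \<partial>distr N bf_measures (\<lambda>\<omega>. \<nu> (P \<omega>) \<omega>))
        = (\<integral>\<^sup>+\<omega>. ennreal (expneg (\<Sum>i<k. ennreal (c i) * emeasure (\<nu> (P \<omega>) \<omega>) (A i))) \<partial>N)"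
      by (subst nn_integral_distr) auto
    also have "\<dots> = (\<Sum>p\<in>?P. ennreal (partition_prob \<theta> n p) *
        (\<integral>\<^sup>+\<omega>. ennreal (expneg (\<Sum>i<k. ennreal (c i) * emeasure (\<nu> p \<omega>) (A i))) \<partial>Np p))"
      by (rule mix) measurable
    also have "\<dots> = (\<Sum>p\<in>?P. ennreal (partition_prob \<theta> n p) * ennreal (w p))"
    proof (intro sum.cong refl arg_cong2[where f="(*)"])
      fix p assume p: "p \<in> ?P"
      show "(\<integral>\<^sup>+\<omega>. ennreal (expneg (\<Sum>i<k. ennreal (c i) * emeasure (\<nu> p \<omega>) (A i))) \<partial>Np p) = ennreal (w p)"
        unfolding \<nu>_def w_def by (rule cell_variables_laplace[OF Np[OF p] cells[OF p] cv[OF p] A c])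
    qed
    also have "\<dots> = ennreal (\<Sum>p\<in>?P. partition_prob \<theta> n p * w p)"
      using w partition_prob_pos[OF \<theta>, of n]
      by (subst sum_ennreal[symmetric]) (auto simp: ennreal_mult less_imp_le intro!: sum.cong)
    also have "\<dots> = (\<integral>\<^sup>+m. ennreal (expneg (\<Sum>i<k. ennreal (c i) * emeasure m (A i))) \<partial>beta_gamma_law \<G> \<theta> (\<theta> + real n))"
      unfolding w_def by (rule beta_gamma_laplace[OF A c, symmetric])
    finally show "(\<integral>\<^sup>+m. ennreal (expneg (\<Sum>i<k. ennreal (c i) * emeasure m (A i))) \<partial>distr N bf_measures (\<lambda>\<omega>. \<nu> (P \<omega>) \<omega>))
        = (\<integral>\<^sup>+m. ennreal (expneg (\<Sum>i<k. ennreal (c i) * emeasure m (A i))) \<partial>beta_gamma_law \<G> \<theta> (\<theta> + real n))" .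
  qed simp_all
  let ?Z = "\<lambda>\<omega>. add_measure (scale_measure (ennreal (U \<omega>)) (\<mu> \<omega>))
            (scale_measure (ennreal (U \<omega>)) (atoms_measure (P \<omega>) (\<lambda>C. ennreal (G C \<omega>)) (\<lambda>C. Y C \<omega>)))"
  have Z: "?Z \<omega> = scale_measure (ennreal (U \<omega>)) (\<nu> (P \<omega>) \<omega>)" if "\<omega> \<in> space N" for \<omega>
    unfolding \<nu>_def using boundedly_finite_sets[OF measurable_space[OF meas(2)[OF p0] that]]
    by (intro scale_add_measure) simp
  have "distr N bf_measures ?Z = distr N bf_measures (\<lambda>\<omega>. scale_measure (ennreal (U \<omega>)) (\<nu> (P \<omega>) \<omega>))"
    by (rule distr_cong) (use Z in auto)
  also have "\<dots> = beta_gamma_law \<G> \<theta> q"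
  proof (rule measure_eqI_nn_integral)
    let ?B = "beta_dist q (\<theta> + real n - q)"
    fix F :: "'y measure \<Rightarrow> ennreal" assume "F \<in> borel_measurable (distr N bf_measures (\<lambda>\<omega>. scale_measure (ennreal (U \<omega>)) (\<nu> (P \<omega>) \<omega>)))"
    then have F[measurable]: "F \<in> borel_measurable bf_measures" by simp
    have "(\<integral>\<^sup>+m. F m \<partial>distr N bf_measures (\<lambda>\<omega>. scale_measure (ennreal (U \<omega>)) (\<nu> (P \<omega>) \<omega>)))
        = (\<integral>\<^sup>+\<omega>. F (scale_measure (ennreal (U \<omega>)) (\<nu> (P \<omega>) \<omega>)) \<partial>N)"
      by (subst nn_integral_distr) auto
    also have "\<dots> = (\<Sum>p\<in>?P. ennreal (partition_prob \<theta> n p) * (\<integral>\<^sup>+\<omega>. F (scale_measure (ennreal (U \<omega>)) (\<nu> p \<omega>)) \<partial>Np p))"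
      by (rule mix) measurable
    also have "\<dots> = (\<Sum>p\<in>?P. \<integral>\<^sup>+u. ennreal (partition_prob \<theta> n p) * (\<integral>\<^sup>+\<omega>. F (scale_measure (ennreal u) (\<nu> p \<omega>)) \<partial>Np p) \<partial>?B)"
    proof (intro sum.cong refl)
      fix p assume p: "p \<in> ?P"
      interpret Np: prob_space "Np p" by (rule Np[OF p])
      have [measurable]: "\<nu> p \<in> measurable N bf_measures" by (rule \<nu>_meas[OF p])
      have ind: "indep_rvs (Np p) borel U bf_measures (\<nu> p)"
        unfolding \<nu>_def[abs_def]
        by (rule cell_variables_indep_rvs[OF Np[OF p] cells(1)[OF p] cv[OF p]])
      have "(\<integral>\<^sup>+\<omega>. F (scale_measure (ennreal (U \<omega>)) (\<nu> p \<omega>)) \<partial>Np p)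
          = (\<integral>\<^sup>+u. \<integral>\<^sup>+m. F (scale_measure (ennreal u) m) \<partial>distr (Np p) bf_measures (\<nu> p) \<partial>distr (Np p) borel U)"
        by (rule Np.nn_integral_indep_rvs[OF _ _ ind]) measurable
      also have "\<dots> = (\<integral>\<^sup>+u. \<integral>\<^sup>+\<omega>. F (scale_measure (ennreal u) (\<nu> p \<omega>)) \<partial>Np p \<partial>?B)"
        unfolding U_law[OF p] by (intro nn_integral_cong, subst nn_integral_distr) auto
      finally show "ennreal (partition_prob \<theta> n p) * (\<integral>\<^sup>+\<omega>. F (scale_measure (ennreal (U \<omega>)) (\<nu> p \<omega>)) \<partial>Np p)
        = (\<integral>\<^sup>+u. ennreal (partition_prob \<theta> n p) * (\<integral>\<^sup>+\<omega>. F (scale_measure (ennreal u) (\<nu> p \<omega>)) \<partial>Np p) \<partial>?B)"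
        by (simp add: nn_integral_cmult)
    qed
    also have "\<dots> = (\<integral>\<^sup>+u. (\<Sum>p\<in>?P. ennreal (partition_prob \<theta> n p) * (\<integral>\<^sup>+\<omega>. F (scale_measure (ennreal u) (\<nu> p \<omega>)) \<partial>Np p)) \<partial>?B)"
    proof (rule nn_integral_sum[symmetric])
      fix p assume p: "p \<in> ?P"
      interpret Np: prob_space "Np p" by (rule Np[OF p])
      have [measurable]: "\<nu> p \<in> measurable N bf_measures" by (rule \<nu>_meas[OF p])
      show "(\<lambda>u. ennreal (partition_prob \<theta> n p) * (\<integral>\<^sup>+\<omega>. F (scale_measure (ennreal u) (\<nu> p \<omega>)) \<partial>Np p)) \<in> borel_measurable ?B"
        by measurable
    qed
    also have "\<dots> = (\<integral>\<^sup>+u. \<integral>\<^sup>+\<omega>. F (scale_measure (ennreal u) (\<nu> (P \<omega>) \<omega>)) \<partial>N \<partial>?B)"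
      by (intro nn_integral_cong mix[symmetric]) measurable
    also have "\<dots> = (\<integral>\<^sup>+u. \<integral>\<^sup>+m. F (scale_measure (ennreal u) m) \<partial>beta_gamma_law \<G> \<theta> (\<theta> + real n) \<partial>?B)"
      unfolding \<nu>_law[symmetric] by (intro nn_integral_cong, subst nn_integral_distr) auto
    also have "\<dots> = (\<integral>\<^sup>+m. F m \<partial>beta_gamma_law \<G> \<theta> q)"
      using q by (intro nn_integral_beta_scaled_beta_gamma) auto
    finally show "(\<integral>\<^sup>+m. F m \<partial>distr N bf_measures (\<lambda>\<omega>. scale_measure (ennreal (U \<omega>)) (\<nu> (P \<omega>) \<omega>)))
        = (\<integral>\<^sup>+m. F m \<partial>beta_gamma_law \<G> \<theta> q)" .
  qed simp
  finally show ?thesis .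
qed

end

theorem theorem5p1:
  fixes H :: "'y::polish_space measure" and \<theta> q :: real
    and \<G> :: "'y measure measure"
    and M :: "'a measure" and X :: "'a \<Rightarrow> 'y measure"
    and N :: "'b measure"
  assumes "prob_space H" and "sets H = sets borel" and "non_atomic H"
    and "\<theta> > 0" and "q > 0"
    and "gamma_process_law \<theta> H \<G>"
    and "prob_space M" and "prob_space N"
    and "has_law M bf_measures X (beta_gamma_law \<G> \<theta> q)"
  shows
    "(\<forall>n P U \<mu> G Y.
        \<theta> + real n - q > 0 \<longrightarrow>
        random_partition N \<theta> n P \<longrightarrow>
        (\<forall>p. partition_on {1..n} p \<longrightarrow>
           cell_variables (uniform_measure N {\<omega> \<in> space N. P \<omega> = p}) p
             (beta_dist q (\<theta> + real n - q)) \<G> H U \<mu> G Y) \<longrightarrow>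
        distr M bf_measures X =
        distr N bf_measures (\<lambda>\<omega>.
          add_measure
            (scale_measure (ennreal (U \<omega>)) (\<mu> \<omega>))
            (scale_measure (ennreal (U \<omega>))
              (atoms_measure (P \<omega>) (\<lambda>C. ennreal (G C \<omega>)) (\<lambda>C. Y C \<omega>)))))
     \<and>
     (\<forall>U \<mu>. \<theta> - q > 0 \<longrightarrow>
        has_law N borel U (beta_dist q (\<theta> - q)) \<longrightarrow>
        has_law N bf_measures \<mu> \<G> \<longrightarrow>
        indep_rvs N borel U bf_measures \<mu> \<longrightarrow>
        distr M bf_measures X =
        distr N bf_measures (\<lambda>\<omega>. scale_measure (ennreal (U \<omega>)) (\<mu> \<omega>)))
     \<and>
     (\<forall>Tq P\<theta>.
        has_law N borel Tq (gamma_dist q) \<longrightarrow>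
        has_law N bf_measures P\<theta> (dirichlet_law \<G>) \<longrightarrow>
        indep_rvs N borel Tq bf_measures P\<theta> \<longrightarrow>
        distr M bf_measures X =
        distr N bf_measures (\<lambda>\<omega>. scale_measure (ennreal (Tq \<omega>)) (P\<theta> \<omega>)))
     \<and>
     (\<forall>T\<theta> Tq \<mu>.
        has_law M borel T\<theta> (gamma_dist \<theta>) \<longrightarrow>
        indep_rvs M borel T\<theta> bf_measures X \<longrightarrow>
        has_law N borel Tq (gamma_dist q) \<longrightarrow>
        has_law N bf_measures \<mu> \<G> \<longrightarrow>
        indep_rvs N borel Tq bf_measures \<mu> \<longrightarrow>
        distr M bf_measures (\<lambda>\<omega>. scale_measure (ennreal (T\<theta> \<omega>)) (X \<omega>)) =
        distr N bf_measures (\<lambda>\<omega>. scale_measure (ennreal (Tq \<omega>)) (\<mu> \<omega>)))"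
proof -
  interpret gamma_process \<theta> H \<G>
    by (rule gamma_process.intro) fact+
  have X_law: "distr M bf_measures X = beta_gamma_law \<G> \<theta> q"
    using assms by (simp add: has_law_def)
  show ?thesis
  proof (intro conjI allI impI)
    fix n P U \<mu> G Y
    assume "\<theta> + real n - q > 0" "random_partition N \<theta> n P"
      "\<forall>p. partition_on {1..n} p \<longrightarrow> cell_variables (uniform_measure N {\<omega> \<in> space N. P \<omega> = p}) p
             (beta_dist q (\<theta> + real n - q)) \<G> H U \<mu> G Y"
    then show "distr M bf_measures X = distr N bf_measures (\<lambda>\<omega>. add_measure (scale_measure (ennreal (U \<omega>)) (\<mu> \<omega>))
            (scale_measure (ennreal (U \<omega>)) (atoms_measure (P \<omega>) (\<lambda>C. ennreal (G C \<omega>)) (\<lambda>C. Y C \<omega>))))"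
      unfolding X_law using assms by (intro law_random_partition_mixture[symmetric]) auto
  next
    fix U \<mu>
    assume "\<theta> - q > 0" "has_law N borel U (beta_dist q (\<theta> - q))" "has_law N bf_measures \<mu> \<G>"
      "indep_rvs N borel U bf_measures \<mu>"
    then show "distr M bf_measures X = distr N bf_measures (\<lambda>\<omega>. scale_measure (ennreal (U \<omega>)) (\<mu> \<omega>))"
      unfolding X_law using assms by (intro law_beta_times[where r=\<theta>, symmetric]) (auto simp: \<G>_eq_beta_gamma)
  next
    fix Tq P\<theta>
    assume "has_law N borel Tq (gamma_dist q)" "has_law N bf_measures P\<theta> (dirichlet_law \<G>)"
      "indep_rvs N borel Tq bf_measures P\<theta>"
    then show "distr M bf_measures X = distr N bf_measures (\<lambda>\<omega>. scale_measure (ennreal (Tq \<omega>)) (P\<theta> \<omega>))"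
      unfolding X_law using assms by (intro law_gamma_times_dirichlet[symmetric]) auto
  next
    fix T\<theta> Tq \<mu>
    assume "has_law M borel T\<theta> (gamma_dist \<theta>)" "indep_rvs M borel T\<theta> bf_measures X"
      "has_law N borel Tq (gamma_dist q)" "has_law N bf_measures \<mu> \<G>" "indep_rvs N borel Tq bf_measures \<mu>"
    then show "distr M bf_measures (\<lambda>\<omega>. scale_measure (ennreal (T\<theta> \<omega>)) (X \<omega>)) =
        distr N bf_measures (\<lambda>\<omega>. scale_measure (ennreal (Tq \<omega>)) (\<mu> \<omega>))"
      using assms by (intro law_gamma_times_symmetric[where a=\<theta> and b=q]) (auto simp: \<G>_eq_beta_gamma)
  qed
qed

end
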